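(* Let $n\ge 1$. The assignment $$(f,g)\ \longmapsto\ G(x_0,\dots,x_{n+1})=\delta\Big(\frac{x_{n+1}}{x_0}-f\Big(\frac{x_1}{x_0},\dots,\frac{x_n}{x_0}\Big)\Big)\,g\Big(\frac{x_1}{x_0},\dots,\frac{x_n}{x_0}\Big)\,x_0^{-\frac{n+2}{2}}$$ is a one-to-one correspondence between (i) admissible pairs of germs of functions $(f,g)$ in $n$ variables, and (ii) non-zero germs $G$ of distributions in $n+2$ variables which are smooth densities, independent of $\hbar$, on a smooth conical germ $C$ of a hypersurface in $\mathbb{A}^{n+2}$ at a point $p\in\mathbb{A}^{n+2}\setminus\{0\}$ satisfying the constraints (1) the projectivization of $C$ is non-degenerate, (2) the coordinate $x_0$ of $p$ is non-zero, (3) the tangent space $T_pC$ does not contain the vector $(0,\dots,0,1)$; which are homogeneous of degree $-\frac{n+2}{2}$; and whose formal Fourier transform is, up to the formal factor $(2\pi\hbar)^{\frac{n+2}{2}}$, a distribution with the same properties on the dual space (coordinates $y_0,\dots,y_{n+1}$, with the roles of the indices $0$ and $n+1$ exchanged), i.e. $$\int G(x_0,\dots,x_{n+1})\,e^{\frac1\hbar(x_0y_0+\dots+x_{n+1}y_{n+1})}dx_0\cdots dx_{n+1}=(2\pi\hbar)^{\frac{n+2}{2}}\,\hat G(y_0,\dots,y_{n+1}),$$ $$\hat G(y_0,\dots,y_{n+1})=\delta\Big(\frac{y_0}{y_{n+1}}+\hat f\Big(\frac{y_1}{y_{n+1}},\dots,\frac{y_n}{y_{n+1}}\Big)\Big)\,\hat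 g\Big(\frac{y_1}{y_{n+1}},\dots,\frac{y_n}{y_{n+1}}\Big)\,y_{n+1}^{-\frac{n+2}{2}}$$ for some germs of functions $\hat f,\hat g$ in $n$ variables independent of $\hbar$.
   Context: **Ground field and germs.** $\mathbf k$ is a field of characteristic $0$; functions are germs of analytic functions (if $\mathbf k=\mathbb R,\mathbb C$) or formal germs (power series) over $\mathbf k$. Germs $f$ are taken at points where $\det(\partial_i\partial_jf)\ne0$. Branches of $x_0^{1/2}$, $y_{n+1}^{1/2}$ are fixed. **Formal integrals and admissible pairs.** Let $f$ be a function of $x=(x_1,\dots,x_n)$ whose Hessian matrix $H=(\partial_i\partial_j f)$ has $\det H\not\equiv 0$, and $g$ another function (possibly a power series in $\hbar$, treated $\hbar$-linearly). At points $t$ with $\det H(t)\neq0$ put $R_t(u)=f(t+u)-f(t)-\sum_i\partial_if(t)u_i-\frac12\sum_{i,j}H_{ij}(t)u_iu_j$, $\Delta_t=-\frac12\sum_{i,j}(H(t)^{-1})_{ij}\partial_{u_i}\partial_{u_j}$, and $$A_k(t)=\sum_{v=0}^{2k}\frac{1}{v!\,(k+v)!}\,\Delta_t^{\,k+v}\big[g(t+u)R_t(u)^v\big]\Big|_{u=0},\qquad k\ge0.$$ The formal integral $\int g\,e^{(f+x\cdot y)/\hbar}dx_1\cdots dx_n$ is by definition $(2\pi\hbar)^{n/2}e^{\hat f(y)/\hbar}\det(-H(t))^{-1/2}\sum_{k\ge0}A_k(t)\hbar^k$, where $t=t(y)$ solves $y_i=-\partial_if(t)$ and $\hat f(y)=f(t)+t\cdot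 y$ (stationary phase expansion). The pair $(f,g)$ is *admissible* if $\det H\not\equiv0$, $g\not\equiv 0$ and $A_k\equiv0$ for all $k\ge1$; equivalently $\int g\,e^{(f+x\cdot y)/\hbar}dx=(2\pi\hbar)^{n/2}\hat g(y)e^{\hat f(y)/\hbar}$ with $\hat g(y)=g(t)\det(-H(t))^{-1/2}$ independent of $\hbar$. All identities between formal integrals are understood up to multiplication by a fourth root of unity. **Delta functions.** Expressions with $\delta$ are formal wave functions, with the usual rules: $\delta(x)=\frac1{2\pi\hbar}\int e^{xy/\hbar}dy$, $\delta(cx)=c^{-1}\delta(x)$, and $h(x')e^{S(x')/\hbar}\delta(x_N-\varphi(x'))$, $x'=(x_1,\dots,x_{N-1})$, is the object whose formal Fourier transform $\int(\cdot)e^{x_Ny_N/\hbar}dx_N$ in $x_N$ is $h(x')e^{(S(x')+\varphi(x')y_N)/\hbar}$. Two such expressions are equal if, after formal (inverse) Fourier transforms in some of the variables bringing both to the form (power series in $\hbar$)$\cdot e^{\text{function}/\hbar}$ in the same variables, they coincide. Multiple formal integrals may be computed iteratively (formal Fubini). **Non-degeneracy.** A germ of a smooth hypersurface $\Sigma\subset\mathbb P(V)$ is non-degenerate if the Gauss map $\Sigma\to\mathbb P(V^* )$, $x\mapsto T_x\Sigma$, is an immersion. A conical germ is a germ of a hypersurface invariant under rescaling of $\mathbb A^{n+2}$ (taken along the ray through $p$).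
   Formalization: Over a general field k the square roots x_0^{1/2}, y_{n+1}^{1/2}, det(-H)^{-1/2} are taken in an algebraic closure, and ĝ is a germ over k times a constant whose square lies in k; with ĝ over k the claim fails, e.g. for k = Q, f = x^2, g = 1. *)

theory Defs
  imports
    "HOL-Analysis.Analysis"
    "HOL-Computational_Algebra.Formal_Power_Series"
    "HOL-Algebra.Algebraic_Closure_Type"
begin

section \<open>Formal power series in finitely many variables\<close>

text \<open>
  Series in variables indexed by the finite type \<open>'v\<close>; a monomial is given by its exponent
  function.  A germ at a point \<open>p\<close> is represented by its expansion in the local coordinates
  \<open>x i - p i\<close>.
\<close>

typedef ('v, 'a) mps = "UNIV :: (('v \<Rightarrow> nat) \<Rightarrow> 'a) set"
  morphisms mcoeff Abs_mps ..

lemma mcoeff_Abs_mps [simp]: "mcoeff (Abs_mps f) m = f m"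
  by (simp add: Abs_mps_inverse)

lemma mps_eqI: "(\<And>m. mcoeff a m = mcoeff b m) \<Longrightarrow> a = b"
  by (metis ext mcoeff_inject)

abbreviation mle :: "('v \<Rightarrow> nat) \<Rightarrow> ('v \<Rightarrow> nat) set" where
  "mle m \<equiv> {p. \<forall>i. p i \<le> m i}"

lemma finite_mle [simp]: "finite (mle (m :: 'v::finite \<Rightarrow> nat))"
proof -
  have "mle m = PiE UNIV (\<lambda>i. {..m i})" by (auto simp: PiE_UNIV_domain)
  then show ?thesis by (simp add: finite_PiE)
qed

instantiation mps :: (finite, comm_ring_1) comm_ring_1
begin

definition zero_mps :: "('a, 'b) mps" where "0 = Abs_mps (\<lambda>_. 0)"
definition one_mps :: "('a, 'b) mps" where "1 = Abs_mps (\<lambda>m. if m = (\<lambda>_. 0) then 1 else 0)"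
definition plus_mps :: "('a, 'b) mps \<Rightarrow> ('a, 'b) mps \<Rightarrow> ('a, 'b) mps" where
  "a + b = Abs_mps (\<lambda>m. mcoeff a m + mcoeff b m)"
definition uminus_mps :: "('a, 'b) mps \<Rightarrow> ('a, 'b) mps" where
  "- a = Abs_mps (\<lambda>m. - mcoeff a m)"
definition minus_mps :: "('a, 'b) mps \<Rightarrow> ('a, 'b) mps \<Rightarrow> ('a, 'b) mps" where
  "a - b = Abs_mps (\<lambda>m. mcoeff a m - mcoeff b m)"
definition times_mps :: "('a, 'b) mps \<Rightarrow> ('a, 'b) mps \<Rightarrow> ('a, 'b) mps" where
  "a * b = Abs_mps (\<lambda>m. \<Sum>p\<in>mle m. mcoeff a p * mcoeff b (\<lambda>i. m i - p i))"

instance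
proof
  fix a b c :: "('a, 'b) mps"
  show "a * b * c = a * (b * c)"
  proof (rule mps_eqI)
    fix m :: "'a \<Rightarrow> nat"
    let ?t = "\<lambda>p q. mcoeff a q * (mcoeff b (\<lambda>i. p i - q i) * mcoeff c (\<lambda>i. m i - p i))"
    let ?s = "\<lambda>q r. mcoeff a q * (mcoeff b r * mcoeff c (\<lambda>i. m i - q i - r i))"
    have "mcoeff (a * b * c) m = (\<Sum>p\<in>mle m. \<Sum>q\<in>mle p. ?t p q)"
      by (simp add: times_mps_def sum_distrib_right mult.assoc)
    also have "\<dots> = (\<Sum>(p, q)\<in>(SIGMA p:mle m. mle p). ?t p q)"
      by (simp add: sum.Sigma)
    also have "\<dots> = (\<Sum>(q, r)\<in>(SIGMA q:mle m. mle (\<lambda>i. m i - q i)). ?s q r)"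
    proof (rule sum.reindex_bij_witness
        [where i = "\<lambda>(q, r). (\<lambda>i. q i + r i, q)" and j = "\<lambda>(p, q). (q, \<lambda>i. p i - q i)"])
      fix x assume x: "x \<in> (SIGMA p:mle m. mle p)"
      obtain p q where pq: "x = (p, q)" by (cases x)
      have le: "\<And>i. q i \<le> p i" "\<And>i. p i \<le> m i" using x pq by auto
      show "(\<lambda>(q, r). (\<lambda>i. q i + r i, q)) ((\<lambda>(p, q). (q, \<lambda>i. p i - q i)) x) = x"
        using le pq by simp
      show "(\<lambda>(p, q). (q, \<lambda>i. p i - q i)) x \<in> (SIGMA q:mle m. mle (\<lambda>i. m i - q i))"
        using le pq by (auto intro: order.trans diff_le_mono)
      show "(case (\<lambda>(p, q). (q, \<lambda>i. p i - q i)) x of (q, r) \<Rightarrow> ?s q r)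
          = (case x of (p, q) \<Rightarrow> ?t p q)"
        using le pq by simp
    next
      fix y assume y: "y \<in> (SIGMA q:mle m. mle (\<lambda>i. m i - q i))"
      obtain q r where qr: "y = (q, r)" by (cases y)
      have le: "\<And>i. q i \<le> m i" "\<And>i. r i \<le> m i - q i" using y qr by auto
      show "(\<lambda>(p, q). (q, \<lambda>i. p i - q i)) ((\<lambda>(q, r). (\<lambda>i. q i + r i, q)) y) = y"
        using qr by simp
      have "q i + r i \<le> m i" for i using le(1)[of i] le(2)[of i] by linarith
      then show "(\<lambda>(q, r). (\<lambda>i. q i + r i, q)) y \<in> (SIGMA p:mle m. mle p)"
        using qr by auto
    qed
    also have "\<dots> = (\<Sum>q\<in>mle m. \<Sum>r\<in>mle (\<lambda>i. m i - q i). ?s q r)"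
      by (simp add: sum.Sigma)
    also have "\<dots> = mcoeff (a * (b * c)) m"
      by (simp add: times_mps_def sum_distrib_left)
    finally show "mcoeff (a * b * c) m = mcoeff (a * (b * c)) m" .
  qed
  show "a * b = b * a"
  proof (rule mps_eqI)
    fix m :: "'a \<Rightarrow> nat"
    have "(\<Sum>p\<in>mle m. mcoeff a p * mcoeff b (\<lambda>i. m i - p i))
        = (\<Sum>p\<in>mle m. mcoeff b p * mcoeff a (\<lambda>i. m i - p i))"
      by (rule sum.reindex_bij_witness
          [where i = "\<lambda>p i. m i - p i" and j = "\<lambda>p i. m i - p i"]) (auto simp: mult.commute)
    then show "mcoeff (a * b) m = mcoeff (b * a) m" by (simp add: times_mps_def)
  qed
  show "1 * a = a"
  proof (rule mps_eqI)
    fix m :: "'a \<Rightarrow> nat"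
    have "mcoeff (1 * a) m = (\<Sum>p\<in>mle m. if p = (\<lambda>_. 0) then mcoeff a m else 0)"
      unfolding times_mps_def one_mps_def mcoeff_Abs_mps by (rule sum.cong) auto
    then show "mcoeff (1 * a) m = mcoeff a m" by (simp add: sum.delta)
  qed
  show "(a + b) * c = a * c + b * c"
    by (rule mps_eqI) (simp add: times_mps_def plus_mps_def distrib_right sum.distrib)
  show "a + b + c = a + (b + c)" "a + b = b + a" "0 + a = a" "- a + a = 0" "a - b = a + - b"
    by (rule mps_eqI; simp add: plus_mps_def zero_mps_def uminus_mps_def minus_mps_def)+
  have "mcoeff (0 :: ('a, 'b) mps) (\<lambda>_. 0) \<noteq> mcoeff 1 (\<lambda>_. 0)"
    by (simp add: zero_mps_def one_mps_def)
  then show "(0 :: ('a, 'b) mps) \<noteq> 1" by metis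
qed

end

definition cterm :: "('v, 'a) mps \<Rightarrow> 'a" where
  "cterm a = mcoeff a (\<lambda>_. 0)"

definition mconst :: "'a::zero \<Rightarrow> ('v, 'a) mps" where
  "mconst c = Abs_mps (\<lambda>m. if m = (\<lambda>_. 0) then c else 0)"

definition mvar :: "'v \<Rightarrow> ('v, 'a::zero_neq_one) mps" where
  "mvar i = Abs_mps (\<lambda>m. if m = (\<lambda>_. 0)(i := 1) then 1 else 0)"

definition mmap :: "('a \<Rightarrow> 'b) \<Rightarrow> ('v, 'a) mps \<Rightarrow> ('v, 'b) mps" where
  "mmap F a = Abs_mps (\<lambda>m. F (mcoeff a m))"

definition mderiv :: "'v \<Rightarrow> ('v, 'a::semiring_1) mps \<Rightarrow> ('v, 'a) mps" where
  "mderiv i a = Abs_mps (\<lambda>m. of_nat (Suc (m i)) * mcoeff a (m(i := Suc (m i))))"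

definition mdeg :: "('v::finite \<Rightarrow> nat) \<Rightarrow> nat" where
  "mdeg m = (\<Sum>i\<in>UNIV. m i)"

text \<open>
  Substitution, meant for \<open>b\<close> without constant terms: then monomials of degree larger than
  \<open>mdeg m\<close> contribute nothing to the coefficient of \<open>m\<close>, so the sum below is complete.
\<close>
definition msubst :: "('v::finite, 'a::comm_ring_1) mps \<Rightarrow> ('v \<Rightarrow> ('w::finite, 'a) mps) \<Rightarrow> ('w, 'a) mps"
  where "msubst a b =
    Abs_mps (\<lambda>m. \<Sum>\<alpha> | mdeg \<alpha> \<le> mdeg m. mcoeff a \<alpha> * mcoeff (\<Prod>i\<in>UNIV. b i ^ \<alpha> i) m)"

definition mrename :: "('v \<Rightarrow> 'w) \<Rightarrow> ('v::finite, 'a::comm_ring_1) mps \<Rightarrow> ('w::finite, 'a) mps" where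
  "mrename r a = msubst a (\<lambda>i. mvar (r i))"

text \<open>The coordinate function \<open>x i\<close> as a germ at \<open>p\<close>.\<close>
definition coord :: "('v \<Rightarrow> 'a) \<Rightarrow> 'v \<Rightarrow> ('v::finite, 'a::comm_ring_1) mps" where
  "coord p i = mconst (p i) + mvar i"

definition indep_of :: "'v \<Rightarrow> ('v, 'a::zero) mps \<Rightarrow> bool" where
  "indep_of i a \<longleftrightarrow> (\<forall>m. m i \<noteq> 0 \<longrightarrow> mcoeff a m = 0)"

text \<open>The binomial series \<open>(1 + s i / c) ^ d\<close>, that is, \<open>(x i / c) ^ d\<close> at a point with
  \<open>x i = c\<close>, on the branch with value \<open>1\<close> there.\<close>
definition mpowr :: "'v \<Rightarrow> 'a \<Rightarrow> 'a \<Rightarrow> ('v, 'a::field_char_0) mps" where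
  "mpowr i c d = Abs_mps (\<lambda>m. if \<forall>j. j \<noteq> i \<longrightarrow> m j = 0 then (d gchoose m i) / c ^ m i else 0)"


section \<open>Formal and analytic germs\<close>

text \<open>
  The germs over the field \<open>'k\<close> are either all formal power series, or, when \<open>'k\<close> is identified
  with the real or complex numbers by a field embedding into \<^typ>\<open>complex\<close>, the power series
  converging absolutely on some polydisc.
\<close>

datatype 'k setting = Formal | Analytic "'k \<Rightarrow> complex"

fun valid_setting :: "'k::field_char_0 setting \<Rightarrow> bool" where
  "valid_setting Formal = True"
| "valid_setting (Analytic \<iota>) =
    (\<iota> 1 = 1 \<and> (\<forall>x y. \<iota> (x + y) = \<iota> x + \<iota> y) \<and> (\<forall>x y. \<iota> (x * y) = \<iota> x * \<iota> y) \<and>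
     (range \<iota> = \<real> \<or> range \<iota> = UNIV))"

fun germ :: "'k::field_char_0 setting \<Rightarrow> ('v::finite, 'k) mps \<Rightarrow> bool" where
  "germ Formal a = True"
| "germ (Analytic \<iota>) a = (\<exists>r>0. (\<lambda>m. norm (\<iota> (mcoeff a m)) * r ^ mdeg m) summable_on UNIV)"


section \<open>Formal integrals\<close>

text \<open>
  The integrand \<open>g e\<^bsup>f/\<hbar>\<^esup>\<close> may depend on further variables as parameters: all variables are
  indexed by \<open>'v\<close>, and the injection \<open>e :: 'n \<Rightarrow> 'v\<close> selects the integration variables.
\<close>

definition hess :: "('n \<Rightarrow> 'v) \<Rightarrow> ('v::finite, 'a::comm_ring_1) mps \<Rightarrow> ('v, 'a) mps ^ 'n ^ 'n" where
  "hess e f = (\<chi> i j. mderiv (e i) (mderiv (e j) f))"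

text \<open>
  Functions of \<open>(t, u)\<close> are series in variables of type \<open>'v + 'n\<close>, where \<open>Inl\<close> stands for the
  local coordinates of \<open>t\<close> (and the parameters) and \<open>Inr\<close> for \<open>u\<close>.
\<close>

definition shift :: "('n \<Rightarrow> 'v) \<Rightarrow> ('v::finite, 'a::comm_ring_1) mps \<Rightarrow> ('v + 'n::finite, 'a) mps" where
  "shift e f = msubst f (\<lambda>j. mvar (Inl j) + (\<Sum>i | e i = j. mvar (Inr i)))"

definition at_u0 :: "('v::finite + 'n::finite, 'a::comm_ring_1) mps \<Rightarrow> ('v, 'a) mps" where
  "at_u0 a = msubst a (case_sum mvar (\<lambda>_. 0))"

definition stat_rem :: "('n \<Rightarrow> 'v) \<Rightarrow> ('v::finite, 'a::field_char_0) mps \<Rightarrow> ('v + 'n::finite, 'a) mps" where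
  "stat_rem e f = shift e f - mrename Inl f
     - (\<Sum>i\<in>UNIV. mrename Inl (mderiv (e i) f) * mvar (Inr i))
     - mconst (1 / 2) * (\<Sum>i\<in>UNIV. \<Sum>j\<in>UNIV. mrename Inl (hess e f $ i $ j) * mvar (Inr i) * mvar (Inr j))"

definition stat_delta ::
    "('n \<Rightarrow> 'v) \<Rightarrow> ('v::finite, 'a::field_char_0) mps \<Rightarrow> ('v + 'n::finite, 'a) mps \<Rightarrow> ('v + 'n, 'a) mps" where
  "stat_delta e f a = - mconst (1 / 2) *
     (\<Sum>i\<in>UNIV. \<Sum>j\<in>UNIV.
        mrename Inl (matrix_inv (hess e f) $ i $ j) * mderiv (Inr i) (mderiv (Inr j) a))"

text \<open>The coefficients \<open>A\<^sub>k(t)\<close> of the stationary phase expansion.\<close>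
definition stat_coeff ::
    "('n::finite \<Rightarrow> 'v) \<Rightarrow> ('v::finite, 'a::field_char_0) mps \<Rightarrow> ('v, 'a) mps \<Rightarrow> nat \<Rightarrow> ('v, 'a) mps" where
  "stat_coeff e f g k =
     (\<Sum>v\<le>2 * k. mconst (1 / (fact v * fact (k + v))) *
        at_u0 ((stat_delta e f ^^ (k + v)) (shift e g * stat_rem e f ^ v)))"

text \<open>
  \<open>Wave z m S a\<close> is the germ \<open>(2\<pi>\<hbar>)\<^bsup>m/2\<^esup> a e\<^bsup>S/\<hbar>\<^esup>\<close> at the point \<open>z\<close>; the amplitude \<open>a\<close> is a power
  series in \<open>\<hbar>\<close> whose coefficients are germs at \<open>z\<close>.
\<close>
datatype ('v, 'a) wave =
  Wave (wbase: "'v \<Rightarrow> 'a") (hpow: int) (phase: "('v, 'a) mps") (ampl: "('v, 'a) mps fps")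

text \<open>Equality up to a fourth root of unity.\<close>
definition wave_eq :: "('v::finite, 'a::field) wave \<Rightarrow> ('v, 'a) wave \<Rightarrow> bool" where
  "wave_eq w w' \<longleftrightarrow> wbase w = wbase w' \<and> hpow w = hpow w' \<and> phase w = phase w' \<and>
     (\<exists>\<zeta>. \<zeta> ^ 4 = 1 \<and> ampl w = fps_const (mconst \<zeta>) * ampl w')"

text \<open>
  \<open>w\<close> is the formal integral of \<open>g e\<^bsup>(f + x\<cdot>y)/\<hbar>\<^esup>\<close> over the variables \<open>x i\<close> selected by \<open>e\<close>, where
  \<open>f\<close>, \<open>g\<close> are germs at \<open>z\<close>.  In \<open>w\<close> the variable indexed by \<open>e i\<close> is \<open>y i\<close>, the parameters keep
  their names.  The substitution \<open>\<tau>\<close> is the solution \<open>t(y)\<close> of \<open>y i = - \<partial>\<^sub>i f (t)\<close> in local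
  coordinates, and \<open>\<rho>\<close> is \<open>det (- H) \<^bsup>-1/2\<^esup>\<close>.
\<close>
definition is_formal_integral ::
    "('n::finite \<Rightarrow> 'v) \<Rightarrow> ('v::finite \<Rightarrow> 'a::field_char_0) \<Rightarrow> ('v, 'a) mps \<Rightarrow> ('v, 'a) mps \<Rightarrow> ('v, 'a) wave \<Rightarrow> bool" where
  "is_formal_integral e z f g w \<longleftrightarrow>
     cterm (det (hess e f)) \<noteq> 0 \<and>
     (\<forall>i. wbase w (e i) = - cterm (mderiv (e i) f)) \<and>
     (\<forall>j. j \<notin> range e \<longrightarrow> wbase w j = z j) \<and>
     hpow w = int CARD('n) \<and>
     (\<exists>\<tau> \<rho>. (\<forall>j. cterm (\<tau> j) = 0) \<and> (\<forall>j. j \<notin> range e \<longrightarrow> \<tau> j = mvar j) \<and>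
        (\<forall>i. coord (wbase w) (e i) = - msubst (mderiv (e i) f) \<tau>) \<and>
        \<rho>\<^sup>2 * det (- hess e f) = 1 \<and>
        phase w = msubst f \<tau>
          + (\<Sum>i\<in>UNIV. (mconst (z (e i)) + \<tau> (e i)) * coord (wbase w) (e i)) \<and>
        ampl w = Abs_fps (\<lambda>k. msubst (\<rho> * stat_coeff e f g k) \<tau>))"

text \<open>Admissible pairs \<open>(f, g)\<close> of germs at a point \<open>t\<close> where the Hessian of \<open>f\<close> is invertible.\<close>
definition admissible_pairs ::
    "'k::field_char_0 setting \<Rightarrow> (('n::finite \<Rightarrow> 'k) \<times> ('n, 'k) mps \<times> ('n, 'k) mps) set" where
  "admissible_pairs S = {(t, f, g). germ S f \<and> germ S g \<and>
     cterm (det (hess (\<lambda>i. i) f)) \<noteq> 0 \<and> g \<noteq> 0 \<and> (\<forall>k\<ge>1. stat_coeff (\<lambda>i. i) f g k = 0)}"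


section \<open>Distributions on hypersurfaces\<close>

text \<open>
  The pair \<open>(\<phi>, h)\<close> stands for \<open>h \<delta>(\<phi>)\<close>.  By \<open>\<delta>(u \<phi>) = u\<^sup>-\<^sup>1 \<delta>(\<phi>)\<close> and \<open>\<phi> \<delta>(\<phi>) = 0\<close>, the germs
  \<open>h \<delta>(\<phi>)\<close> and \<open>h' \<delta>(\<phi>')\<close> on a smooth hypersurface agree iff \<open>\<phi> = u \<phi>'\<close> for a unit \<open>u\<close> and \<open>h = u h'\<close>
  on the hypersurface.
\<close>
definition delta_eq ::
    "('v::finite, 'a::field) mps \<times> ('v, 'a) mps \<Rightarrow> ('v, 'a) mps \<times> ('v, 'a) mps \<Rightarrow> bool" where
  "delta_eq G G' \<longleftrightarrow> (\<exists>u w. cterm u \<noteq> 0 \<and> fst G = u * fst G' \<and> snd G = u * snd G' + w * fst G')"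

definition smooth_hypersurface :: "('v, 'a::field) mps \<Rightarrow> bool" where
  "smooth_hypersurface \<phi> \<longleftrightarrow> cterm \<phi> = 0 \<and> (\<exists>i. cterm (mderiv i \<phi>) \<noteq> 0)"

definition tangent_space :: "('v::finite, 'a::field) mps \<Rightarrow> ('v \<Rightarrow> 'a) set" where
  "tangent_space \<phi> = {v. (\<Sum>i\<in>UNIV. cterm (mderiv i \<phi>) * v i) = 0}"

text \<open>
  Rescaling \<open>x \<mapsto> (1 + \<epsilon>) x\<close> in local coordinates at \<open>p\<close>; the variable \<open>\<epsilon>\<close> is indexed by \<^const>\<open>None\<close>.
\<close>
definition rescale :: "('v \<Rightarrow> 'a) \<Rightarrow> ('v::finite, 'a::comm_ring_1) mps \<Rightarrow> ('v option, 'a) mps" where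
  "rescale p a = msubst a (\<lambda>i. mvar (Some i) + mvar None * (mconst (p i) + mvar (Some i)))"

definition conical :: "('v \<Rightarrow> 'a) \<Rightarrow> ('v::finite, 'a::field) mps \<Rightarrow> bool" where
  "conical p \<phi> \<longleftrightarrow> (\<exists>u. rescale p \<phi> = u * mrename Some \<phi>)"

text \<open>\<open>h(\<lambda>x) \<delta>(\<phi>(\<lambda>x)) = \<lambda>\<^sup>d h(x) \<delta>(\<phi>(x))\<close> for \<open>\<lambda> = 1 + \<epsilon>\<close>.\<close>
definition homogeneous :: "'a \<Rightarrow> ('v \<Rightarrow> 'a) \<Rightarrow> ('v::finite, 'a::field_char_0) mps \<Rightarrow> ('v, 'a) mps \<Rightarrow> bool" where
  "homogeneous d p \<phi> h \<longleftrightarrow>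
     delta_eq (rescale p \<phi>, rescale p h) (mrename Some \<phi>, mpowr None 1 d * mrename Some h)"

text \<open>
  The Gauss map of the projectivization of the cone \<open>\<phi> = 0\<close> is induced by \<open>x \<mapsto> [d\<phi>(x)]\<close>.  Its
  differential at \<open>[p]\<close> is the map from the tangent space of the cone modulo \<open>p\<close> to the dual
  space modulo \<open>d\<phi>(p)\<close> given by the second derivative of \<open>\<phi>\<close>; it has to be injective.
\<close>
definition gauss_immersion :: "('v \<Rightarrow> 'a) \<Rightarrow> ('v::finite, 'a::field) mps \<Rightarrow> bool" where
  "gauss_immersion p \<phi> \<longleftrightarrow>
     (\<forall>v\<in>tangent_space \<phi>.
        (\<exists>c. \<forall>i. (\<Sum>j\<in>UNIV. cterm (mderiv j (mderiv i \<phi>)) * v j) = c * cterm (mderiv i \<phi>)) \<longrightarrow>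
        (\<exists>c. \<forall>i. v i = c * p i))"

text \<open>Indices of the coordinates \<open>x\<^sub>0, x\<^sub>1, \<dots>, x\<^sub>n, x\<^bsub>n+1\<^esub>\<close>, with \<open>n = CARD('n)\<close>.\<close>
datatype 'n amb = First | Mid 'n | Last

lemma UNIV_amb: "UNIV = insert First (insert Last (range Mid))"
  by (auto intro: amb.exhaust)

instance amb :: (finite) finite
  by standard (simp add: UNIV_amb)

text \<open>
  A germ of a distribution: base point, equation of the hypersurface, density.  Square roots of
  constants are taken in the algebraic closure, so the density has coefficients there.
\<close>
type_synonym ('n, 'k) distr = "('n amb \<Rightarrow> 'k) \<times> ('n amb, 'k) mps \<times> ('n amb, 'k alg_closure) mps"

definition hdeg :: "'n::finite itself \<Rightarrow> 'a::field_char_0" where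
  "hdeg _ = - (of_nat (CARD('n) + 2) / 2)"

text \<open>
  Non-zero densities, homogeneous of degree \<open>-(n+2)/2\<close>, on cones with non-degenerate
  projectivization; \<open>i\<^sub>0\<close>, \<open>i\<^sub>1\<close> play the roles of the indices \<open>0\<close>, \<open>n + 1\<close>.  The density is the
  constant \<open>c\<close> times a germ over \<open>'k\<close>.
\<close>
definition cone_density ::
    "'k::field_char_0 setting \<Rightarrow> 'n::finite amb \<Rightarrow> 'n amb \<Rightarrow> 'k alg_closure \<Rightarrow> ('n, 'k) distr \<Rightarrow> bool" where
  "cone_density S i\<^sub>0 i\<^sub>1 c G \<longleftrightarrow> (case G of (p, \<phi>, h) \<Rightarrow>
     p \<noteq> (\<lambda>_. 0) \<and> germ S \<phi> \<and> smooth_hypersurface \<phi> \<and> conical p \<phi> \<and>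
     gauss_immersion p \<phi> \<and> p i\<^sub>0 \<noteq> 0 \<and> (\<lambda>_. 0)(i\<^sub>1 := 1) \<notin> tangent_space \<phi> \<and>
     (\<exists>h\<^sub>0. germ S h\<^sub>0 \<and> h = mconst c * mmap to_ac h\<^sub>0) \<and>
     \<not> (\<exists>w. h = w * mmap to_ac \<phi>) \<and>
     homogeneous (hdeg TYPE('n)) (to_ac \<circ> p) (mmap to_ac \<phi>) h)"

text \<open>
  \<open>fourier_related G G'\<close> states \<open>\<integral> G(x) e\<^bsup>x\<cdot>y/\<hbar>\<^esup> dx = (2\<pi>\<hbar>)\<^bsup>(n+2)/2\<^esup> G'(y)\<close>, with both sides
  brought to the form of wave functions in the variables \<open>x\<^sub>0, y\<^sub>1, \<dots>, y\<^bsub>n+1\<^esub>\<close>.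
  Write \<open>G = \<eta> \<delta>(x\<^bsub>n+1\<^esub> - \<psi>)\<close> and \<open>G' = \<eta>' \<delta>(y\<^sub>0 - \<psi>')\<close> with \<open>\<psi>, \<eta>\<close> independent of \<open>x\<^bsub>n+1\<^esub>\<close> and
  \<open>\<psi>', \<eta>'\<close> independent of \<open>y\<^sub>0\<close>.  Integrating \<open>G\<close> over \<open>x\<^bsub>n+1\<^esub>\<close> gives \<open>\<eta> e\<^bsup>\<psi> y\<^sub>n\<^sub>+\<^sub>1/\<hbar>\<^esup>\<close>, which is then
  integrated over \<open>x\<^sub>1, \<dots>, x\<^sub>n\<close>.  On the other side
  \<open>\<eta>' \<delta>(y\<^sub>0 - \<psi>') = (2\<pi>\<hbar>)\<^sup>-\<^sup>1 \<integral> \<eta>' e\<^bsup>x\<^sub>0 (y\<^sub>0 - \<psi>')/\<hbar>\<^esup> dx\<^sub>0\<close>.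
\<close>
definition fourier_related ::
    "('n::finite, 'k::field_char_0) distr \<Rightarrow> ('n, 'k) distr \<Rightarrow> bool" where
  "fourier_related G G' \<longleftrightarrow> (case G of (p, \<phi>, h) \<Rightarrow> case G' of (q, \<phi>', h') \<Rightarrow>
     let p = to_ac \<circ> p; q = to_ac \<circ> q; z = p(Last := q Last); z' = q(First := p First) in
     \<exists>\<psi> \<eta> \<psi>' \<eta>' w.
       indep_of Last \<psi> \<and> indep_of Last \<eta> \<and>
       delta_eq (mmap to_ac \<phi>, h) (coord p Last - \<psi>, \<eta>) \<and>
       indep_of First \<psi>' \<and> indep_of First \<eta>' \<and>
       delta_eq (mmap to_ac \<phi>', h') (coord q First - \<psi>', \<eta>') \<and>
       is_formal_integral Mid z (\<psi> * coord z Last) \<eta> w \<and>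
       wave_eq w (Wave z' (int (CARD('n) + 2) - 2) (- (coord z' First * \<psi>')) (fps_const \<eta>')))"


section \<open>The correspondence\<close>

definition sqrt_branch :: "('k::field \<Rightarrow> 'k alg_closure) \<Rightarrow> bool" where
  "sqrt_branch r \<longleftrightarrow> (\<forall>c. c \<noteq> 0 \<longrightarrow> r c ^ 2 = to_ac c)"

text \<open>
  \<open>x\<^sub>0\<^bsup>(n+2)/2\<^esup> G\<close>, formed with the branch \<open>r\<close> of \<open>x\<^sub>0\<^bsup>1/2\<^esup>\<close>, is defined over \<open>'k\<close>.  The transform
  of \<open>G\<close> involves \<open>det (- H)\<^bsup>-1/2\<^esup>\<close> and \<open>y\<^bsub>n+1\<^esub>\<^bsup>1/2\<^esup>\<close>, hence is defined over \<open>'k\<close> up to the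
  square root of a constant.
\<close>
definition fourier_cone_densities ::
    "'k::field_char_0 setting \<Rightarrow> ('k \<Rightarrow> 'k alg_closure) \<Rightarrow> ('n::finite, 'k) distr set" where
  "fourier_cone_densities S r =
     {G. cone_density S First Last (inverse (r (fst G First) ^ (CARD('n) + 2))) G \<and>
         (\<exists>G' c. c ^ 2 \<in> range to_ac \<and> cone_density S Last First c G' \<and> fourier_related G G')}"

text \<open>
  Germs of distributions homogeneous of degree \<open>-(n+2)/2\<close> are identified along the rays:
  \<open>G\<close> at \<open>p\<close> and \<open>G'\<close> at \<open>l p\<close> are identified if \<open>G'(l x) = l\<^bsup>-(n+2)/2\<^esup> G(x)\<close>, where
  \<open>l\<^bsup>1/2\<^esup>\<close> is the quotient of the values of the fixed branch of \<open>x\<^sub>0\<^bsup>1/2\<^esup>\<close> at \<open>l p\<close> and \<open>p\<close>.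
  For \<open>l = 1\<close> this is equality of germs of distributions.
\<close>
definition ray_eq ::
    "('k::field_char_0 \<Rightarrow> 'k alg_closure) \<Rightarrow> ('n::finite, 'k) distr \<Rightarrow> ('n, 'k) distr \<Rightarrow> bool" where
  "ray_eq r G G' \<longleftrightarrow> (case G of (p, \<phi>, h) \<Rightarrow> case G' of (p', \<phi>', h') \<Rightarrow>
     \<exists>l. l \<noteq> 0 \<and> p' = (\<lambda>i. l * p i) \<and>
       (let dil = (\<lambda>a. msubst a (\<lambda>i. mconst (to_ac l) * mvar i)) in
        delta_eq (dil (mmap to_ac \<phi>'), dil h')
          (mmap to_ac \<phi>, mconst (inverse ((r (p' First) / r (p First)) ^ (CARD('n) + 2))) * h)))"

definition ray_rel ::
    "'k::field_char_0 setting \<Rightarrow> ('k \<Rightarrow> 'k alg_closure) \<Rightarrow> ('n::finite, 'k) distr rel" where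
  "ray_rel S r = {(G, G'). G \<in> fourier_cone_densities S r \<and> G' \<in> fourier_cone_densities S r \<and> ray_eq r G G'}"

text \<open>
  The distribution \<open>\<delta>(x i\<^sub>1 / x i\<^sub>0 - f(x / x i\<^sub>0)) g(x / x i\<^sub>0) (x i\<^sub>0)\<^bsup>-(n+2)/2\<^esup>\<close> at the point with
  \<open>x i\<^sub>0 = c\<close> over \<open>t\<close>, where \<open>f\<close>, \<open>g\<close> are germs at \<open>t\<close>.  The first two local definitions are the
  point and the germs \<open>x j / x i\<^sub>0\<close>.
\<close>
definition cone_distr ::
    "'n::finite amb \<Rightarrow> 'n amb \<Rightarrow> ('k::field_char_0 \<Rightarrow> 'k alg_closure) \<Rightarrow> 'k \<Rightarrow>
     ('n \<Rightarrow> 'k) \<Rightarrow> ('n, 'k) mps \<Rightarrow> ('n, 'k alg_closure) mps \<Rightarrow> ('n, 'k) distr" where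
  "cone_distr i\<^sub>0 i\<^sub>1 r c t f g =
     (let p = (\<lambda>j. case j of Mid i \<Rightarrow> c * t i | _ \<Rightarrow> if j = i\<^sub>0 then c else c * cterm f);
          ratio = (\<lambda>j. coord p j * (mconst (1 / c) * mpowr i\<^sub>0 c (- 1)));
          s = (\<lambda>i. ratio (Mid i) - mconst (t i))
      in (p, ratio i\<^sub>1 - msubst f s,
          msubst g (\<lambda>i. mmap to_ac (s i)) *
            (mconst (inverse (r c ^ (CARD('n) + 2))) * mpowr i\<^sub>0 (to_ac c) (hdeg TYPE('n)))))"

end

theory Submission
  imports Defs
begin

text \<open>
  A homogeneous density on a cone is determined by its restriction to a hyperplane \<open>x\<^sub>0 = c\<close>; in the
  affine coordinates \<open>s = x / x\<^sub>0\<close> it becomes \<open>\<eta> \<delta>(x\<^bsub>n+1\<^esub> - \<psi>)\<close> with \<open>\<psi> = x\<^sub>0 f(s)\<close> and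
  \<open>\<eta> = x\<^sub>0\<^bsup>-n/2\<^esup> g(s)\<close>.  Its Fourier transform is the formal integral with amplitude \<open>\<eta>\<close> and phase
  \<open>x\<^sub>0 y\<^bsub>n+1\<^esub> (f(s) + s\<cdot>y / y\<^bsub>n+1\<^esub>)\<close>, so \<open>x\<^sub>0 y\<^bsub>n+1\<^esub>\<close> plays the role of \<open>1/\<hbar>\<close>: the stationary phase
  coefficients of the cone are those of \<open>(f, g)\<close> times a unit and \<open>(x\<^sub>0 y\<^bsub>n+1\<^esub>)\<^bsup>-k\<^esup>\<close>.  Hence the transform
  is independent of \<open>\<hbar>\<close> iff \<open>(f, g)\<close> is admissible.  In that case the powers of \<open>x\<^sub>0\<close> cancel in the
  leading term, which is the density belonging to the Legendre transform of \<open>f\<close> and to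
  \<open>g det(-H)\<^bsup>-1/2\<^esup>\<close> at the critical point.  Germs stay convergent because the inverse function
  theorem holds for convergent series.
\<close>

section \<open>Calculus of formal power series\<close>

text \<open>Distributions are compared after being solved for one coordinate: by
  \<open>delta_eq_graph\<close> the form \<open>\<eta> \<delta>(x\<^sub>j - \<psi>)\<close> with
  \<open>\<psi>\<close>, \<open>\<eta>\<close> independent of \<open>x\<^sub>j\<close> is unique. So
  the witnesses in \<open>fourier_related\<close> are forced, and homogeneity of a distribution
  becomes homogeneity of two series. The converse direction needs more than the scaling of the
  coefficients: the transform shows only that they vanish after substitution of the critical point.
  That substitution is injective, because on a slice the critical point inverts the gradient map of
  \<open>f\<close>. Square roots are the obstacle to working over one field. Half-integral powers
  and det(-H)^(-1/2) are split into a constant, which may lie only in the algebraic closure, and a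
  binomial series with constant term 1 over the ground field. Identities are computed over the
  closure, while convergence is checked on the part over the ground field.\<close>

lemma mcoeff_0 [simp]: "mcoeff 0 m = 0"
  and mcoeff_1: "mcoeff 1 m = (if m = (\<lambda>_. 0) then 1 else 0)"
  and mcoeff_add [simp]: "mcoeff (a + b) m = mcoeff a m + mcoeff b m"
  and mcoeff_uminus [simp]: "mcoeff (- a) m = - mcoeff a m"
  and mcoeff_diff [simp]: "mcoeff (a - b) m = mcoeff a m - mcoeff b m"
  and mcoeff_mult: "mcoeff (a * b) m = (\<Sum>p\<in>mle m. mcoeff a p * mcoeff b (\<lambda>i. m i - p i))"
  for a b :: "('v::finite, 'a::comm_ring_1) mps"
  by (simp_all add: zero_mps_def one_mps_def plus_mps_def uminus_mps_def minus_mps_def times_mps_def)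

lemma mcoeff_sum [simp]: "mcoeff (\<Sum>x\<in>A. f x) m = (\<Sum>x\<in>A. mcoeff (f x) m)"
  by (induction A rule: infinite_finite_induct) auto

lemma mcoeff_mconst: "mcoeff (mconst c) m = (if m = (\<lambda>_. 0) then c else 0)"
  by (simp add: mconst_def)

lemma mcoeff_mvar: "mcoeff (mvar i) m = (if m = (\<lambda>_. 0)(i := 1) then 1 else 0)"
  by (simp add: mvar_def)

lemma mcoeff_mmap [simp]: "mcoeff (mmap F a) m = F (mcoeff a m)"
  by (simp add: mmap_def)

lemma mcoeff_mderiv: "mcoeff (mderiv i a) m = of_nat (Suc (m i)) * mcoeff a (m(i := Suc (m i)))"
  by (simp add: mderiv_def)

lemma mcoeff_mconst_mult [simp]: "mcoeff (mconst c * a) m = c * mcoeff a m"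
proof -
  have "mcoeff (mconst c * a) m = (\<Sum>p\<in>mle m. if p = (\<lambda>_. 0) then c * mcoeff a m else 0)"
    unfolding mcoeff_mult mcoeff_mconst by (rule sum.cong) auto
  then show ?thesis by (simp add: sum.delta)
qed

lemma mconst_0 [simp]: "mconst 0 = (0 :: ('v::finite, 'a::comm_ring_1) mps)"
  and mconst_1 [simp]: "mconst 1 = (1 :: ('v::finite, 'a::comm_ring_1) mps)"
  by (simp_all add: mps_eqI mcoeff_mconst mcoeff_1)

lemma mconst_add: "mconst (a + b) = (mconst a + mconst b :: ('v::finite, 'a::comm_ring_1) mps)"
  and mconst_uminus: "mconst (- a) = (- mconst a :: ('v::finite, 'a::comm_ring_1) mps)"
  and mconst_diff: "mconst (a - b) = (mconst a - mconst b :: ('v::finite, 'a::comm_ring_1) mps)"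
  by (simp_all add: mps_eqI mcoeff_mconst)

lemma mconst_mult: "mconst (a * b) = (mconst a * mconst b :: ('v::finite, 'a::comm_ring_1) mps)"
  by (rule mps_eqI) (simp add: mcoeff_mconst)

lemma mconst_power: "mconst (a ^ n) = (mconst a ^ n :: ('v::finite, 'a::comm_ring_1) mps)"
  by (induction n) (auto simp: mconst_mult)

lemma mconst_sum: "mconst (\<Sum>x\<in>A. f x) = (\<Sum>x\<in>A. mconst (f x) :: ('v::finite, 'a::comm_ring_1) mps)"
  by (induction A rule: infinite_finite_induct) (auto simp: mconst_add)

section \<open>Degree of monomials and order of vanishing\<close>

lemma mdeg_zero [simp]: "mdeg (\<lambda>_. 0) = 0"
  by (simp add: mdeg_def)

lemma mdeg_single [simp]: "mdeg ((\<lambda>_. 0)(i := n)) = n"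
  by (simp add: mdeg_def fun_upd_def sum.delta)

lemma mdeg_add: "mdeg (\<lambda>i. m i + p i) = mdeg m + mdeg p"
  by (simp add: mdeg_def sum.distrib)

lemma mdeg_diff: "p \<in> mle m \<Longrightarrow> mdeg (\<lambda>i. m i - p i) = mdeg m - mdeg p"
  unfolding mdeg_def by (rule sum_subtractf_nat) auto

lemma mdeg_mono: "p \<in> mle m \<Longrightarrow> mdeg p \<le> mdeg m"
  unfolding mdeg_def by (auto intro: sum_mono)

lemma mdeg_upd_Suc: "mdeg (m(i := Suc (m i))) = Suc (mdeg m)"
proof -
  have "m(i := Suc (m i)) = (\<lambda>j. m j + ((\<lambda>_. 0)(i := 1)) j)" by auto
  then show ?thesis by (simp only: mdeg_add mdeg_single)
qed

lemma le_mdeg: "m i \<le> mdeg m"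
  unfolding mdeg_def by (rule member_le_sum) auto

lemma mdeg_eq_0_iff: "mdeg m = 0 \<longleftrightarrow> m = (\<lambda>_. 0)"
  by (auto simp: mdeg_def fun_eq_iff)

lemma finite_mdeg_le [simp]: "finite {m :: 'v::finite \<Rightarrow> nat. mdeg m \<le> n}"
  by (rule finite_subset[of _ "mle (\<lambda>_. n)"]) (auto intro: order.trans[OF le_mdeg])

lemma mdeg_eq_1E:
  assumes "mdeg m = 1"
  obtains i where "m = (\<lambda>_. 0)(i := 1)"
proof -
  have "m \<noteq> (\<lambda>_. 0)" using assms by auto
  then obtain i where i: "m i \<noteq> 0" by auto
  have "m j = 0" if "j \<noteq> i" for j
  proof -
    have "m i + m j = (\<Sum>k\<in>{i, j}. m k)" using that by simp
    also have "\<dots> \<le> mdeg m" unfolding mdeg_def by (rule sum_mono2) auto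
    finally show ?thesis using i assms by simp
  qed
  moreover have "m i = 1" using i le_mdeg[of m i] assms by simp
  ultimately have "m = (\<lambda>_. 0)(i := 1)" by auto
  then show ?thesis by (rule that)
qed

text \<open>The filtration by order of vanishing at the base point. It is separated
  (\<open>mord_eqI\<close>), so it serves as the topology in which all formal limits are
  taken.\<close>

definition mord :: "nat \<Rightarrow> ('v::finite, 'a::zero) mps \<Rightarrow> bool" where
  "mord n a \<longleftrightarrow> (\<forall>m. mdeg m < n \<longrightarrow> mcoeff a m = 0)"

lemma mord_0 [simp]: "mord 0 a"
  and mord_zero [simp]: "mord n (0 :: ('v::finite, 'a::comm_ring_1) mps)"
  by (auto simp: mord_def)

lemma mord_mono: "mord n a \<Longrightarrow> k \<le> n \<Longrightarrow> mord k a"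
  by (auto simp: mord_def)

lemma mord_add: "mord n a \<Longrightarrow> mord n b \<Longrightarrow> mord n (a + b)"
  and mord_diff: "mord n a \<Longrightarrow> mord n b \<Longrightarrow> mord n (a - b)"
  and mord_uminus: "mord n a \<Longrightarrow> mord n (- a)"
  for a b :: "('v::finite, 'a::comm_ring_1) mps"
  by (auto simp: mord_def)

lemma mord_sum: "(\<And>x. x \<in> A \<Longrightarrow> mord n (f x)) \<Longrightarrow> mord n (\<Sum>x\<in>A. f x :: ('v::finite, 'a::comm_ring_1) mps)"
  by (auto simp: mord_def intro!: sum.neutral)

lemma mord_mult:
  fixes a b :: "('v::finite, 'a::comm_ring_1) mps"
  assumes "mord n a" "mord k b"
  shows "mord (n + k) (a * b)"
  unfolding mord_def mcoeff_mult
proof (intro allI impI sum.neutral ballI)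
  fix m p :: "'v \<Rightarrow> nat" assume "mdeg m < n + k" and p: "p \<in> mle m"
  then have "mdeg p < n \<or> mdeg (\<lambda>i. m i - p i) < k"
    using mdeg_diff[OF p] mdeg_mono[OF p] by linarith
  then show "mcoeff a p * mcoeff b (\<lambda>i. m i - p i) = 0"
    using assms by (auto simp: mord_def)
qed

lemma mord_mult_left: "mord n a \<Longrightarrow> mord n (c * a)" for a c :: "('v::finite, 'a::comm_ring_1) mps"
  using mord_mult[of 0 c n a] by simp

lemma mord_1_iff: "mord 1 a \<longleftrightarrow> cterm a = 0" "mord (Suc 0) a \<longleftrightarrow> cterm a = 0"
  by (auto simp: mord_def cterm_def mdeg_eq_0_iff)

lemma mord_power: "mord 1 a \<Longrightarrow> mord n (a ^ n)" for a :: "('v::finite, 'a::comm_ring_1) mps"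
  using mord_mult[of 1 a] by (induction n) auto

text \<open>Each \<open>b i\<close> has order at least 1 and orders add up in products. This is why
  the finite sum in \<open>msubst\<close> is complete.\<close>

lemma mord_monomial:
  fixes b :: "'w::finite \<Rightarrow> ('v::finite, 'a::comm_ring_1) mps"
  assumes "\<And>i. cterm (b i) = 0"
  shows "mord (mdeg \<alpha>) (\<Prod>i\<in>UNIV. b i ^ \<alpha> i)"
proof -
  have "mord (\<Sum>i\<in>A. \<alpha> i) (\<Prod>i\<in>A. b i ^ \<alpha> i)" for A
    by (induction A rule: infinite_finite_induct)
      (auto intro!: mord_mult mord_power simp: mord_1_iff assms)
  then show ?thesis by (simp add: mdeg_def)
qed

lemma mord_eqI:
  fixes a b :: "('v::finite, 'a::comm_ring_1) mps"
  assumes "\<And>n. mord n (a - b)"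
  shows "a = b"
proof (rule mps_eqI)
  fix m :: "'v \<Rightarrow> nat"
  have "mcoeff (a - b) m = 0" using assms[of "Suc (mdeg m)"] by (auto simp: mord_def)
  then show "mcoeff a m = mcoeff b m" by simp
qed

lemma mord_mderiv: "mord (Suc n) a \<Longrightarrow> mord n (mderiv i a)" for a :: "('v::finite, 'a::comm_ring_1) mps"
  by (auto simp: mord_def mcoeff_mderiv mdeg_upd_Suc)

lemma cterm_0 [simp]: "cterm (0 :: ('v::finite, 'a::comm_ring_1) mps) = 0"
  and cterm_1 [simp]: "cterm (1 :: ('v::finite, 'a::comm_ring_1) mps) = 1"
  and cterm_mconst [simp]: "cterm (mconst c) = c"
  and cterm_mvar [simp]: "cterm (mvar i :: ('v, 'b::zero_neq_one) mps) = 0"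
  by (auto simp: cterm_def mcoeff_mconst mcoeff_mvar mcoeff_1 fun_eq_iff)

lemma cterm_add [simp]: "cterm (a + b) = cterm a + cterm b"
  and cterm_uminus [simp]: "cterm (- a) = - cterm a"
  and cterm_diff [simp]: "cterm (a - b) = cterm a - cterm b"
  for a b :: "('v::finite, 'a::comm_ring_1) mps"
  by (auto simp: cterm_def)

lemma cterm_mult [simp]: "cterm (a * b) = cterm a * cterm b" for a b :: "('v::finite, 'a::comm_ring_1) mps"
proof -
  have "mle (\<lambda>_::'v. 0) = {\<lambda>_. 0}" by auto
  then show ?thesis by (simp add: cterm_def mcoeff_mult)
qed

lemma cterm_power [simp]: "cterm (a ^ n) = cterm a ^ n" for a :: "('v::finite, 'a::comm_ring_1) mps"
  by (induction n) auto

lemma cterm_sum [simp]: "cterm (\<Sum>x\<in>A. f x) = (\<Sum>x\<in>A. cterm (f x))"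
  for f :: "'i \<Rightarrow> ('v::finite, 'a::comm_ring_1) mps"
  by (simp add: cterm_def)

lemma cterm_coord [simp]: "cterm (coord p i) = p i"
  by (simp add: coord_def)

section \<open>Substitution as a ring homomorphism\<close>

lemma cterm_msubst [simp]:
  fixes b :: "'v::finite \<Rightarrow> ('w::finite, 'a::comm_ring_1) mps"
  shows "cterm (msubst a b) = cterm a"
proof -
  have "{\<alpha> :: 'v \<Rightarrow> nat. mdeg \<alpha> \<le> mdeg (\<lambda>_::'w. 0)} = {\<lambda>_. 0}"
    by (auto simp: mdeg_eq_0_iff)
  then show ?thesis by (simp add: cterm_def msubst_def mcoeff_1)
qed

lemma cterm_mrename [simp]: "cterm (mrename r a) = cterm a"
  by (simp add: mrename_def)

text \<open>Monomials of degree above \<open>mdeg m\<close> contribute 0. The freedom to enlarge the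
  range lets one index set serve all coefficients that occur in a convolution.\<close>

lemma mcoeff_msubst:
  fixes b :: "'v::finite \<Rightarrow> ('w::finite, 'a::comm_ring_1) mps"
  assumes "\<And>i. cterm (b i) = 0" and "mdeg m \<le> N"
  shows "mcoeff (msubst a b) m = (\<Sum>\<alpha> | mdeg \<alpha> \<le> N. mcoeff a \<alpha> * mcoeff (\<Prod>i\<in>UNIV. b i ^ \<alpha> i) m)"
proof -
  have "mcoeff (msubst a b) m = (\<Sum>\<alpha> | mdeg \<alpha> \<le> mdeg m. mcoeff a \<alpha> * mcoeff (\<Prod>i\<in>UNIV. b i ^ \<alpha> i) m)"
    by (simp add: msubst_def)
  also have "\<dots> = (\<Sum>\<alpha> | mdeg \<alpha> \<le> N. mcoeff a \<alpha> * mcoeff (\<Prod>i\<in>UNIV. b i ^ \<alpha> i) m)"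
  proof (rule sum.mono_neutral_left)
    show "\<forall>\<alpha>\<in>{\<alpha>. mdeg \<alpha> \<le> N} - {\<alpha>. mdeg \<alpha> \<le> mdeg m}. mcoeff a \<alpha> * mcoeff (\<Prod>i\<in>UNIV. b i ^ \<alpha> i) m = 0"
      using mord_monomial[of b] assms(1) by (auto simp: mord_def)
  qed (use assms(2) in auto)
  finally show ?thesis .
qed

lemma msubst_add [simp]: "msubst (a + c) b = msubst a b + msubst c b"
  and msubst_diff [simp]: "msubst (a - c) b = msubst a b - msubst c b"
  and msubst_uminus [simp]: "msubst (- a) b = - msubst a b"
  and msubst_0 [simp]: "msubst 0 b = 0"
  by (rule mps_eqI; simp add: msubst_def distrib_right left_diff_distrib sum.distrib sum_subtractf sum_negf)+

lemma msubst_sum [simp]: "msubst (\<Sum>x\<in>A. f x) b = (\<Sum>x\<in>A. msubst (f x) b)"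
  by (induction A rule: infinite_finite_induct) auto

lemma msubst_mconst [simp]:
  fixes b :: "'v::finite \<Rightarrow> ('w::finite, 'a::comm_ring_1) mps"
  shows "msubst (mconst c) b = mconst c"
proof (rule mps_eqI)
  fix m :: "'w \<Rightarrow> nat"
  have "mcoeff (msubst (mconst c) b) m
      = (\<Sum>\<alpha> | mdeg \<alpha> \<le> mdeg m. if \<alpha> = (\<lambda>_. 0) then c * mcoeff (\<Prod>i\<in>UNIV. b i ^ \<alpha> i) m else 0)"
    unfolding msubst_def mcoeff_Abs_mps mcoeff_mconst by (rule sum.cong) auto
  then show "mcoeff (msubst (mconst c) b) m = mcoeff (mconst c) m"
    by (simp add: sum.delta mcoeff_1 mcoeff_mconst)
qed

lemma msubst_1 [simp]: "msubst 1 b = 1"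
  using msubst_mconst[of 1 b] by simp

lemma msubst_mvar [simp]:
  fixes b :: "'v::finite \<Rightarrow> ('w::finite, 'a::comm_ring_1) mps"
  assumes "\<And>i. cterm (b i) = 0"
  shows "msubst (mvar i) b = b i"
proof (rule mps_eqI)
  fix m :: "'w \<Rightarrow> nat"
  have "(\<Prod>j\<in>UNIV. b j ^ ((\<lambda>_. 0)(i := 1)) j) = (\<Prod>j\<in>UNIV. if j = i then b j else 1)"
    by (rule prod.cong) auto
  then have *: "(\<Prod>j\<in>UNIV. b j ^ ((\<lambda>_. 0)(i := Suc 0)) j) = b i" by (simp add: prod.delta)
  have "mcoeff (msubst (mvar i) b) m
      = (\<Sum>\<alpha> | mdeg \<alpha> \<le> mdeg m + 1. if \<alpha> = (\<lambda>_. 0)(i := 1) then mcoeff (\<Prod>j\<in>UNIV. b j ^ \<alpha> j) m else 0)"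
    unfolding mcoeff_msubst[of b m "mdeg m + 1" "mvar i", OF assms le_add1] mcoeff_mvar
    by (rule sum.cong) auto
  also have "\<dots> = mcoeff (b i) m"
    by (subst sum.delta) (auto simp: * simp del: fun_upd_apply)
  finally show "mcoeff (msubst (mvar i) b) m = mcoeff (b i) m" .
qed

lemma msubst_mult [simp]:
  fixes b :: "'v::finite \<Rightarrow> ('w::finite, 'a::comm_ring_1) mps"
  assumes "\<And>i. cterm (b i) = 0"
  shows "msubst (a * c) b = msubst a b * msubst c b"
proof (rule mps_eqI)
  fix m :: "'w \<Rightarrow> nat"
  let ?N = "mdeg m"
  let ?D = "{\<alpha> :: 'v \<Rightarrow> nat. mdeg \<alpha> \<le> ?N}"
  let ?B = "\<lambda>\<alpha>. \<Prod>i\<in>UNIV. b i ^ \<alpha> i"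
  let ?t = "\<lambda>p q. mcoeff a p * (mcoeff c q * mcoeff (?B (\<lambda>i. p i + q i)) m)"
  have B: "?B (\<lambda>i. p i + q i) = ?B p * ?B q" for p q
    by (simp add: power_add prod.distrib)
  have "mcoeff (msubst (a * c) b) m = (\<Sum>\<alpha>\<in>?D. \<Sum>p\<in>mle \<alpha>. mcoeff a p * mcoeff c (\<lambda>i. \<alpha> i - p i) * mcoeff (?B \<alpha>) m)"
    by (simp add: msubst_def mcoeff_mult sum_distrib_right)
  also have "\<dots> = (\<Sum>(\<alpha>, p)\<in>(SIGMA \<alpha>:?D. mle \<alpha>). mcoeff a p * mcoeff c (\<lambda>i. \<alpha> i - p i) * mcoeff (?B \<alpha>) m)"
    by (simp add: sum.Sigma)
  also have "\<dots> = (\<Sum>(p, q)\<in>{(p, q). mdeg p + mdeg q \<le> ?N}. ?t p q)"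
  proof (rule sum.reindex_bij_witness
      [where i = "\<lambda>(p, q). (\<lambda>i. p i + q i, p)" and j = "\<lambda>(\<alpha>, p). (p, \<lambda>i. \<alpha> i - p i)"])
    fix x assume "x \<in> (SIGMA \<alpha>:?D. mle \<alpha>)"
    then obtain \<alpha> p where x: "x = (\<alpha>, p)" "mdeg \<alpha> \<le> ?N" and p: "p \<in> mle \<alpha>" by auto
    have [simp]: "(\<lambda>i. p i + (\<alpha> i - p i)) = \<alpha>" using p by auto
    show "(case (case x of (\<alpha>, p) \<Rightarrow> (p, \<lambda>i. \<alpha> i - p i)) of (p, q) \<Rightarrow> (\<lambda>i. p i + q i, p)) = x"
      using x by simp
    show "(case x of (\<alpha>, p) \<Rightarrow> (p, \<lambda>i. \<alpha> i - p i)) \<in> {(p, q). mdeg p + mdeg q \<le> ?N}"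
      using x mdeg_diff[OF p] mdeg_mono[OF p] by simp
    show "(case (case x of (\<alpha>, p) \<Rightarrow> (p, \<lambda>i. \<alpha> i - p i)) of (p, q) \<Rightarrow> ?t p q)
        = (case x of (\<alpha>, p) \<Rightarrow> mcoeff a p * mcoeff c (\<lambda>i. \<alpha> i - p i) * mcoeff (?B \<alpha>) m)"
      using x fun_cong[OF \<open>(\<lambda>i. p i + (\<alpha> i - p i)) = \<alpha>\<close>] by (simp add: mult.assoc)
  qed (auto simp: mdeg_add)
  \<comment> \<open>The added pairs have total degree above \<open>mdeg m\<close>, so their monomial
    has coefficient 0 at \<open>m\<close>. Over the full square the double sum factors.\<close>
  also have "\<dots> = (\<Sum>(p, q)\<in>?D \<times> ?D. ?t p q)"
  proof (rule sum.mono_neutral_left)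
    show "\<forall>x\<in>?D \<times> ?D - {(p, q). mdeg p + mdeg q \<le> ?N}. (case x of (p, q) \<Rightarrow> ?t p q) = 0"
    proof
      fix x assume x: "x \<in> ?D \<times> ?D - {(p, q). mdeg p + mdeg q \<le> ?N}"
      obtain p q where pq: "x = (p, q)" by (cases x)
      have "mcoeff (?B (\<lambda>i. p i + q i)) m = 0"
        using mord_monomial[of b "\<lambda>i. p i + q i"] assms x pq by (auto simp: mord_def mdeg_add)
      then show "(case x of (p, q) \<Rightarrow> ?t p q) = 0" by (simp add: pq)
    qed
  qed auto
  also have "\<dots> = (\<Sum>p\<in>?D. \<Sum>q\<in>?D. ?t p q)"
    by (simp add: sum.cartesian_product)
  also have "\<dots> = (\<Sum>p\<in>?D. \<Sum>q\<in>?D. \<Sum>k\<in>mle m. mcoeff a p * mcoeff (?B p) k * (mcoeff c q * mcoeff (?B q) (\<lambda>i. m i - k i)))"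
    unfolding B mcoeff_mult sum_distrib_left by (intro sum.cong refl) (simp add: mult_ac)
  also have "\<dots> = (\<Sum>p\<in>?D. \<Sum>k\<in>mle m. \<Sum>q\<in>?D. mcoeff a p * mcoeff (?B p) k * (mcoeff c q * mcoeff (?B q) (\<lambda>i. m i - k i)))"
    by (intro sum.cong refl) (rule sum.swap)
  also have "\<dots> = (\<Sum>k\<in>mle m. \<Sum>p\<in>?D. \<Sum>q\<in>?D. mcoeff a p * mcoeff (?B p) k * (mcoeff c q * mcoeff (?B q) (\<lambda>i. m i - k i)))"
    by (rule sum.swap)
  also have "\<dots> = (\<Sum>k\<in>mle m. mcoeff (msubst a b) k * mcoeff (msubst c b) (\<lambda>i. m i - k i))"
  proof (rule sum.cong[OF refl])
    fix k assume k: "k \<in> mle m"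
    then have "mdeg k \<le> ?N" "mdeg (\<lambda>i. m i - k i) \<le> ?N" by (auto intro!: mdeg_mono)
    then show "(\<Sum>p\<in>?D. \<Sum>q\<in>?D. mcoeff a p * mcoeff (?B p) k * (mcoeff c q * mcoeff (?B q) (\<lambda>i. m i - k i)))
        = mcoeff (msubst a b) k * mcoeff (msubst c b) (\<lambda>i. m i - k i)"
      by (simp add: mcoeff_msubst[OF assms, where N = ?N] sum_product)
  qed
  finally show "mcoeff (msubst (a * c) b) m = mcoeff (msubst a b * msubst c b) m"
    by (simp add: mcoeff_mult)
qed

lemma msubst_power [simp]:
  "(\<And>i. cterm (b i) = 0) \<Longrightarrow> msubst (a ^ n) b = msubst a b ^ n"
  by (induction n) auto

lemma msubst_prod [simp]:
  "(\<And>i. cterm (b i) = 0) \<Longrightarrow> msubst (\<Prod>x\<in>A. f x) b = (\<Prod>x\<in>A. msubst (f x) b)"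
  by (induction A rule: infinite_finite_induct) auto

lemma mord_msubst:
  fixes b :: "'v::finite \<Rightarrow> ('w::finite, 'a::comm_ring_1) mps"
  assumes "\<And>i. cterm (b i) = 0" "mord n a"
  shows "mord n (msubst a b)"
  unfolding mord_def msubst_def mcoeff_Abs_mps
proof (intro allI impI sum.neutral ballI)
  fix m :: "'w \<Rightarrow> nat" and \<alpha> :: "'v \<Rightarrow> nat"
  assume "mdeg m < n" "\<alpha> \<in> {\<alpha>. mdeg \<alpha> \<le> mdeg m}"
  then have "mdeg \<alpha> < n" by simp
  then show "mcoeff a \<alpha> * mcoeff (\<Prod>i\<in>UNIV. b i ^ \<alpha> i) m = 0"
    using assms(2) by (simp add: mord_def)
qed

lemma monomial_mcoeff:
  fixes \<alpha> m :: "'b::finite \<Rightarrow> nat"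
  shows "mcoeff (\<Prod>i\<in>UNIV. mvar i ^ \<alpha> i) m = (if m = \<alpha> then 1 else (0 :: 'a::comm_ring_1))"
proof -
  have mult_var: "mcoeff (a * mvar i) m = (if m i = 0 then 0 else mcoeff a (m(i := m i - 1)))"
    for a :: "('b::finite, 'a) mps" and i :: 'b and m
  proof -
    have *: "(\<lambda>j. m j - p j) = (\<lambda>_. 0)(i := 1) \<longleftrightarrow> m i \<noteq> 0 \<and> p = m(i := m i - 1)" if "p \<in> mle m" for p
    proof
      assume "(\<lambda>j. m j - p j) = (\<lambda>_. 0)(i := 1)"
      then have A: "m j - p j = (if j = i then 1 else 0)" for j by (metis fun_upd_apply)
      have B: "p j \<le> m j" for j using that by auto
      have "p j = (m(i := m i - 1)) j" for j using A[of j] B[of j] by (auto split: if_splits)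
      with A[of i] show "m i \<noteq> 0 \<and> p = m(i := m i - 1)" by auto
    qed auto
    have "mcoeff (a * mvar i) m = (\<Sum>p\<in>mle m. if m i \<noteq> 0 \<and> p = m(i := m i - 1) then mcoeff a p else 0)"
      unfolding mcoeff_mult mcoeff_mvar using * by (intro sum.cong refl) auto
    also have "\<dots> = (if m i = 0 then 0 else mcoeff a (m(i := m i - 1)))"
      by (auto simp: sum.delta)
    finally show ?thesis .
  qed
  have power_var: "mcoeff (a * mvar i ^ n) m = (if m i < n then 0 else mcoeff a (m(i := m i - n)))"
    for a :: "('b::finite, 'a) mps" and i :: 'b and m n
  proof (induction n arbitrary: a)
    case (Suc n)
    have "mcoeff (a * mvar i ^ Suc n) m = mcoeff (a * mvar i * mvar i ^ n) m" by (simp add: mult_ac)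
    then show ?case unfolding Suc.IH by (auto simp: mult_var fun_upd_def intro!: arg_cong[where f = "mcoeff a"])
  qed simp
  have "mcoeff (\<Prod>i\<in>A. mvar i ^ \<alpha> i) m = (if m = (\<lambda>i. if i \<in> A then \<alpha> i else 0) then 1 else (0 :: 'a))" for A m
  proof (induction A arbitrary: m rule: infinite_finite_induct)
    case (insert i A)
    have "(mcoeff (\<Prod>i\<in>insert i A. mvar i ^ \<alpha> i) m :: 'a) = mcoeff ((\<Prod>i\<in>A. mvar i ^ \<alpha> i) * mvar i ^ \<alpha> i) m"
      using insert by (simp add: mult.commute)
    also have "\<dots> = (if m = (\<lambda>j. if j \<in> insert i A then \<alpha> j else 0) then 1 else 0)"
      unfolding power_var insert.IH using insert(2) by (auto simp: fun_eq_iff split: if_splits)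
    finally show ?case .
  qed (auto simp: mcoeff_1)
  then show ?thesis by simp
qed

lemma mcoeff_mult_mvar_Suc:
  fixes a :: "('b::finite, 'a::comm_ring_1) mps"
  shows "mcoeff (mvar i * a) (m(i := Suc (m i))) = mcoeff a m"
proof -
  have "(\<lambda>j. (m(i := Suc (m i))) j - p j) = m \<longleftrightarrow> p = (\<lambda>_. 0)(i := 1)" if "p \<in> mle (m(i := Suc (m i)))" for p
  proof
    assume "(\<lambda>j. (m(i := Suc (m i))) j - p j) = m"
    then have A: "(m(i := Suc (m i))) j - p j = m j" for j by metis
    have "p j = ((\<lambda>_. 0)(i := 1)) j" for j using A[of j] that by (auto split: if_splits dest: spec[of _ j])
    then show "p = (\<lambda>_. 0)(i := 1)" by auto
  qed auto
  have "mcoeff (mvar i * a) (m(i := Suc (m i)))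
      = (\<Sum>p\<in>mle (m(i := Suc (m i))). if p = (\<lambda>_. 0)(i := 1) then mcoeff a m else 0)"
    unfolding mcoeff_mult mcoeff_mvar by (intro sum.cong refl) (auto intro!: arg_cong[where f = "mcoeff a"])
  then show ?thesis by (simp add: sum.delta)
qed

lemma mvar_mult_cancel: "mvar i * a = mvar i * b \<Longrightarrow> a = b"
  for a b :: "('b::finite, 'a::comm_ring_1) mps"
  by (rule mps_eqI) (metis mcoeff_mult_mvar_Suc)

lemma truncation:
  fixes a :: "('v::finite, 'a::comm_ring_1) mps"
  shows "mord n (a - (\<Sum>\<alpha> | mdeg \<alpha> \<le> n. mconst (mcoeff a \<alpha>) * (\<Prod>i\<in>UNIV. mvar i ^ \<alpha> i)))"
  by (auto simp: mord_def monomial_mcoeff sum.delta if_distrib[of "(*) _"] cong: if_cong)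

text \<open>Maps that are continuous for the degree filtration are determined by their values on polynomials.\<close>
lemma map_eq_on_series:
  fixes F G :: "('v::finite, 'a::comm_ring_1) mps \<Rightarrow> ('w::finite, 'b::comm_ring_1) mps"
  assumes add: "\<And>a b. F (a + b) = F a + F b" "\<And>a b. G (a + b) = G a + G b"
    and cont: "\<And>n a. mord (Suc n) a \<Longrightarrow> mord n (F a)" "\<And>n a. mord (Suc n) a \<Longrightarrow> mord n (G a)"
    and const: "\<And>c. F (mconst c) = G (mconst c)" and var: "\<And>i. F (mvar i) = G (mvar i)"
    and mult: "\<And>a b. F a = G a \<Longrightarrow> F b = G b \<Longrightarrow> F (a * b) = G (a * b)"
  shows "F a = G a"
proof (rule mord_eqI)
  fix n
  \<comment> \<open>The truncation is at degree \<open>Suc n\<close> because \<open>F\<close> and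
    \<open>G\<close> may lose one order, as derivatives do.\<close>
  define p where "p = (\<Sum>\<alpha> | mdeg \<alpha> \<le> Suc n. mconst (mcoeff a \<alpha>) * (\<Prod>i\<in>UNIV. mvar i ^ \<alpha> i))"
  have one: "F 1 = G 1" using const[of 1] by simp
  have zero: "F 0 = G 0" using const[of 0] by simp
  have pw: "F (mvar i ^ k) = G (mvar i ^ k)" for i k
    by (induction k) (auto simp: one intro!: mult var)
  have pr: "F (\<Prod>i\<in>A. mvar i ^ \<alpha> i) = G (\<Prod>i\<in>A. mvar i ^ \<alpha> i)" for A \<alpha>
    by (induction A rule: infinite_finite_induct) (auto simp: one intro!: mult pw)
  have "F (\<Sum>\<alpha>\<in>A. mconst (mcoeff a \<alpha>) * (\<Prod>i\<in>UNIV. mvar i ^ \<alpha> i)) = G (\<Sum>\<alpha>\<in>A. mconst (mcoeff a \<alpha>) * (\<Prod>i\<in>UNIV. mvar i ^ \<alpha> i))" for A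
    by (induction A rule: infinite_finite_induct) (auto simp: zero add intro!: arg_cong2[of _ _ _ _ "(+)"] mult const pr)
  then have p: "F p = G p" unfolding p_def .
  have "F a = F p + F (a - p)" "G a = G p + G (a - p)" by (simp_all flip: add)
  then have "F a - G a = F (a - p) - G (a - p)" using p by simp
  moreover have "mord (Suc n) (a - p)" unfolding p_def by (rule truncation)
  ultimately show "mord n (F a - G a)" by (simp add: cont mord_diff)
qed

section \<open>Derivatives, composition and the chain rule\<close>

lemma mderiv_add [simp]: "mderiv i (a + b) = mderiv i a + mderiv i b"
  and mderiv_diff [simp]: "mderiv i (a - b) = mderiv i a - mderiv i b"
  and mderiv_uminus [simp]: "mderiv i (- a) = - mderiv i a"
  and mderiv_0 [simp]: "mderiv i 0 = 0"
  for a b :: "('v::finite, 'a::comm_ring_1) mps"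
  by (rule mps_eqI; simp add: mcoeff_mderiv algebra_simps)+

lemma mderiv_sum [simp]: "mderiv i (\<Sum>x\<in>A. f x) = (\<Sum>x\<in>A. mderiv i (f x))"
  for f :: "'i \<Rightarrow> ('v::finite, 'a::comm_ring_1) mps"
  by (induction A rule: infinite_finite_induct) auto

lemma mderiv_mconst [simp]: "mderiv i (mconst c) = (0 :: ('v::finite, 'a::comm_ring_1) mps)"
proof (rule mps_eqI)
  fix m :: "'v \<Rightarrow> nat"
  have "m(i := Suc (m i)) \<noteq> (\<lambda>_. 0)" by (metis fun_upd_same nat.simps(3))
  then show "mcoeff (mderiv i (mconst c)) m = mcoeff (0 :: ('v, 'a) mps) m"
    by (simp add: mcoeff_mderiv mcoeff_mconst)
qed

lemma mderiv_1 [simp]: "mderiv i (1 :: ('v::finite, 'a::comm_ring_1) mps) = 0"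
  using mderiv_mconst[of i 1] by simp

lemma mderiv_mvar: "mderiv i (mvar j) = (if i = j then 1 else 0 :: ('v::finite, 'a::comm_ring_1) mps)"
proof (rule mps_eqI)
  fix m :: "'v \<Rightarrow> nat"
  have "m(i := Suc (m i)) = (\<lambda>_. 0)(j := 1) \<longleftrightarrow> i = j \<and> m = (\<lambda>_. 0)"
    by (auto simp: fun_eq_iff split: if_splits)
  then show "mcoeff (mderiv i (mvar j)) m = mcoeff (if i = j then 1 else 0 :: ('v, 'a) mps) m"
    by (auto simp: mcoeff_mderiv mcoeff_mvar mcoeff_1)
qed

lemma mderiv_mult [simp]:
  fixes a b :: "('v::finite, 'a::comm_ring_1) mps"
  shows "mderiv i (a * b) = mderiv i a * b + a * mderiv i b"
proof -
  \<comment> \<open>The Euler operator \<open>x\<^sub>i \<partial>\<^sub>i\<close> multiplies coefficients by exponents, so it is visibly a derivation.\<close>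
  define \<theta> :: "('v, 'a) mps \<Rightarrow> ('v, 'a) mps" where "\<theta> a = Abs_mps (\<lambda>m. of_nat (m i) * mcoeff a m)" for a
  have \<theta>: "\<theta> a = mvar i * mderiv i a" for a
  proof (rule mps_eqI)
    fix m
    show "mcoeff (\<theta> a) m = mcoeff (mvar i * mderiv i a) m"
    proof (cases "m i")
      case 0
      have "mcoeff (mvar i) p * x = 0" if "p \<in> mle m" for p and x :: 'a
        using that 0 by (auto simp: mcoeff_mvar dest: spec[of _ i])
      then show ?thesis by (simp add: \<theta>_def 0 mcoeff_mult)
    next
      case (Suc k)
      then have m: "m = (m(i := k))(i := Suc ((m(i := k)) i))" by auto
      show ?thesis by (subst (2) m, subst mcoeff_mult_mvar_Suc) (simp add: \<theta>_def Suc mcoeff_mderiv fun_upd_idem)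
    qed
  qed
  have "\<theta> (a * b) = \<theta> a * b + a * \<theta> b"
  proof (rule mps_eqI)
    fix m :: "'v \<Rightarrow> nat"
    have "of_nat (m i) * (mcoeff a p * mcoeff b (\<lambda>i. m i - p i))
       = of_nat (p i) * mcoeff a p * mcoeff b (\<lambda>i. m i - p i)
         + mcoeff a p * (of_nat (m i - p i) * mcoeff b (\<lambda>i. m i - p i))" if "p \<in> mle m" for p
      using that by (simp add: of_nat_diff algebra_simps)
    then show "mcoeff (\<theta> (a * b)) m = mcoeff (\<theta> a * b + a * \<theta> b) m"
      by (simp add: \<theta>_def mcoeff_mult sum_distrib_left sum.distrib)
  qed
  then have "mvar i * mderiv i (a * b) = mvar i * (mderiv i a * b + a * mderiv i b)"
    by (simp add: \<theta> algebra_simps)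
  then show ?thesis by (rule mvar_mult_cancel)
qed

lemma mderiv_commute: "mderiv i (mderiv j a) = mderiv j (mderiv i a)"
  for a :: "('v::finite, 'a::comm_ring_1) mps"
  by (cases "i = j") (auto intro!: mps_eqI simp: mcoeff_mderiv fun_upd_twist mult.left_commute)

text \<open>As functions of \<open>a\<close> both sides are continuous ring homomorphisms with the
  same values on the variables, so \<open>map_eq_on_series\<close> applies.\<close>

lemma msubst_msubst:
  fixes b :: "'u::finite \<Rightarrow> ('v::finite, 'a::comm_ring_1) mps" and c :: "'v \<Rightarrow> ('w::finite, 'a) mps"
  assumes "\<And>i. cterm (b i) = 0" "\<And>i. cterm (c i) = 0"
  shows "msubst (msubst a b) c = msubst a (\<lambda>i. msubst (b i) c)"
  by (rule map_eq_on_series[where F = "\<lambda>a. msubst (msubst a b) c"])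
    (auto simp: assms intro!: mord_msubst elim: mord_mono)

lemma msubst_id [simp]: "msubst a mvar = (a :: ('v::finite, 'a::comm_ring_1) mps)"
  by (rule map_eq_on_series[where F = "\<lambda>a. msubst a mvar"])
    (auto intro!: mord_msubst elim: mord_mono)

text \<open>As functions of \<open>a\<close> both sides are derivations over the ring map
  \<open>msubst _ b\<close>. The multiplicative premise of \<open>map_eq_on_series\<close> may use
  equality at both factors, so it follows from the Leibniz rule although neither side is
  multiplicative.\<close>

lemma mderiv_msubst:
  fixes b :: "'v::finite \<Rightarrow> ('w::finite, 'a::comm_ring_1) mps"
  assumes "\<And>i. cterm (b i) = 0"
  shows "mderiv j (msubst a b) = (\<Sum>i\<in>UNIV. msubst (mderiv i a) b * mderiv j (b i))"
proof (rule map_eq_on_series[where F = "\<lambda>a. mderiv j (msubst a b)"])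
  show "mderiv j (msubst (mvar i) b) = (\<Sum>k\<in>UNIV. msubst (mderiv k (mvar i)) b * mderiv j (b k))" for i
  proof -
    have "(\<Sum>k\<in>UNIV. msubst (mderiv k (mvar i)) b * mderiv j (b k))
        = (\<Sum>k\<in>UNIV. if k = i then mderiv j (b k) else 0)"
      by (rule sum.cong) (auto simp: mderiv_mvar)
    then show ?thesis by (simp add: assms)
  qed
  show "mord n (\<Sum>i\<in>UNIV. msubst (mderiv i a) b * mderiv j (b i))" if "mord (Suc n) a" for n a
  proof (rule mord_sum)
    show "mord n (msubst (mderiv i a) b * mderiv j (b i))" for i
      by (subst mult.commute, rule mord_mult_left, rule mord_msubst, rule assms, rule mord_mderiv, rule that)
  qed
qed (auto simp: assms sum.distrib sum_distrib_left sum_distrib_right algebra_simps intro!: mord_mderiv mord_msubst)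

lemma msubst_cong:
  assumes "\<And>m i. mcoeff a m \<noteq> 0 \<Longrightarrow> m i \<noteq> 0 \<Longrightarrow> b i = b' i"
  shows "msubst a b = msubst a b'"
proof -
  have "mcoeff a \<alpha> * mcoeff (\<Prod>i\<in>UNIV. b i ^ \<alpha> i) m = mcoeff a \<alpha> * mcoeff (\<Prod>i\<in>UNIV. b' i ^ \<alpha> i) m" for \<alpha> m
  proof (cases "mcoeff a \<alpha> = 0")
    case False
    have "b i ^ \<alpha> i = b' i ^ \<alpha> i" for i using assms[OF False, of i] by (cases "\<alpha> i = 0") auto
    then show ?thesis by simp
  qed simp
  then show ?thesis by (simp add: msubst_def)
qed

lemma msubst_indep_cong:
  assumes "indep_of j a" "\<And>i. i \<noteq> j \<Longrightarrow> b i = b' i"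
  shows "msubst a b = msubst a b'"
  using assms by (intro msubst_cong) (metis indep_of_def)

section \<open>Extension of scalars to the algebraic closure\<close>

lemma mmap_to_ac_add [simp]: "mmap to_ac (a + b) = mmap to_ac a + mmap to_ac b"
  and mmap_to_ac_diff [simp]: "mmap to_ac (a - b) = mmap to_ac a - mmap to_ac b"
  and mmap_to_ac_uminus [simp]: "mmap to_ac (- a) = - mmap to_ac a"
  and mmap_to_ac_0 [simp]: "mmap to_ac 0 = 0"
  and mmap_to_ac_1 [simp]: "mmap to_ac 1 = 1"
  and mmap_to_ac_mult [simp]: "mmap to_ac (a * b) = mmap to_ac a * mmap to_ac b"
  for a b :: "('v::finite, 'k::field) mps"
  by (auto intro!: mps_eqI simp: mcoeff_1 mcoeff_mult to_ac_sum)

lemma mmap_to_ac_sum [simp]: "mmap to_ac (\<Sum>x\<in>A. f x) = (\<Sum>x\<in>A. mmap to_ac (f x))"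
  for f :: "'i \<Rightarrow> ('v::finite, 'k::field) mps"
  by (induction A rule: infinite_finite_induct) auto

lemma mmap_to_ac_prod [simp]: "mmap to_ac (\<Prod>x\<in>A. f x) = (\<Prod>x\<in>A. mmap to_ac (f x))"
  for f :: "'i \<Rightarrow> ('v::finite, 'k::field) mps"
  by (induction A rule: infinite_finite_induct) auto

lemma mmap_to_ac_power [simp]: "mmap to_ac (a ^ n) = mmap to_ac a ^ n"
  for a :: "('v::finite, 'k::field) mps"
  by (induction n) auto

lemma mmap_to_ac_mconst [simp]: "mmap to_ac (mconst c) = mconst (to_ac c)"
  and mmap_to_ac_mvar [simp]: "mmap to_ac (mvar i) = mvar i"
  and mmap_to_ac_mderiv [simp]: "mmap to_ac (mderiv i a) = mderiv i (mmap to_ac a)"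
  and cterm_mmap_to_ac [simp]: "cterm (mmap to_ac a) = to_ac (cterm a)"
  by (auto intro!: mps_eqI simp: mcoeff_mconst mcoeff_mvar mcoeff_mderiv cterm_def simp del: of_nat_Suc)

lemma mmap_to_ac_eq_iff [simp]: "mmap to_ac a = mmap to_ac b \<longleftrightarrow> a = b"
proof
  assume *: "mmap to_ac a = mmap to_ac b"
  show "a = b"
  proof (rule mps_eqI)
    fix m show "mcoeff a m = mcoeff b m"
      using arg_cong[OF *, of "\<lambda>a. mcoeff a m"] by simp
  qed
qed simp

lemma mmap_to_ac_msubst [simp]: "mmap to_ac (msubst a b) = msubst (mmap to_ac a) (\<lambda>i. mmap to_ac (b i))"
proof (rule mps_eqI)
  fix m
  have "to_ac (mcoeff (\<Prod>i\<in>UNIV. b i ^ \<alpha> i) m) = mcoeff (\<Prod>i\<in>UNIV. mmap to_ac (b i) ^ \<alpha> i) m" for \<alpha>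
    using mcoeff_mmap[of to_ac "\<Prod>i\<in>UNIV. b i ^ \<alpha> i" m] by simp
  then show "mcoeff (mmap to_ac (msubst a b)) m = mcoeff (msubst (mmap to_ac a) (\<lambda>i. mmap to_ac (b i))) m"
    by (simp add: msubst_def to_ac_sum)
qed

lemma mmap_to_ac_mrename [simp]: "mmap to_ac (mrename r a) = mrename r (mmap to_ac a)"
  by (simp add: mrename_def)

lemma mmap_to_ac_coord [simp]: "mmap to_ac (coord p i) = coord (to_ac \<circ> p) i"
  by (simp add: coord_def)

lemma to_ac_gbinomial: "to_ac (d gchoose k) = (to_ac d gchoose k)"
  for d :: "'k::field_char_0"
  by (simp add: gbinomial_prod_rev to_ac_prod fact_prod to_ac_of_nat flip: of_nat_fact)

lemma mmap_to_ac_mpowr [simp]: "mmap to_ac (mpowr i c d) = mpowr i (to_ac c) (to_ac d)"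
  by (auto intro!: mps_eqI simp: mpowr_def to_ac_gbinomial)

section \<open>Renaming of variables\<close>

lemma mrename_add [simp]: "mrename r (a + b) = mrename r a + mrename r b"
  and mrename_diff [simp]: "mrename r (a - b) = mrename r a - mrename r b"
  and mrename_uminus [simp]: "mrename r (- a) = - mrename r a"
  and mrename_mult [simp]: "mrename r (a * b) = mrename r a * mrename r b"
  and mrename_power [simp]: "mrename r (a ^ n) = mrename r a ^ n"
  and mrename_0 [simp]: "mrename r 0 = 0"
  and mrename_1 [simp]: "mrename r 1 = 1"
  and mrename_mconst [simp]: "mrename r (mconst c) = mconst c"
  and mrename_mvar [simp]: "mrename r (mvar i) = mvar (r i)"
  and mrename_sum [simp]: "mrename r (\<Sum>x\<in>A. f x) = (\<Sum>x\<in>A. mrename r (f x))"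
  and mrename_prod [simp]: "mrename r (\<Prod>x\<in>A. f x) = (\<Prod>x\<in>A. mrename r (f x))"
  by (simp_all add: mrename_def)

lemma mrename_msubst:
  "(\<And>i. cterm (b i) = 0) \<Longrightarrow> mrename r (msubst a b) = msubst a (\<lambda>i. mrename r (b i))"
  by (simp add: mrename_def msubst_msubst)

lemma msubst_mrename:
  "(\<And>i. cterm (b i) = 0) \<Longrightarrow> msubst (mrename r a) b = msubst a (\<lambda>i. b (r i))"
  by (simp add: mrename_def msubst_msubst)

lemma mderiv_mrename_notin:
  fixes a :: "('v::finite, 'a::comm_ring_1) mps"
  shows "j \<notin> range r \<Longrightarrow> mderiv j (mrename r a) = 0"
  unfolding mrename_def by (subst mderiv_msubst) (auto simp: mderiv_mvar intro!: sum.neutral)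

text \<open>In characteristic 0 the exponent can be divided out of the coefficients of the
  derivative. Independence of a variable can then be computed with the rules for
  \<open>mderiv\<close>.\<close>

lemma indep_of_iff: "indep_of i a \<longleftrightarrow> mderiv i a = 0"
  for a :: "('v::finite, 'a::field_char_0) mps"
proof
  assume *: "indep_of i a"
  show "mderiv i a = 0"
    using * by (intro mps_eqI) (simp add: indep_of_def mcoeff_mderiv)
next
  assume *: "mderiv i a = 0"
  have "mcoeff a m = 0" if m: "m i \<noteq> 0" for m
  proof -
    obtain k where k: "m i = Suc k" using not0_implies_Suc[OF m] by blast
    have "of_nat (Suc k) * mcoeff a m = mcoeff (mderiv i a) (m(i := k))"
      using k by (simp add: mcoeff_mderiv fun_upd_idem del: of_nat_Suc)
    then show ?thesis using * by (simp del: of_nat_Suc)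
  qed
  then show "indep_of i a" by (auto simp: indep_of_def)
qed

subsection \<open>Binomial series, inverses and square roots\<close>

text \<open>The power (1 + a)^d for \<open>a\<close> without constant term. The one-variable series
  has variable type \<open>unit\<close>, so each identity in the exponent is proved once in one
  variable and then substituted.\<close>

definition binom :: "'a::field_char_0 \<Rightarrow> ('v::finite, 'a) mps \<Rightarrow> ('v, 'a) mps" where
  "binom d a = msubst (mpowr () 1 d) (\<lambda>_. a)"

lemma mle_unit: "mle m = (\<lambda>k (_::unit). k) ` {..m ()}"
proof -
  have "p \<in> (\<lambda>k _. k) ` {..m ()}" if "p \<in> mle m" for p
  proof -
    have "p = (\<lambda>_. p ())" "p () \<le> m ()" using that by (auto simp: fun_eq_iff)
    then show ?thesis by blast
  qed
  then show ?thesis by auto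
qed

text \<open>Coefficientwise this is Vandermonde's convolution.\<close>

lemma mpowr_unit_mult: "mpowr () 1 d * mpowr () 1 e = (mpowr () 1 (d + e) :: (unit, 'a::field_char_0) mps)"
proof (rule mps_eqI)
  fix m :: "unit \<Rightarrow> nat"
  have inj: "inj_on (\<lambda>k _::unit. k :: nat) A" for A by (auto simp: inj_on_def dest: fun_cong)
  have "(\<Sum>k\<le>m (). (d gchoose k) * (e gchoose (m () - k))) = (d + e gchoose m ())"
    using gbinomial_Vandermonde[of d e "m ()"] by (simp add: atMost_atLeast0)
  then show "mcoeff (mpowr () 1 d * mpowr () 1 e) m = mcoeff (mpowr () 1 (d + e) :: (unit, 'a) mps) m"
    unfolding mcoeff_mult mle_unit by (simp add: sum.reindex[OF inj] mpowr_def)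
qed

text \<open>Reduces powers of a coordinate to \<open>binom\<close>, for which the exponent laws and
  convergence are available.\<close>

lemma mpowr_eq_binom: "mpowr i c d = binom d (mconst (1 / c) * mvar i)"
  for c :: "'a::field_char_0" and i :: "'v::finite"
proof (rule mps_eqI)
  fix m :: "'v \<Rightarrow> nat"
  let ?s = "\<lambda>k. (\<lambda>_::'v. 0::nat)(i := k)"
  have inj: "inj_on (\<lambda>k _::unit. k :: nat) A" for A by (auto simp: inj_on_def dest: fun_cong)
  have D: "{\<alpha> :: unit \<Rightarrow> nat. mdeg \<alpha> \<le> n} = (\<lambda>k _. k) ` {..n}" for n
    using mle_unit[of "\<lambda>_. n"] by (simp add: mdeg_def UNIV_unit)
  have vp: "mcoeff (mvar i ^ k) m = (if m = ?s k then 1 else (0 :: 'a))" for k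
  proof -
    have "(\<Prod>j\<in>UNIV. mvar j ^ ?s k j) = (\<Prod>j\<in>UNIV. if j = i then mvar i ^ k else (1 :: ('v, 'a) mps))"
      by (rule prod.cong) auto
    then show ?thesis using monomial_mcoeff[of "?s k" m, where 'a = 'a] by (simp add: prod.delta)
  qed
  have "mcoeff (binom d (mconst (1 / c) * mvar i)) m
      = (\<Sum>k\<le>mdeg m. (d gchoose k) * ((1 / c) ^ k * (if m = ?s k then 1 else 0)))"
    unfolding binom_def msubst_def mcoeff_Abs_mps D
    by (simp add: sum.reindex[OF inj] mpowr_def UNIV_unit power_mult_distrib vp flip: mconst_power del: fun_upd_apply)
  also have "\<dots> = mcoeff (mpowr i c d) m"
  proof (cases "\<forall>j. j \<noteq> i \<longrightarrow> m j = 0")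
    case True
    then have m: "m = ?s (m i)" by auto
    have eq: "m = ?s k \<longleftrightarrow> k = m i" for k using m by (metis fun_upd_same)
    have "(\<Sum>k\<le>mdeg m. (d gchoose k) * ((1 / c) ^ k * (if m = ?s k then 1 else 0)))
      = (\<Sum>k\<le>mdeg m. if k = m i then (d gchoose k) * (1 / c) ^ k else 0)"
      unfolding eq by (rule sum.cong) auto
    then show ?thesis using True le_mdeg[of m i] by (simp add: sum.delta mpowr_def power_one_over divide_inverse power_inverse)
  next
    case False
    then have "m \<noteq> ?s k" for k by auto
    then show ?thesis using False by (auto simp: mpowr_def simp del: fun_upd_apply)
  qed
  finally show "mcoeff (mpowr i c d) m = mcoeff (binom d (mconst (1 / c) * mvar i)) m" by simp
qed

lemma cterm_binom [simp]: "cterm (binom d a) = 1"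
  by (simp add: binom_def) (simp add: cterm_def mpowr_def)

lemma binom_add: "cterm a = 0 \<Longrightarrow> binom (d + e) a = binom d a * binom e a"
  by (simp add: binom_def flip: mpowr_unit_mult)

lemma binom_0 [simp]: "cterm a = 0 \<Longrightarrow> binom 0 a = 1" for a :: "('v::finite, 'b::field_char_0) mps"
proof -
  have "mpowr () 1 0 = (1 :: (unit, 'b) mps)"
    by (rule mps_eqI) (auto simp: mpowr_def mcoeff_1 fun_eq_iff gbinomial_0_left)
  then show "cterm a = 0 \<Longrightarrow> binom 0 a = 1" by (simp add: binom_def)
qed

lemma binom_1 [simp]: "cterm a = 0 \<Longrightarrow> binom 1 a = 1 + a" for a :: "('v::finite, 'b::field_char_0) mps"
proof -
  have "mpowr () 1 1 = (1 + mvar () :: (unit, 'b) mps)"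
  proof (rule mps_eqI)
    fix m :: "unit \<Rightarrow> nat"
    have "m = (\<lambda>_. m ())" by auto
    moreover have "(1 gchoose n) = (if n = 0 \<or> n = 1 then 1 else 0 :: 'b)" for n
      using binomial_gbinomial[of 1 n, where 'a = 'b] by (cases n) (auto simp: binomial_eq_0)
    ultimately show "mcoeff (mpowr () 1 1) m = mcoeff (1 + mvar () :: (unit, 'b) mps) m"
      by (auto simp: mpowr_def mcoeff_1 mcoeff_mvar fun_eq_iff)
  qed
  then show "cterm a = 0 \<Longrightarrow> binom 1 a = 1 + a" by (simp add: binom_def)
qed

lemma binom_of_nat: "cterm a = 0 \<Longrightarrow> binom (of_nat n) a = (1 + a) ^ n"
  by (induction n) (simp_all add: binom_add)

lemma binom_minus: "cterm a = 0 \<Longrightarrow> binom (- d) a * binom d a = 1"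
  using binom_add[of a "- d" d] by simp

lemma binom_minus_of_nat: "cterm a = 0 \<Longrightarrow> binom (- of_nat n) a * (1 + a) ^ n = 1"
  using binom_minus[of a "of_nat n"] by (simp add: binom_of_nat)

lemma binom_double: "cterm a = 0 \<Longrightarrow> binom d a ^ 2 = binom (2 * d) a"
  using binom_add[of a d d] by (simp add: power2_eq_square)

lemma msubst_binom:
  "cterm a = 0 \<Longrightarrow> (\<And>i. cterm (b i) = 0) \<Longrightarrow> msubst (binom d a) b = binom d (msubst a b)"
  by (simp add: binom_def msubst_msubst)

text \<open>With a_0 the constant term, write a = a_0 (1 + (a / a_0 - 1)) and expand the inverse of
  the bracket as a binomial series.\<close>

definition minv :: "('v::finite, 'a::field_char_0) mps \<Rightarrow> ('v, 'a) mps" where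
  "minv a = mconst (inverse (cterm a)) * binom (- 1) (mconst (inverse (cterm a)) * a - 1)"

lemma mult_minv: "cterm a \<noteq> 0 \<Longrightarrow> a * minv a = 1"
  using binom_minus_of_nat[of "mconst (inverse (cterm a)) * a - 1" 1]
  by (simp add: minv_def mult_ac)

lemma unit_cancel:
  fixes a x y :: "('v::finite, 'a::field_char_0) mps"
  assumes "cterm a \<noteq> 0" "a * x = a * y"
  shows "x = y"
proof -
  have "minv a * (a * x) = minv a * (a * y)" using assms(2) by simp
  then show ?thesis using mult_minv[OF assms(1)] by (simp add: mult.commute[of "minv a"] flip: mult.assoc)
qed

lemma unit_of_mult: "a * b = 1 \<Longrightarrow> cterm a \<noteq> 0" for a b :: "('v::finite, 'a::field_char_0) mps"
  using cterm_mult[of a b] by auto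

text \<open>The product of \<open>a + b\<close> and \<open>a - b\<close> is 0, and
  \<open>a + b\<close> is a unit because its constant term is twice that of
  \<open>a\<close>.\<close>

lemma square_eq_unit:
  fixes a b :: "('v::finite, 'a::field_char_0) mps"
  assumes "a ^ 2 = b ^ 2" "cterm a = cterm b" "cterm a \<noteq> 0"
  shows "a = b"
proof -
  have "(a + b) * a = (a + b) * b" using assms(1) by (simp add: algebra_simps power2_eq_square)
  moreover have "cterm (a + b) \<noteq> 0" using assms by (simp flip: mult_2)
  ultimately show ?thesis using unit_cancel by blast
qed

text \<open>Squaring reduces half-integral exponents to integral ones.\<close>
lemma binom_half_mult:
  assumes "cterm a = 0" "cterm b = 0"
  shows "binom (- of_nat n / 2) (a + b + a * b) = binom (- of_nat n / 2) a * binom (- of_nat n / 2) b"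
proof (rule square_eq_unit)
  have 1: "1 + (a + b + a * b) = (1 + a) * (1 + b)" by (simp add: algebra_simps)
  have "(1 + (a + b + a * b)) ^ n * (binom (- of_nat n) a * binom (- of_nat n) b)
      = (binom (- of_nat n) a * (1 + a) ^ n) * (binom (- of_nat n) b * (1 + b) ^ n)"
    unfolding 1 power_mult_distrib by (simp only: mult_ac)
  also have "\<dots> = 1" by (simp only: assms binom_minus_of_nat mult_1_left)
  also have "1 = (1 + (a + b + a * b)) ^ n * binom (- of_nat n) (a + b + a * b)"
    by (subst mult.commute, rule binom_minus_of_nat[symmetric]) (simp add: assms)
  finally have "binom (- of_nat n) a * binom (- of_nat n) b = binom (- of_nat n) (a + b + a * b)"
    by (rule unit_cancel[rotated]) (use assms in simp)
  then show "binom (- of_nat n / 2) (a + b + a * b) ^ 2 = (binom (- of_nat n / 2) a * binom (- of_nat n / 2) b) ^ 2"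
    using assms by (simp add: power_mult_distrib binom_double)
qed auto

lemma mderiv_inverse:
  fixes a b :: "('v::finite, 'a::field_char_0) mps"
  assumes "a * b = 1"
  shows "mderiv i b = - (mderiv i a * b ^ 2)"
proof -
  have "mderiv i a * b + a * mderiv i b = 0" using arg_cong[OF assms, of "mderiv i"] by simp
  then have "b * (mderiv i a * b + a * mderiv i b) = 0" by simp
  then have "mderiv i a * b ^ 2 + (a * b) * mderiv i b = 0" by (simp add: algebra_simps power2_eq_square)
  then show ?thesis using assms by (simp add: eq_neg_iff_add_eq_0 add.commute)
qed

section \<open>Convergence\<close>

text \<open>A truncation at degree \<open>D\<close> of the weighted sum whose summability defines
  analytic germs. Estimates then involve finite sums only, and convergence is a bound uniform in
  \<open>D\<close>.\<close>

definition tnorm :: "('k::field_char_0 \<Rightarrow> complex) \<Rightarrow> real \<Rightarrow> nat \<Rightarrow> ('v::finite, 'k) mps \<Rightarrow> real" where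
  "tnorm \<iota> r D a = (\<Sum>m | mdeg m \<le> D. norm (\<iota> (mcoeff a m)) * r ^ mdeg m)"

lemma germ_iff_bounded:
  fixes a :: "('v::finite, 'k::field_char_0) mps"
  shows "germ (Analytic \<iota>) a \<longleftrightarrow> (\<exists>r>0. \<exists>C. \<forall>D. tnorm \<iota> r D a \<le> C)"
proof -
  have "(\<lambda>m. norm (\<iota> (mcoeff a m)) * r ^ mdeg m) summable_on UNIV \<longleftrightarrow> (\<exists>C. \<forall>D. tnorm \<iota> r D a \<le> C)"
    if r: "r > 0" for r
  proof
    assume *: "(\<lambda>m. norm (\<iota> (mcoeff a m)) * r ^ mdeg m) summable_on UNIV"
    have "tnorm \<iota> r D a \<le> infsum (\<lambda>m. norm (\<iota> (mcoeff a m)) * r ^ mdeg m) UNIV" for D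
      unfolding tnorm_def using r by (intro finite_sum_le_infsum[OF *]) auto
    then show "\<exists>C. \<forall>D. tnorm \<iota> r D a \<le> C" by blast
  next
    assume "\<exists>C. \<forall>D. tnorm \<iota> r D a \<le> C"
    then obtain C where C: "\<And>D. tnorm \<iota> r D a \<le> C" by blast
    show "(\<lambda>m. norm (\<iota> (mcoeff a m)) * r ^ mdeg m) summable_on UNIV"
    proof (rule nonneg_bdd_above_summable_on)
      show "bdd_above (sum (\<lambda>m. norm (\<iota> (mcoeff a m)) * r ^ mdeg m) ` {F. F \<subseteq> UNIV \<and> finite F})"
      proof (rule bdd_aboveI2)
        fix F :: "('v \<Rightarrow> nat) set" assume "F \<in> {F. F \<subseteq> UNIV \<and> finite F}"
        then have F: "finite F" by simp
        have "F \<subseteq> {m. mdeg m \<le> Max (mdeg ` F)}" using F by auto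
        then have "(\<Sum>m\<in>F. norm (\<iota> (mcoeff a m)) * r ^ mdeg m) \<le> tnorm \<iota> r (Max (mdeg ` F)) a"
          unfolding tnorm_def using r by (intro sum_mono2) auto
        then show "(\<Sum>m\<in>F. norm (\<iota> (mcoeff a m)) * r ^ mdeg m) \<le> C" using C order.trans by blast
      qed
    qed (use r in auto)
  qed
  then show ?thesis by auto
qed

context
  fixes \<iota> :: "'k::field_char_0 \<Rightarrow> complex"
  assumes valid: "valid_setting (Analytic \<iota>)"
begin

lemma embed_add: "\<iota> (x + y) = \<iota> x + \<iota> y"
  and embed_mult: "\<iota> (x * y) = \<iota> x * \<iota> y"
  and embed_1: "\<iota> 1 = 1"
  using valid by auto

lemma embed_0: "\<iota> 0 = 0"
  using embed_add[of 0 0] by simp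

lemma embed_uminus: "\<iota> (- x) = - \<iota> x"
  using embed_add[of x "- x"] embed_0 by (simp add: eq_neg_iff_add_eq_0 add.commute)

lemma embed_sum: "\<iota> (\<Sum>x\<in>A. f x) = (\<Sum>x\<in>A. \<iota> (f x))"
  by (induction A rule: infinite_finite_induct) (auto simp: embed_add embed_0)

lemma embed_of_nat: "\<iota> (of_nat n) = of_nat n"
  by (induction n) (auto simp: embed_add embed_0 embed_1)

lemma tnorm_nonneg: "r \<ge> 0 \<Longrightarrow> tnorm \<iota> r D a \<ge> 0"
  by (auto simp: tnorm_def intro!: sum_nonneg)

lemma tnorm_0 [simp]: "tnorm \<iota> r D 0 = 0"
  by (simp add: tnorm_def embed_0)

lemma tnorm_add: "r \<ge> 0 \<Longrightarrow> tnorm \<iota> r D (a + b) \<le> tnorm \<iota> r D a + tnorm \<iota> r D b"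
  unfolding tnorm_def sum.distrib[symmetric]
  by (auto simp: embed_add distrib_right[symmetric] intro!: sum_mono mult_right_mono norm_triangle_ineq)

lemma tnorm_mconst: "tnorm \<iota> r D (mconst c :: ('v::finite, 'k) mps) = norm (\<iota> c)"
proof -
  have "tnorm \<iota> r D (mconst c :: ('v, 'k) mps)
      = (\<Sum>m :: 'v \<Rightarrow> nat | mdeg m \<le> D. if m = (\<lambda>_. 0) then norm (\<iota> c) else 0)"
    unfolding tnorm_def by (rule sum.cong) (auto simp: mcoeff_mconst embed_0)
  then show ?thesis by (simp add: sum.delta)
qed

text \<open>Truncation preserves submultiplicativity: pairs of monomials whose product has degree at
  most \<open>D\<close> are among the pairs of monomials of degree at most \<open>D\<close>, and all
  terms are nonnegative.\<close>

lemma tnorm_mult: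
  fixes a b :: "('v::finite, 'k) mps"
  assumes r: "r \<ge> 0"
  shows "tnorm \<iota> r D (a * b) \<le> tnorm \<iota> r D a * tnorm \<iota> r D b"
proof -
  let ?n = "\<lambda>x. norm (\<iota> x)"
  let ?D = "{m. mdeg m \<le> D}"
  let ?t = "\<lambda>p q. (?n (mcoeff a p) * r ^ mdeg p) * (?n (mcoeff b q) * r ^ mdeg q)"
  have "tnorm \<iota> r D (a * b) \<le> (\<Sum>m\<in>?D. \<Sum>p\<in>mle m. ?t p (\<lambda>i. m i - p i))"
    unfolding tnorm_def
  proof (rule sum_mono)
    fix m :: "'v \<Rightarrow> nat"
    have "?n (mcoeff (a * b) m) \<le> (\<Sum>p\<in>mle m. ?n (mcoeff a p) * ?n (mcoeff b (\<lambda>i. m i - p i)))"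
      unfolding mcoeff_mult embed_sum by (rule order.trans[OF norm_sum]) (simp add: embed_mult norm_mult)
    then have "?n (mcoeff (a * b) m) * r ^ mdeg m
        \<le> (\<Sum>p\<in>mle m. ?n (mcoeff a p) * ?n (mcoeff b (\<lambda>i. m i - p i))) * r ^ mdeg m"
      using r by (intro mult_right_mono) auto
    also have "\<dots> = (\<Sum>p\<in>mle m. ?t p (\<lambda>i. m i - p i))"
      unfolding sum_distrib_right
    proof (rule sum.cong[OF refl])
      fix p assume p: "p \<in> mle m"
      have "r ^ mdeg m = r ^ mdeg p * r ^ mdeg (\<lambda>i. m i - p i)"
        using mdeg_diff[OF p] mdeg_mono[OF p] by (simp flip: power_add)
      then show "?n (mcoeff a p) * ?n (mcoeff b (\<lambda>i. m i - p i)) * r ^ mdeg m = ?t p (\<lambda>i. m i - p i)"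
        by simp
    qed
    finally show "?n (mcoeff (a * b) m) * r ^ mdeg m \<le> (\<Sum>p\<in>mle m. ?t p (\<lambda>i. m i - p i))" .
  qed
  also have "\<dots> = (\<Sum>(m, p)\<in>(SIGMA m:?D. mle m). ?t p (\<lambda>i. m i - p i))"
    by (simp add: sum.Sigma)
  also have "\<dots> = (\<Sum>(p, q)\<in>(\<lambda>(m, p). (p, \<lambda>i. m i - p i)) ` (SIGMA m:?D. mle m). ?t p q)"
  proof (subst sum.reindex)
    show "inj_on (\<lambda>(m, p). (p, \<lambda>i. m i - p i)) (SIGMA m:?D. mle m)"
    proof (rule inj_onI)
      fix x y assume x: "x \<in> (SIGMA m:?D. mle m)" and y: "y \<in> (SIGMA m:?D. mle m)"
        and xy: "(\<lambda>(m, p). (p, \<lambda>i. m i - p i)) x = (\<lambda>(m, p). (p, \<lambda>i. m i - p i)) y"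
      obtain m p m' p' where *: "x = (m, p)" "y = (m', p')" by (cases x, cases y) auto
      have eq: "p' = p" "(\<lambda>i. m i - p i) = (\<lambda>i. m' i - p i)" using xy * by auto
      have "m i = m' i" for i
      proof -
        have "p i \<le> m i" "p i \<le> m' i" using x y * eq(1) by auto
        then show ?thesis using fun_cong[OF eq(2), of i] by simp
      qed
      then show "x = y" using * eq(1) by auto
    qed
  qed (auto intro!: sum.cong)
  also have "\<dots> \<le> (\<Sum>(p, q)\<in>?D \<times> ?D. ?t p q)"
  proof (rule sum_mono2)
    show "(\<lambda>(m, p). (p, \<lambda>i. m i - p i)) ` (SIGMA m:?D. mle m) \<subseteq> ?D \<times> ?D"
    proof
      fix x assume "x \<in> (\<lambda>(m, p). (p, \<lambda>i. m i - p i)) ` (SIGMA m:?D. mle m)"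
      then obtain m p where *: "mdeg m \<le> D" "p \<in> mle m" "x = (p, \<lambda>i. m i - p i)" by auto
      then show "x \<in> ?D \<times> ?D" using mdeg_diff[OF *(2)] mdeg_mono[OF *(2)] by simp
    qed
  qed (use r in auto)
  also have "\<dots> = tnorm \<iota> r D a * tnorm \<iota> r D b"
    unfolding tnorm_def sum_product sum.cartesian_product ..
  finally show ?thesis .
qed

lemma tnorm_monomial:
  assumes r: "r \<ge> 0" and b: "\<And>i. tnorm \<iota> r D (b i) \<le> \<delta>"
  shows "tnorm \<iota> r D (\<Prod>i\<in>UNIV. b i ^ \<alpha> i) \<le> \<delta> ^ mdeg \<alpha>"
proof -
  have one: "tnorm \<iota> r D 1 = 1" using tnorm_mconst[of r D 1] by (simp add: embed_1)
  have \<delta>: "\<delta> \<ge> 0" using order.trans[OF tnorm_nonneg[OF r] b] .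
  have pw: "tnorm \<iota> r D (b i ^ n) \<le> \<delta> ^ n" for i n
  proof (induction n)
    case (Suc n)
    have "tnorm \<iota> r D (b i ^ Suc n) \<le> tnorm \<iota> r D (b i) * tnorm \<iota> r D (b i ^ n)"
      using tnorm_mult[OF r] by simp
    also have "\<dots> \<le> \<delta> * \<delta> ^ n" by (intro mult_mono b Suc \<delta> tnorm_nonneg r)
    finally show ?case by simp
  qed (simp add: one)
  have "tnorm \<iota> r D (\<Prod>i\<in>A. b i ^ \<alpha> i) \<le> \<delta> ^ (\<Sum>i\<in>A. \<alpha> i)" for A
  proof (induction A rule: infinite_finite_induct)
    case (insert i A)
    have "tnorm \<iota> r D (\<Prod>i\<in>insert i A. b i ^ \<alpha> i) \<le> tnorm \<iota> r D (b i ^ \<alpha> i) * tnorm \<iota> r D (\<Prod>i\<in>A. b i ^ \<alpha> i)"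
      using tnorm_mult[OF r] insert by simp
    also have "\<dots> \<le> \<delta> ^ \<alpha> i * \<delta> ^ (\<Sum>i\<in>A. \<alpha> i)" by (intro mult_mono pw insert tnorm_nonneg r zero_le_power \<delta>)
    finally show ?case using insert by (simp add: power_add)
  qed (simp_all add: one)
  then show ?thesis by (simp add: mdeg_def)
qed

text \<open>Method of majorants: a monomial of degree k in the \<open>b i\<close> has norm at most
  \<delta>^k, so \<delta> takes the place of the radius in the norm of \<open>a\<close>.\<close>

lemma tnorm_msubst:
  assumes r: "r \<ge> 0" and b0: "\<And>i. cterm (b i) = 0" and b: "\<And>i. tnorm \<iota> r D (b i) \<le> \<delta>"
  shows "tnorm \<iota> r D (msubst a b) \<le> tnorm \<iota> \<delta> D a"
proof -
  let ?n = "\<lambda>x. norm (\<iota> x)"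
  let ?B = "\<lambda>\<alpha>. \<Prod>i\<in>UNIV. b i ^ \<alpha> i"
  have "tnorm \<iota> r D (msubst a b) \<le> (\<Sum>m | mdeg m \<le> D. \<Sum>\<alpha> | mdeg \<alpha> \<le> D. ?n (mcoeff a \<alpha>) * (?n (mcoeff (?B \<alpha>) m) * r ^ mdeg m))"
    unfolding tnorm_def
  proof (rule sum_mono)
    fix m :: "'b \<Rightarrow> nat" assume "m \<in> {m. mdeg m \<le> D}"
    then have "mcoeff (msubst a b) m = (\<Sum>\<alpha> | mdeg \<alpha> \<le> D. mcoeff a \<alpha> * mcoeff (?B \<alpha>) m)"
      by (intro mcoeff_msubst b0) simp
    then have "?n (mcoeff (msubst a b) m) \<le> (\<Sum>\<alpha> | mdeg \<alpha> \<le> D. ?n (mcoeff a \<alpha>) * ?n (mcoeff (?B \<alpha>) m))"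
      by (simp add: embed_sum embed_mult norm_mult[symmetric] norm_sum)
    then have "?n (mcoeff (msubst a b) m) * r ^ mdeg m
        \<le> (\<Sum>\<alpha> | mdeg \<alpha> \<le> D. ?n (mcoeff a \<alpha>) * ?n (mcoeff (?B \<alpha>) m)) * r ^ mdeg m"
      using r by (intro mult_right_mono) auto
    then show "?n (mcoeff (msubst a b) m) * r ^ mdeg m
        \<le> (\<Sum>\<alpha> | mdeg \<alpha> \<le> D. ?n (mcoeff a \<alpha>) * (?n (mcoeff (?B \<alpha>) m) * r ^ mdeg m))"
      by (simp add: sum_distrib_right mult.assoc)
  qed
  also have "\<dots> = (\<Sum>\<alpha> | mdeg \<alpha> \<le> D. ?n (mcoeff a \<alpha>) * tnorm \<iota> r D (?B \<alpha>))"
    unfolding tnorm_def by (subst sum.swap) (simp add: sum_distrib_left)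
  also have "\<dots> \<le> tnorm \<iota> \<delta> D a"
    unfolding tnorm_def[of _ \<delta>] by (intro sum_mono mult_left_mono tnorm_monomial r b) auto
  finally show ?thesis .
qed

text \<open>Every monomial that occurs has degree at least \<open>k\<close>, so shrinking the radius
  gains the factor \<open>(r / R) ^ k\<close>. This is the source of smallness in the later
  estimates.\<close>

lemma tnorm_scale:
  assumes "mord k a" "0 \<le> r" "r \<le> R" "R > 0"
  shows "tnorm \<iota> r D a \<le> (r / R) ^ k * tnorm \<iota> R D a"
  unfolding tnorm_def sum_distrib_left
proof (rule sum_mono)
  fix m :: "'a \<Rightarrow> nat"
  show "norm (\<iota> (mcoeff a m)) * r ^ mdeg m \<le> (r / R) ^ k * (norm (\<iota> (mcoeff a m)) * R ^ mdeg m)"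
  proof (cases "mdeg m < k")
    case True
    then show ?thesis using assms(1) by (simp add: mord_def embed_0)
  next
    case False
    have "r ^ mdeg m = (r / R) ^ mdeg m * R ^ mdeg m" using assms by (simp add: power_divide)
    also have "\<dots> \<le> (r / R) ^ k * R ^ mdeg m"
      using assms False by (intro mult_right_mono power_decreasing) auto
    finally have "norm (\<iota> (mcoeff a m)) * r ^ mdeg m \<le> norm (\<iota> (mcoeff a m)) * ((r / R) ^ k * R ^ mdeg m)"
      by (intro mult_left_mono) auto
    then show ?thesis by (simp add: mult_ac)
  qed
qed

lemma tnorm_mono_radius:
  assumes "0 \<le> r" "r \<le> R"
  shows "tnorm \<iota> r D a \<le> tnorm \<iota> R D a"
  unfolding tnorm_def using assms by (intro sum_mono mult_left_mono power_mono) auto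

lemma common_bound:
  fixes a :: "'i::finite \<Rightarrow> ('v::finite, 'k) mps"
  assumes "\<And>i. germ (Analytic \<iota>) (a i)"
  obtains R C where "R > 0" "C > 0" "\<And>i D. tnorm \<iota> R D (a i) \<le> C"
proof -
  obtain r C where rC: "\<And>i. r i > 0" "\<And>i D. tnorm \<iota> (r i) D (a i) \<le> C i"
    using assms unfolding germ_iff_bounded by metis
  let ?R = "Min (range r)"
  have R: "?R > 0" "\<And>i. ?R \<le> r i" using rC(1) by auto
  show ?thesis
  \<comment> \<open>The summand 1 keeps the bound positive, since later radii are quotients by
    it.\<close>
  proof (rule that[of ?R "(\<Sum>i\<in>UNIV. \<bar>C i\<bar>) + 1"])
    fix i D
    have "tnorm \<iota> ?R D (a i) \<le> C i" using tnorm_mono_radius[of ?R "r i" D "a i"] R rC(2)[of i D] by (simp add: less_imp_le)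
    also have "\<dots> \<le> \<bar>C i\<bar>" by simp
    also have "\<dots> \<le> (\<Sum>i\<in>UNIV. \<bar>C i\<bar>)" by (rule member_le_sum) auto
    finally show "tnorm \<iota> ?R D (a i) \<le> (\<Sum>i\<in>UNIV. \<bar>C i\<bar>) + 1" by simp
  qed (use R in \<open>auto intro!: add_nonneg_pos sum_nonneg\<close>)
qed

lemma germ_analytic_add:
  assumes "germ (Analytic \<iota>) a" "germ (Analytic \<iota>) b"
  shows "germ (Analytic \<iota>) (a + b)"
proof -
  obtain R C where R: "R > 0" "C > 0" "\<And>i D. tnorm \<iota> R D (if i then a else b) \<le> C"
    using common_bound[of "\<lambda>i::bool. if i then a else b"] assms by (metis (full_types))
  have "tnorm \<iota> R D (a + b) \<le> C + C" for D
    using tnorm_add[of R D a b] R(1) R(3)[where i = True and D = D] R(3)[where i = False and D = D] by simp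
  then show ?thesis unfolding germ_iff_bounded using R(1) by blast
qed

lemma germ_analytic_mult:
  assumes "germ (Analytic \<iota>) a" "germ (Analytic \<iota>) b"
  shows "germ (Analytic \<iota>) (a * b)"
proof -
  obtain R C where R: "R > 0" "C > 0" "\<And>i D. tnorm \<iota> R D (if i then a else b) \<le> C"
    using common_bound[of "\<lambda>i::bool. if i then a else b"] assms by (metis (full_types))
  have "tnorm \<iota> R D (a * b) \<le> C * C" for D
  proof -
    have "tnorm \<iota> R D (a * b) \<le> tnorm \<iota> R D a * tnorm \<iota> R D b" using R(1) by (intro tnorm_mult) auto
    also have "\<dots> \<le> C * C" using R(1,2) R(3)[where i = True and D = D] R(3)[where i = False and D = D]
      by (intro mult_mono tnorm_nonneg) auto
    finally show ?thesis .
  qed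
  then show ?thesis unfolding germ_iff_bounded using R(1) by blast
qed

lemma germ_analytic_msubst:
  assumes a: "germ (Analytic \<iota>) a" and b: "\<And>i. germ (Analytic \<iota>) (b i)" and b0: "\<And>i. cterm (b i) = 0"
  shows "germ (Analytic \<iota>) (msubst a b)"
proof -
  obtain R0 A where R0: "R0 > 0" "\<And>D. tnorm \<iota> R0 D a \<le> A"
    using a unfolding germ_iff_bounded by blast
  obtain R C where R: "R > 0" "C > 0" "\<And>i D. tnorm \<iota> R D (b i) \<le> C"
    using common_bound[of b] b by metis
  \<comment> \<open>The \<open>b i\<close> have order 1, so at radius \<open>?r\<close> their bound
    \<open>C\<close> is scaled by \<open>?r / R\<close> and falls below the radius \<open>R0\<close>
    of \<open>a\<close>.\<close>
  let ?r = "min R (R * R0 / C)"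
  have r: "?r > 0" using R R0 by auto
  have "tnorm \<iota> ?r D (b i) \<le> R0" for i D
  proof -
    have "tnorm \<iota> ?r D (b i) \<le> (?r / R) ^ 1 * tnorm \<iota> R D (b i)"
      using r R by (intro tnorm_scale) (auto simp: mord_1_iff b0)
    also have "\<dots> \<le> (R0 / C) * C"
      using r R R0 by (intro mult_mono tnorm_nonneg) (auto simp: field_simps min_def)
    finally show ?thesis using R by simp
  qed
  then have "tnorm \<iota> ?r D (msubst a b) \<le> A" for D
    using tnorm_msubst[of ?r b D R0 a] b0 r R0(2)[of D] by (simp add: less_imp_le order.trans)
  then show ?thesis unfolding germ_iff_bounded using r by blast
qed

lemma germ_analytic_mderiv:
  assumes "germ (Analytic \<iota>) a"
  shows "germ (Analytic \<iota>) (mderiv i a)"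
proof -
  obtain R C where R: "R > 0" "\<And>D. tnorm \<iota> R D a \<le> C"
    using assms unfolding germ_iff_bounded by blast
  \<comment> \<open>Halving the radius absorbs the factor \<open>Suc (m i)\<close> produced by
    differentiation.\<close>
  have bound: "real (Suc n) * (1 / 2) ^ n \<le> 2" for n
  proof -
    have "real (Suc n) \<le> 2 * 2 ^ n" by (induction n) auto
    then show ?thesis by (simp add: power_one_over field_simps)
  qed
  have "tnorm \<iota> (R / 2) D (mderiv i a) \<le> 2 / R * C" for D
  proof -
    have "tnorm \<iota> (R / 2) D (mderiv i a)
        \<le> (\<Sum>m | mdeg m \<le> D. 2 / R * (norm (\<iota> (mcoeff a (m(i := Suc (m i))))) * R ^ mdeg (m(i := Suc (m i)))))"
      unfolding tnorm_def
    proof (rule sum_mono)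
      fix m :: "'a \<Rightarrow> nat"
      let ?x = "norm (\<iota> (mcoeff a (m(i := Suc (m i)))))"
      have "norm (\<iota> (mcoeff (mderiv i a) m)) * (R / 2) ^ mdeg m = (real (Suc (m i)) * (1 / 2) ^ mdeg m) * (?x * R ^ mdeg m)"
        by (simp add: mcoeff_mderiv embed_mult embed_of_nat norm_mult power_divide del: of_nat_Suc)
      also have "\<dots> \<le> (real (Suc (mdeg m)) * (1 / 2) ^ mdeg m) * (?x * R ^ mdeg m)"
        using le_mdeg[of m i] R by (intro mult_right_mono) auto
      also have "\<dots> \<le> 2 * (?x * R ^ mdeg m)"
        using R by (intro mult_right_mono bound) auto
      also have "\<dots> = 2 / R * (?x * R ^ mdeg (m(i := Suc (m i))))"
        using R by (simp add: mdeg_upd_Suc)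
      finally show "norm (\<iota> (mcoeff (mderiv i a) m)) * (R / 2) ^ mdeg m \<le> \<dots>" .
    qed
    also have "\<dots> = 2 / R * (\<Sum>m\<in>(\<lambda>m. m(i := Suc (m i))) ` {m. mdeg m \<le> D}. norm (\<iota> (mcoeff a m)) * R ^ mdeg m)"
    proof (subst sum.reindex)
      show "inj_on (\<lambda>m. m(i := Suc (m i))) {m. mdeg m \<le> D}"
      proof (rule inj_onI)
        fix m m' :: "'a \<Rightarrow> nat" assume eq: "m(i := Suc (m i)) = m'(i := Suc (m' i))"
        have "m j = m' j" for j using fun_cong[OF eq, of j] by (auto split: if_splits)
        then show "m = m'" by auto
      qed
    qed (simp add: sum_distrib_left)
    also have "\<dots> \<le> 2 / R * tnorm \<iota> R (Suc D) a"
      unfolding tnorm_def using R by (intro mult_left_mono sum_mono2) (auto simp: mdeg_upd_Suc)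
    also have "\<dots> \<le> 2 / R * C" using R by (intro mult_left_mono) auto
    finally show ?thesis .
  qed
  moreover have "R / 2 > 0" using R by simp
  ultimately show ?thesis unfolding germ_iff_bounded by blast
qed

text \<open>The recursion (k + 1) C(d, k + 1) = (d - k) C(d, k) gives |C(d, k)| <= (|d| + 1)^k. At
  half the reciprocal of |d| + 1 the series is dominated by a geometric series of ratio 1/2.\<close>

lemma germ_analytic_mpowr_unit: "germ (Analytic \<iota>) (mpowr () 1 d)"
proof -
  let ?e = "norm (\<iota> d) + 1"
  have e: "?e > 0" by (smt (verit) norm_ge_zero)
  have g: "norm (\<iota> (d gchoose k)) \<le> ?e ^ k" for k
  proof (induction k)
    case (Suc k)
    have "of_nat (Suc k) * (d gchoose Suc k) = (d - of_nat k) * (d gchoose k)"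
      by (simp only: gbinomial_absorption gbinomial_absorb_comp)
    then have "\<iota> (of_nat (Suc k) * (d gchoose Suc k)) = \<iota> ((d + - of_nat k) * (d gchoose k))" by simp
    then have "norm (\<iota> (of_nat (Suc k) * (d gchoose Suc k))) = norm (\<iota> ((d + - of_nat k) * (d gchoose k)))" by (rule arg_cong)
    then have "real (Suc k) * norm (\<iota> (d gchoose Suc k)) = norm (\<iota> d - of_nat k) * norm (\<iota> (d gchoose k))"
      unfolding embed_mult embed_add embed_uminus embed_of_nat norm_mult by (simp del: of_nat_Suc)
    also have "\<dots> \<le> (norm (\<iota> d) + real k) * ?e ^ k"
      using norm_triangle_ineq4[of "\<iota> d" "of_nat k"] Suc e by (intro mult_mono) auto
    also have "\<dots> \<le> (real (Suc k) * ?e) * ?e ^ k"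
      using e by (intro mult_right_mono) (auto simp: algebra_simps)
    finally have "real (Suc k) * norm (\<iota> (d gchoose Suc k)) \<le> real (Suc k) * ?e ^ Suc k" by (simp add: mult_ac)
    then show ?case by (simp del: of_nat_Suc power_Suc)
  qed (simp add: embed_1)
  let ?r = "1 / (2 * ?e)"
  have inj: "inj_on (\<lambda>k _::unit. k :: nat) A" for A by (auto simp: inj_on_def dest: fun_cong)
  have D: "{\<alpha> :: unit \<Rightarrow> nat. mdeg \<alpha> \<le> n} = (\<lambda>k _. k) ` {..n}" for n
    using mle_unit[of "\<lambda>_. n"] by (simp add: mdeg_def UNIV_unit)
  have "tnorm \<iota> ?r D (mpowr () 1 d) \<le> 2" for D
  proof -
    have "tnorm \<iota> ?r D (mpowr () 1 d) = (\<Sum>k\<le>D. norm (\<iota> (d gchoose k)) * ?r ^ k)"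
      unfolding tnorm_def D by (simp add: sum.reindex[OF inj] mpowr_def mdeg_def UNIV_unit)
    also have "\<dots> \<le> (\<Sum>k\<le>D. ?e ^ k * ?r ^ k)"
      using e by (intro sum_mono mult_right_mono g) auto
    also have "\<dots> = (\<Sum>k\<le>D. (1 / 2) ^ k)"
    proof (rule sum.cong[OF refl])
      fix k
      have "?e * ?r = 1 / 2" using e by simp
      then show "?e ^ k * ?r ^ k = (1 / 2) ^ k" by (metis power_mult_distrib)
    qed
    also have "\<dots> \<le> 2" using sum_gp[of "1/2 :: real" 0 D] by (simp add: atMost_atLeast0)
    finally show ?thesis .
  qed
  moreover have "?r > 0" using e by simp
  ultimately show ?thesis unfolding germ_iff_bounded by blast
qed

end

section \<open>Closure of germs under the operations, in both settings\<close>

lemma germ_mconst [simp]: "valid_setting S \<Longrightarrow> germ S (mconst c :: ('b::finite, 'a::field_char_0) mps)"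
proof (cases S)
  case (Analytic \<iota>)
  assume "valid_setting S"
  then have "tnorm \<iota> 1 D (mconst c :: ('b, 'a) mps) \<le> norm (\<iota> c)" for D
    using tnorm_mconst[where 'v = 'b, of \<iota> 1 D c] Analytic by (simp del: valid_setting.simps(2))
  then show ?thesis unfolding Analytic germ_iff_bounded by (intro exI[of _ 1]) auto
qed simp

lemma germ_mvar [simp]: "valid_setting S \<Longrightarrow> germ S (mvar i)"
proof (cases S)
  case (Analytic \<iota>)
  assume v: "valid_setting S"
  have z: "\<iota> 0 = 0" "\<iota> 1 = 1"
    using embed_0[of \<iota>] embed_1[of \<iota>] v Analytic by (simp_all del: valid_setting.simps(2))
  have "tnorm \<iota> 1 D (mvar i) \<le> 1" for D
  proof -
    have "tnorm \<iota> 1 D (mvar i) = (\<Sum>m | mdeg m \<le> D. if m = (\<lambda>_. 0)(i := 1) then 1 else 0)"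
      unfolding tnorm_def by (rule sum.cong) (auto simp: mcoeff_mvar z)
    also have "\<dots> \<le> 1" by (subst sum.delta) auto
    finally show ?thesis .
  qed
  then show ?thesis unfolding Analytic germ_iff_bounded by (intro exI[of _ 1]) auto
qed simp

lemma germ_add: "valid_setting S \<Longrightarrow> germ S a \<Longrightarrow> germ S b \<Longrightarrow> germ S (a + b)"
  and germ_mult: "valid_setting S \<Longrightarrow> germ S a \<Longrightarrow> germ S b \<Longrightarrow> germ S (a * b)"
  and germ_mderiv: "valid_setting S \<Longrightarrow> germ S a \<Longrightarrow> germ S (mderiv i a)"
  by (cases S, simp, simp add: germ_analytic_add germ_analytic_mult germ_analytic_mderiv del: germ.simps(2) valid_setting.simps(2),
      cases S, simp, simp add: germ_analytic_add germ_analytic_mult germ_analytic_mderiv del: germ.simps(2) valid_setting.simps(2),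
      cases S, simp, simp add: germ_analytic_add germ_analytic_mult germ_analytic_mderiv del: germ.simps(2) valid_setting.simps(2))

lemma germ_msubst:
  "valid_setting S \<Longrightarrow> germ S a \<Longrightarrow> (\<And>i. germ S (b i)) \<Longrightarrow> (\<And>i. cterm (b i) = 0) \<Longrightarrow> germ S (msubst a b)"
  by (cases S; simp add: germ_analytic_msubst del: germ.simps(2) valid_setting.simps(2))

lemma germ_uminus: "valid_setting S \<Longrightarrow> germ S a \<Longrightarrow> germ S (- a)"
  using germ_mult[of S "mconst (- 1)" a] germ_mconst[of S "- 1"] by (simp add: mconst_uminus)

lemma germ_diff: "valid_setting S \<Longrightarrow> germ S a \<Longrightarrow> germ S b \<Longrightarrow> germ S (a - b)"
  using germ_add[of S a "- b"] germ_uminus[of S b] by simp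

lemma germ_0 [simp]: "valid_setting S \<Longrightarrow> germ S 0"
  and germ_1 [simp]: "valid_setting S \<Longrightarrow> germ S 1"
  using germ_mconst[of S 0] germ_mconst[of S 1] by auto

lemma germ_sum: "valid_setting S \<Longrightarrow> (\<And>x. x \<in> A \<Longrightarrow> germ S (f x)) \<Longrightarrow> germ S (\<Sum>x\<in>A. f x)"
  by (induction A rule: infinite_finite_induct) (auto intro: germ_add)

lemma germ_prod: "valid_setting S \<Longrightarrow> (\<And>x. x \<in> A \<Longrightarrow> germ S (f x)) \<Longrightarrow> germ S (\<Prod>x\<in>A. f x)"
  by (induction A rule: infinite_finite_induct) (auto intro: germ_mult)

lemma germ_coord [simp]: "valid_setting S \<Longrightarrow> germ S (coord p i)"
  by (simp add: coord_def germ_add)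

lemma germ_mpowr_unit: "valid_setting S \<Longrightarrow> germ S (mpowr () 1 d)"
  by (cases S; simp add: germ_analytic_mpowr_unit del: germ.simps(2) valid_setting.simps(2))

lemma germ_binom: "valid_setting S \<Longrightarrow> germ S a \<Longrightarrow> cterm a = 0 \<Longrightarrow> germ S (binom d a)"
  unfolding binom_def by (rule germ_msubst) (simp_all add: germ_mpowr_unit)

lemma germ_mpowr: "valid_setting S \<Longrightarrow> germ S (mpowr i c d)"
  unfolding mpowr_eq_binom by (intro germ_binom germ_mult) auto

lemma germ_minv: "valid_setting S \<Longrightarrow> germ S a \<Longrightarrow> cterm a \<noteq> 0 \<Longrightarrow> germ S (minv a)"
  unfolding minv_def by (intro germ_mult germ_binom germ_diff) auto

section \<open>Inverse and implicit functions\<close>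

text \<open>Telescoping: \<open>x * y - x' * y' = (x - x') * y + x' * (y - y')\<close>. The
  invariant \<open>?P\<close> records the order \<open>d\<close> of a product together with the
  order \<open>n + d\<close> of the difference.\<close>

lemma mord_monomial_diff:
  fixes b b' :: "'v::finite \<Rightarrow> ('w::finite, 'a::comm_ring_1) mps"
  assumes "\<And>i. cterm (b i) = 0" "\<And>i. cterm (b' i) = 0" "\<And>i. mord (Suc n) (b i - b' i)"
  shows "mord (n + mdeg \<alpha>) ((\<Prod>i\<in>UNIV. b i ^ \<alpha> i) - (\<Prod>i\<in>UNIV. b' i ^ \<alpha> i))"
proof -
  let ?P = "\<lambda>d x x'. mord d x \<and> mord d x' \<and> mord (n + d) (x - x')"
  have mult: "?P (d + e) (x * y) (x' * y')" if "?P d x x'" "?P e y y'" for d e and x y x' y' :: "('w, 'a) mps"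
  proof -
    have "x * y - x' * y' = (x - x') * y + x' * (y - y')" by (simp add: algebra_simps)
    moreover have "mord ((n + d) + e) ((x - x') * y)" "mord (d + (n + e)) (x' * (y - y'))"
      using that by (blast intro: mord_mult)+
    ultimately have "mord (n + (d + e)) (x * y - x' * y')" by (auto simp: ac_simps intro!: mord_add)
    then show ?thesis using that by (auto intro: mord_mult)
  qed
  have base: "?P 1 (b i) (b' i)" for i using assms by (auto simp: mord_1_iff)
  have pw: "?P k (b i ^ k) (b' i ^ k)" for i k
  proof (induction k)
    case (Suc k)
    then show ?case using mult[OF base Suc] by simp
  qed simp
  have "?P (\<Sum>i\<in>A. \<alpha> i) (\<Prod>i\<in>A. b i ^ \<alpha> i) (\<Prod>i\<in>A. b' i ^ \<alpha> i)" for A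
  proof (induction A rule: infinite_finite_induct)
    case (insert i A)
    then show ?case using mult[OF pw insert.IH] by simp
  qed simp_all
  then show ?thesis by (simp add: mdeg_def)
qed

text \<open>Every monomial of \<open>a\<close> has degree at least 2, so by
  \<open>mord_monomial_diff\<close> the order of agreement rises by one. This is the contraction
  behind \<open>fixed_point_exists\<close>.\<close>

lemma mord_msubst_diff:
  fixes b b' :: "'v::finite \<Rightarrow> ('w::finite, 'a::comm_ring_1) mps"
  assumes "\<And>i. cterm (b i) = 0" "\<And>i. cterm (b' i) = 0" "\<And>i. mord (Suc n) (b i - b' i)" "mord 2 a"
  shows "mord (n + 2) (msubst a b - msubst a b')"
  unfolding mord_def
proof (intro allI impI)
  fix m :: "'w \<Rightarrow> nat" assume m: "mdeg m < n + 2"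
  have "mcoeff a \<alpha> * mcoeff (\<Prod>i\<in>UNIV. b i ^ \<alpha> i) m = mcoeff a \<alpha> * mcoeff (\<Prod>i\<in>UNIV. b' i ^ \<alpha> i) m" for \<alpha>
  proof (cases "mdeg \<alpha> < 2")
    case False
    have "mcoeff ((\<Prod>i\<in>UNIV. b i ^ \<alpha> i) - (\<Prod>i\<in>UNIV. b' i ^ \<alpha> i)) m = 0"
      using mord_monomial_diff[OF assms(1-3), of \<alpha>] m False by (auto simp: mord_def)
    then show ?thesis by simp
  qed (use assms(4) in \<open>simp add: mord_def\<close>)
  then show "mcoeff (msubst a b - msubst a b') m = 0" by (simp add: msubst_def)
qed

text \<open>Iterating \<open>T \<mapsto> L + N(T)\<close> from 0 converges in the degree filtration
  by the contraction above. The formal solution is constructed once; the last clause adds that it is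
  a germ whenever the data are, which makes the inverse and implicit functions below valid in both
  settings.\<close>

lemma fixed_point_exists:
  fixes L N :: "'v::finite \<Rightarrow> ('v, 'a::field_char_0) mps"
  assumes L: "\<And>i. cterm (L i) = 0" and N: "\<And>i. mord 2 (N i)"
  obtains T where "\<And>i. cterm (T i) = 0" "\<And>i. T i = L i + msubst (N i) T"
    "\<And>S i. valid_setting S \<Longrightarrow> (\<And>i. germ S (L i)) \<Longrightarrow> (\<And>i. germ S (N i)) \<Longrightarrow> germ S (T i)"
proof -
  define U where "U k = ((\<lambda>T i. L i + msubst (N i) T) ^^ k) (\<lambda>_. 0)" for k :: nat
  have U0: "U 0 i = 0" and US: "U (Suc k) i = L i + msubst (N i) (U k)" for k i
    by (simp_all add: U_def)
  have N0: "cterm (N i) = 0" for i using mord_mono[OF N[of i], of 1] by (simp add: mord_1_iff)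
  have cU: "cterm (U k i) = 0" for k i by (cases k) (auto simp: U0 US L N0)
  have step: "mord (Suc k) (U (Suc k) i - U k i)" for k i
  proof (induction k arbitrary: i)
    case 0
    then show ?case by (simp add: mord_1_iff cU)
  next
    case (Suc k)
    have "mord (k + 2) (msubst (N i) (U (Suc k)) - msubst (N i) (U k))"
      by (rule mord_msubst_diff) (auto simp: cU Suc N)
    then show ?case by (simp add: US[of _ i])
  qed
  \<comment> \<open>Consecutive iterates \<open>U k\<close> and \<open>U (Suc k)\<close> agree up to
    degree \<open>k\<close>, so the coefficient at \<open>m\<close> is final from the iterate
    \<open>mdeg m\<close> on.\<close>
  define T where "T i = Abs_mps (\<lambda>m. mcoeff (U (mdeg m) i) m)" for i
  have TU: "mcoeff (T i) m = mcoeff (U k i) m" if "mdeg m \<le> k" for i m k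
    using that
  proof (induction k rule: dec_induct)
    case (step k)
    then have "mcoeff (U (Suc k) i - U k i) m = 0" using \<open>\<And>k i. mord (Suc k) (U (Suc k) i - U k i)\<close>[of k i]
      by (auto simp: mord_def)
    then show ?case using step by simp
  qed (simp add: T_def)
  have T_U: "mord (Suc k) (T i - U k i)" for k i by (auto simp: mord_def TU)
  have cT: "cterm (T i) = 0" for i using TU[of "\<lambda>_. 0" 0 i] by (simp add: cterm_def U0)
  show ?thesis
  proof (rule that[OF cT])
    fix i
    show "T i = L i + msubst (N i) T"
    proof (rule mord_eqI)
      fix n
      have "mord (Suc n) (T i - U (Suc n) i)" using T_U[of "Suc n" i] by (rule mord_mono) simp
      moreover have "mord (Suc n) (msubst (N i) (U n) - msubst (N i) T)"
        using mord_msubst_diff[of "U n" T n "N i"] mord_uminus[OF T_U[of n]]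
        by (auto simp: cU cT N intro: mord_mono)
      ultimately have "mord (Suc n) ((T i - U (Suc n) i) + (msubst (N i) (U n) - msubst (N i) T))" by (rule mord_add)
      then show "mord n (T i - (L i + msubst (N i) T))" by (auto simp: US algebra_simps intro: mord_mono)
    qed
  next
    fix S i assume v: "valid_setting S" and gL: "\<And>i. germ S (L i)" and gN: "\<And>i. germ S (N i)"
    show "germ S (T i)"
    proof (cases S)
      case (Analytic \<iota>)
      note v = v[unfolded Analytic]
      obtain R C where R: "R > 0" "C > 0" "\<And>i D. tnorm \<iota> R D (case_sum L N i) \<le> C"
        using common_bound[OF v, of "case_sum L N"] gL gN Analytic by (metis sum.case_eq_if)
      have RL: "tnorm \<iota> R D (L i) \<le> C" and RN: "tnorm \<iota> R D (N i) \<le> C" for i D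
        using R(3)[of D "Inl i"] R(3)[of D "Inr i"] by simp_all
      \<comment> \<open>All iterates have norm at most \<open>\<delta>\<close>, since \<open>N\<close> contributes \<open>O(\<delta>\<^sup>2)\<close> and \<open>L\<close> is small for small \<open>r\<close>.\<close>
      define \<delta> where "\<delta> = min R (R\<^sup>2 / (2 * C))"
      define r where "r = min R (\<delta> * R / (2 * C))"
      have pos: "\<delta> > 0" "r > 0" using R by (auto simp: \<delta>_def r_def)
      have le: "\<delta> \<le> R" "r \<le> R" by (auto simp: \<delta>_def r_def)
      have "\<delta> * C \<le> R\<^sup>2 / 2" using R by (auto simp: \<delta>_def min_def field_simps)
      then have "\<delta> * (\<delta> * C) \<le> \<delta> * (R\<^sup>2 / 2)" using pos by (intro mult_left_mono) auto
      then have *: "(\<delta> / R)\<^sup>2 * C \<le> \<delta> / 2" using R by (simp add: field_simps power2_eq_square)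
      have **: "(r / R) ^ 1 * C \<le> \<delta> / 2" using R by (auto simp: r_def min_def field_simps)
      have bound: "tnorm \<iota> r D (U k i) \<le> \<delta>" for D k i
      proof (induction k arbitrary: i)
        case 0
        then show ?case using pos by (simp add: U0 tnorm_0[OF v])
      next
        case (Suc k)
        have "tnorm \<iota> r D (L i) \<le> (r / R) ^ 1 * tnorm \<iota> R D (L i)"
          using pos le R by (intro tnorm_scale[OF v]) (auto simp: mord_1_iff L)
        also have "\<dots> \<le> (r / R) ^ 1 * C" using pos R by (intro mult_left_mono RL) auto
        finally have 1: "tnorm \<iota> r D (L i) \<le> \<delta> / 2" using ** by linarith
        have "tnorm \<iota> r D (msubst (N i) (U k)) \<le> tnorm \<iota> \<delta> D (N i)"
          using pos by (intro tnorm_msubst[OF v] cU Suc) auto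
        also have "\<dots> \<le> (\<delta> / R)\<^sup>2 * tnorm \<iota> R D (N i)"
          using pos le R by (intro tnorm_scale[OF v] N) auto
        also have "\<dots> \<le> (\<delta> / R)\<^sup>2 * C" by (intro mult_left_mono RN) auto
        finally have 2: "tnorm \<iota> r D (msubst (N i) (U k)) \<le> \<delta> / 2" using * by linarith
        have "tnorm \<iota> r D (U (Suc k) i) \<le> tnorm \<iota> r D (L i) + tnorm \<iota> r D (msubst (N i) (U k))"
          unfolding US using pos by (intro tnorm_add[OF v]) auto
        then show ?case using 1 2 by linarith
      qed
      have "tnorm \<iota> r D (T i) \<le> \<delta>" for D
      proof -
        have "tnorm \<iota> r D (T i) = tnorm \<iota> r D (U D i)"
          unfolding tnorm_def by (rule sum.cong) (auto simp: TU)
        then show ?thesis using bound by simp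
      qed
      then show ?thesis unfolding Analytic germ_iff_bounded using pos by blast
    qed simp
  qed
qed

section \<open>Inverse function theorem\<close>

lemma linear_part:
  fixes a :: "('v::finite, 'a::comm_ring_1) mps"
  assumes "cterm a = 0"
  shows "mord 2 (a - (\<Sum>j\<in>UNIV. mconst (cterm (mderiv j a)) * mvar j))"
  unfolding mord_def
proof (intro allI impI)
  fix m :: "'v \<Rightarrow> nat" assume "mdeg m < 2"
  then consider "m = (\<lambda>_. 0)" | i where "m = (\<lambda>_. 0)(i := 1)"
  proof -
    have "mdeg m = 0 \<or> mdeg m = 1" using \<open>mdeg m < 2\<close> by linarith
    then show thesis
    proof
      assume "mdeg m = 1"
      then show thesis by (rule mdeg_eq_1E) (rule that(2))
    qed (use that(1) in \<open>simp add: mdeg_eq_0_iff\<close>)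
  qed
  then show "mcoeff (a - (\<Sum>j\<in>UNIV. mconst (cterm (mderiv j a)) * mvar j)) m = 0"
  proof cases
    case 1
    have "cterm (a - (\<Sum>j\<in>UNIV. mconst (cterm (mderiv j a)) * mvar j)) = 0" using assms by simp
    then show ?thesis unfolding 1 cterm_def .
  next
    case (2 i)
    have eq: "(\<lambda>_. 0)(i := 1::nat) = (\<lambda>_. 0)(j := 1) \<longleftrightarrow> i = j" for j by (auto simp: fun_eq_iff split: if_splits)
    have "(\<Sum>j\<in>UNIV. cterm (mderiv j a) * (if (\<lambda>_. 0)(i := 1::nat) = (\<lambda>_. 0)(j := 1) then 1 else 0)) = cterm (mderiv i a)"
      unfolding eq by (simp add: if_distrib[of "(*) _"] sum.delta' cong: if_cong)
    also have "\<dots> = mcoeff a m" by (simp add: 2 cterm_def mcoeff_mderiv)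
    finally show ?thesis by (simp add: mcoeff_mvar 2 del: fun_upd_apply)
  qed
qed

definition jacobian_at_0 :: "('v \<Rightarrow> ('v::finite, 'a::comm_ring_1) mps) \<Rightarrow> 'a ^ 'v ^ 'v" where
  "jacobian_at_0 F = (\<chi> i j. cterm (mderiv j (F i)))"

text \<open>Write F = J x + Q with Q of order 2 and let B be the inverse of J. Then F(T) = x reads T
  = B x - B Q(T), a fixed point equation with linear part \<open>L\<close> and nonlinear part
  \<open>N\<close>.\<close>

lemma right_inverse_exists:
  fixes F :: "'v::finite \<Rightarrow> ('v, 'a::field_char_0) mps"
  assumes F: "\<And>i. cterm (F i) = 0" and J: "det (jacobian_at_0 F) \<noteq> 0"
  obtains T where "\<And>i. cterm (T i) = 0" "\<And>i. msubst (F i) T = mvar i"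
    "\<And>S i. valid_setting S \<Longrightarrow> (\<And>i. germ S (F i)) \<Longrightarrow> germ S (T i)"
proof -
  let ?J = "jacobian_at_0 F"
  have "invertible ?J" using J by (simp add: invertible_det_nz)
  then obtain B where B: "?J ** B = mat 1" "B ** ?J = mat 1" unfolding invertible_def by blast
  have JB: "(\<Sum>k\<in>UNIV. ?J $ i $ k * B $ k $ j) = (if i = j then 1 else 0)" for i j
    using arg_cong[OF B(1), of "\<lambda>A. A $ i $ j"] by (simp add: matrix_matrix_mult_def mat_def)
  define L where "L i = (\<Sum>k\<in>UNIV. mconst (B $ i $ k) * mvar k)" for i
  define Q where "Q k = F k - (\<Sum>j\<in>UNIV. mconst (?J $ k $ j) * mvar j)" for k
  define N where "N i = - (\<Sum>k\<in>UNIV. mconst (B $ i $ k) * Q k)" for i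
  have Q: "mord 2 (Q k)" for k using linear_part[OF F[of k]] by (simp add: Q_def jacobian_at_0_def)
  obtain T where T: "\<And>i. cterm (T i) = 0" "\<And>i. T i = L i + msubst (N i) T"
    "\<And>S i. valid_setting S \<Longrightarrow> (\<And>i. germ S (L i)) \<Longrightarrow> (\<And>i. germ S (N i)) \<Longrightarrow> germ S (T i)"
  proof (rule fixed_point_exists[of L N])
    show "cterm (L i) = 0" for i by (simp add: L_def)
    show "mord 2 (N i)" for i unfolding N_def by (intro mord_uminus mord_sum mord_mult_left Q)
  qed blast
  show ?thesis
  proof (rule that[OF T(1)])
    fix i
    have swap: "(\<Sum>j\<in>UNIV. mconst (?J $ i $ j) * (\<Sum>k\<in>UNIV. mconst (B $ j $ k) * x k)) = x i" for x :: "'v \<Rightarrow> ('v, 'a) mps"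
    proof -
      have "(\<Sum>j\<in>UNIV. mconst (?J $ i $ j) * (\<Sum>k\<in>UNIV. mconst (B $ j $ k) * x k))
          = (\<Sum>k\<in>UNIV. mconst (\<Sum>j\<in>UNIV. ?J $ i $ j * B $ j $ k) * x k)"
        unfolding sum_distrib_left mconst_sum sum_distrib_right by (subst sum.swap) (simp add: mconst_mult mult.assoc)
      also have "\<dots> = (\<Sum>k\<in>UNIV. if k = i then x k else 0)" unfolding JB by (rule sum.cong) auto
      finally show ?thesis by simp
    qed
    have "msubst (F i) T = msubst (Q i + (\<Sum>j\<in>UNIV. mconst (?J $ i $ j) * mvar j)) T" by (simp add: Q_def)
    also have "\<dots> = msubst (Q i) T + (\<Sum>j\<in>UNIV. mconst (?J $ i $ j) * T j)" by (simp add: T(1))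
    also have "(\<Sum>j\<in>UNIV. mconst (?J $ i $ j) * T j) = (\<Sum>j\<in>UNIV. mconst (?J $ i $ j) * (L j + msubst (N j) T))"
      using T(2) by (intro sum.cong refl arg_cong2[of _ _ _ _ "(*)"])
    also have "\<dots> = mvar i - msubst (Q i) T"
      by (simp add: L_def N_def T(1) ring_distribs sum.distrib sum_negf sum_subtractf swap)
    finally show "msubst (F i) T = mvar i" by simp
  next
    fix S i assume v: "valid_setting S" and gF: "\<And>i. germ S (F i)"
    show "germ S (T i)"
    proof (rule T(3)[OF v])
      show "germ S (L i)" for i unfolding L_def by (intro germ_sum germ_mult) (auto simp: v)
      have "germ S (Q i)" for i unfolding Q_def by (intro germ_diff germ_sum germ_mult gF) (auto simp: v)
      then show "germ S (N i)" for i unfolding N_def by (intro germ_uminus germ_sum germ_mult) (auto simp: v)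
    qed
  qed
qed

text \<open>The right inverse \<open>T\<close> has an invertible Jacobian, hence a right inverse
  \<open>R\<close> of its own. Composing \<open>F\<close> with \<open>T\<close> and then with
  \<open>R\<close> gives both \<open>F\<close> and \<open>R\<close>, so \<open>T\<close> is a
  two-sided inverse.\<close>

lemma inverse_function:
  fixes F :: "'v::finite \<Rightarrow> ('v, 'a::field_char_0) mps"
  assumes F: "\<And>i. cterm (F i) = 0" and J: "det (jacobian_at_0 F) \<noteq> 0"
  obtains T where "\<And>i. cterm (T i) = 0" "\<And>i. msubst (F i) T = mvar i" "\<And>i. msubst (T i) F = mvar i"
    "\<And>S i. valid_setting S \<Longrightarrow> (\<And>i. germ S (F i)) \<Longrightarrow> germ S (T i)"
    "jacobian_at_0 F ** jacobian_at_0 T = mat 1"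
proof -
  obtain T where T: "\<And>i. cterm (T i) = 0" "\<And>i. msubst (F i) T = mvar i"
    "\<And>S i. valid_setting S \<Longrightarrow> (\<And>i. germ S (F i)) \<Longrightarrow> germ S (T i)"
    using right_inverse_exists[OF F J] by metis
  have JT: "jacobian_at_0 F ** jacobian_at_0 T = mat 1"
  proof -
    have "(\<Sum>k\<in>UNIV. cterm (mderiv k (F i)) * cterm (mderiv j (T k))) = (if i = j then 1 else 0)" for i j
      using arg_cong[OF T(2)[of i], of "\<lambda>a. cterm (mderiv j a)"] by (subst (asm) mderiv_msubst) (auto simp: T(1) mderiv_mvar)
    then show ?thesis by (simp add: jacobian_at_0_def matrix_matrix_mult_def mat_def)
  qed
  then have "det (jacobian_at_0 F) * det (jacobian_at_0 T) = 1" by (metis det_I det_mul)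
  then have "det (jacobian_at_0 T) \<noteq> 0" by auto
  then obtain R where R: "\<And>i. cterm (R i) = 0" "\<And>i. msubst (T i) R = mvar i"
    using right_inverse_exists[of T] T(1) by metis
  have "F i = R i" for i
  proof -
    have "R i = msubst (mvar i) R" by (simp add: R(1))
    also have "\<dots> = msubst (msubst (F i) T) R" by (simp add: T(2))
    also have "\<dots> = msubst (F i) (\<lambda>k. msubst (T k) R)" by (rule msubst_msubst) (auto simp: T R)
    also have "\<dots> = F i" by (simp add: R(2))
    finally show ?thesis ..
  qed
  then have "F = R" by blast
  then show ?thesis using that T R(2) JT by blast
qed

text \<open>Dividing by the nonzero derivative solves the equation for the variable \<open>j\<close>
  up to terms of order 2, while the other variables are kept; this is again a fixed point
  equation.\<close>

lemma implicit_function: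
  fixes \<phi> :: "('v::finite, 'a::field_char_0) mps"
  assumes \<phi>: "cterm \<phi> = 0" "cterm (mderiv j \<phi>) \<noteq> 0"
  obtains \<xi> where "cterm \<xi> = 0" "indep_of j \<xi>" "msubst \<phi> (mvar(j := \<xi>)) = 0"
    "\<And>S. valid_setting S \<Longrightarrow> germ S \<phi> \<Longrightarrow> germ S \<xi>"
proof -
  let ?d = "\<lambda>k. cterm (mderiv k \<phi>)"
  define Q where "Q = \<phi> - (\<Sum>k\<in>UNIV. mconst (?d k) * mvar k)"
  define L :: "'v \<Rightarrow> ('v, 'a) mps" where "L i = (if i = j then - mconst (1 / ?d j) * (\<Sum>k\<in>-{j}. mconst (?d k) * mvar k) else mvar i)" for i
  define N where "N i = (if i = j then - mconst (1 / ?d j) * Q else 0)" for i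
  have Q: "mord 2 Q" using linear_part[OF \<phi>(1)] by (simp add: Q_def)
  obtain T where T: "\<And>i. cterm (T i) = 0" "\<And>i. T i = L i + msubst (N i) T"
    "\<And>S i. valid_setting S \<Longrightarrow> (\<And>i. germ S (L i)) \<Longrightarrow> (\<And>i. germ S (N i)) \<Longrightarrow> germ S (T i)"
  proof (rule fixed_point_exists[of L N])
    show "cterm (L i) = 0" for i by (simp add: L_def)
    show "mord 2 (N i)" for i unfolding N_def using mord_mult_left[OF Q] by (simp del: mult_minus_left)
  qed blast
  have Tk: "T k = mvar k" if "k \<noteq> j" for k using T(2)[of k] that by (simp add: L_def N_def)
  have "mconst (?d j) * T j = mconst (?d j) * (L j + msubst (N j) T)" using T(2)[of j] by simp
  also have "\<dots> = - (\<Sum>k\<in>-{j}. mconst (?d k) * mvar k) - msubst Q T"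
  proof -
    have "mconst (?d j) * mconst (1 / ?d j) = (1 :: ('v, 'a) mps)" using \<phi>(2) by (simp flip: mconst_mult)
    then show ?thesis by (simp add: L_def N_def T(1) ring_distribs flip: mult.assoc)
  qed
  finally have Tj: "mconst (?d j) * T j + (\<Sum>k\<in>-{j}. mconst (?d k) * mvar k) + msubst Q T = 0" by simp
  have "(\<Sum>k\<in>UNIV. mconst (?d k) * T k) = mconst (?d j) * T j + (\<Sum>k\<in>-{j}. mconst (?d k) * mvar k)"
    by (subst sum.remove[of _ j]) (auto simp: Tk Compl_eq_Diff_UNIV intro!: sum.cong)
  moreover have "msubst \<phi> T = msubst (Q + (\<Sum>k\<in>UNIV. mconst (?d k) * mvar k)) T" by (simp add: Q_def)
  ultimately have 0: "msubst \<phi> T = 0" using Tj by (simp add: T(1) add.commute)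
  \<comment> \<open>Setting the variable \<open>j\<close> to 0 makes the solution visibly
    independent of it. The equation survives, since the other components of \<open>T\<close> are
    plain variables.\<close>
  define \<xi> where "\<xi> = msubst (T j) (mvar(j := 0))"
  show ?thesis
  proof (rule that[of \<xi>])
    show "cterm \<xi> = 0" by (simp add: \<xi>_def T(1))
    have "mderiv j \<xi> = (\<Sum>i\<in>UNIV. msubst (mderiv i (T j)) (mvar(j := 0)) * mderiv j ((mvar(j := 0)) i))"
      unfolding \<xi>_def by (rule mderiv_msubst) simp
    also have "\<dots> = 0" by (intro sum.neutral) (auto simp: mderiv_mvar)
    finally show "indep_of j \<xi>" by (simp add: indep_of_iff)
    have "msubst (msubst \<phi> T) (mvar(j := 0)) = msubst \<phi> (\<lambda>i. msubst (T i) (mvar(j := 0)))"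
      by (rule msubst_msubst) (auto simp: T(1))
    also have "(\<lambda>i. msubst (T i) (mvar(j := 0))) = mvar(j := \<xi>)" by (auto simp: Tk \<xi>_def)
    finally show "msubst \<phi> (mvar(j := \<xi>)) = 0" by (simp only: 0 msubst_0)
    fix S assume v: "valid_setting S" and g: "germ S \<phi>"
    have gQ: "germ S Q" unfolding Q_def by (intro germ_diff germ_sum germ_mult g) (auto simp: v)
    have "germ S (T j)"
    proof (rule T(3)[OF v])
      show "germ S (L i)" for i unfolding L_def using v by (auto intro!: germ_uminus germ_mult germ_sum)
      show "germ S (N i)" for i unfolding N_def using v gQ by (auto intro!: germ_uminus germ_mult)
    qed
    then show "germ S \<xi>" unfolding \<xi>_def using v by (intro germ_msubst) auto
  qed
qed

lemma division_by_variable: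
  fixes a :: "('v::finite, 'a::field_char_0) mps"
  obtains q where "a = msubst a (mvar(j := 0)) + mvar j * q"
proof -
  define q where "q = Abs_mps (\<lambda>m. mcoeff a (m(j := Suc (m j))))"
  have "mcoeff a m = mcoeff (msubst a (mvar(j := 0)) + mvar j * q) m" for m
  proof (cases "m j")
    case 0
    have "mcoeff (mvar j * q) m = 0"
      unfolding mcoeff_mult using 0 by (intro sum.neutral) (auto simp: mcoeff_mvar dest: spec[of _ j])
    moreover have "mcoeff (\<Prod>i\<in>UNIV. (mvar(j := 0)) i ^ \<alpha> i) m = (if m = \<alpha> then 1 else (0 :: 'a))" for \<alpha>
    proof (cases "\<alpha> j = 0")
      case True
      then have "(\<Prod>i\<in>UNIV. (mvar(j := 0)) i ^ \<alpha> i) = (\<Prod>i\<in>UNIV. mvar i ^ \<alpha> i :: ('v, 'a) mps)"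
        by (intro prod.cong) auto
      then show ?thesis by (simp add: monomial_mcoeff)
    next
      case False
      then have "(\<Prod>i\<in>UNIV. (mvar(j := 0)) i ^ \<alpha> i) = (0 :: ('v, 'a) mps)"
        by (intro prod_zero bexI[of _ j]) (auto simp: zero_power)
      then show ?thesis using 0 False by auto
    qed
    then have "mcoeff (msubst a (mvar(j := 0))) m = mcoeff a m"
      by (simp add: msubst_def if_distrib[of "(*) _"] cong: if_cong)
    ultimately show ?thesis by simp
  next
    case (Suc k)
    then have m: "m = (m(j := k))(j := Suc ((m(j := k)) j))" by auto
    have "mcoeff (mvar j * q) m = mcoeff q (m(j := k))" by (subst m, subst mcoeff_mult_mvar_Suc) simp
    also have "\<dots> = mcoeff a m" using Suc by (simp add: q_def fun_upd_idem)
    finally have "mcoeff (mvar j * q) m = mcoeff a m" .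
    moreover have "indep_of j (msubst a (mvar(j := 0)))"
      unfolding indep_of_iff by (subst mderiv_msubst) (auto simp: mderiv_mvar intro!: sum.neutral)
    ultimately show ?thesis using Suc by (simp add: indep_of_def)
  qed
  then show ?thesis using that mps_eqI by blast
qed

text \<open>The substitution \<open>?s\<close> straightens the graph to a coordinate hyperplane,
  where \<open>division_by_variable\<close> applies; \<open>?t\<close> undoes it.\<close>

lemma division_by_graph:
  fixes a \<xi> :: "('v::finite, 'a::field_char_0) mps"
  assumes "cterm \<xi> = 0" "indep_of j \<xi>"
  obtains q where "a = msubst a (mvar(j := \<xi>)) + (mvar j - \<xi>) * q"
proof -
  let ?s = "mvar(j := mvar j + \<xi>)" and ?t = "mvar(j := mvar j - \<xi>)"
  have c: "cterm (?s i) = 0" "cterm (?t i) = 0" "cterm ((mvar(j := 0)) i :: ('v, 'a) mps) = 0" for i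
    using assms by auto
  obtain q where q: "msubst a ?s = msubst (msubst a ?s) (mvar(j := 0)) + mvar j * q"
    using division_by_variable .
  have \<xi>: "msubst \<xi> b = \<xi>" if "\<And>i. i \<noteq> j \<Longrightarrow> b i = mvar i" for b
    using msubst_indep_cong[OF assms(2), of b mvar] that by simp
  have "msubst (msubst a ?s) ?t = msubst a (\<lambda>i. msubst (?s i) ?t)" by (rule msubst_msubst) (use c in auto)
  also have "(\<lambda>i. msubst (?s i) ?t) = mvar" using c by (auto simp: \<xi>)
  finally have 1: "msubst (msubst a ?s) ?t = a" by (simp only: msubst_id)
  have "msubst (msubst a ?s) (mvar(j := 0)) = msubst a (\<lambda>i. msubst (?s i) (mvar(j := 0)))" by (rule msubst_msubst) (use c in auto)
  also have "(\<lambda>i. msubst (?s i) (mvar(j := 0))) = mvar(j := \<xi>)" using c by (auto simp: \<xi>)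
  finally have 2: "msubst (msubst a ?s) (mvar(j := 0)) = msubst a (mvar(j := \<xi>))" .
  have "indep_of j (msubst a (mvar(j := \<xi>)))"
    unfolding indep_of_iff using assms
    by (subst mderiv_msubst) (auto simp: mderiv_mvar indep_of_iff intro!: sum.neutral)
  then have 3: "msubst (msubst a (mvar(j := \<xi>))) ?t = msubst a (mvar(j := \<xi>))"
    using msubst_indep_cong[of j "msubst a (mvar(j := \<xi>))" ?t mvar] by simp
  have "a = msubst (msubst a (mvar(j := \<xi>)) + mvar j * q) ?t"
    using 1 q unfolding 2 by (simp only:)
  also have "\<dots> = msubst a (mvar(j := \<xi>)) + (mvar j - \<xi>) * msubst q ?t" using c by (simp add: 3 del: msubst_msubst)
  finally show ?thesis by (rule that)
qed

unbundle no fps_syntax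

section \<open>Matrices over rings of power series\<close>

text \<open>Power series form no field, so invertibility has to come from a unit determinant.
  \<open>B\<close> is \<open>d\<close> times the adjugate, each cofactor being \<open>det A\<close>
  with row \<open>j\<close> replaced by a unit vector. By linearity in that row, the product with
  row \<open>l\<close> is the determinant with row \<open>j\<close> replaced by row
  \<open>l\<close>.\<close>

lemma right_inverse_of_det_unit:
  fixes A :: "'r::comm_ring_1 ^ 'n ^ 'n"
  assumes d: "det A * d = 1"
  obtains B where "A ** B = mat 1"
proof -
  define B :: "'r ^ 'n ^ 'n" where "B = (\<chi> i j. d * det (\<chi> k. if k = j then axis i 1 else A $ k))"
  have "(A ** B) $ l $ j = (mat 1 :: 'r ^ 'n ^ 'n) $ l $ j" for l j
  proof -
    have "(A ** B) $ l $ j = d * (\<Sum>i\<in>UNIV. A $ l $ i * det (\<chi> k. if k = j then axis i 1 else A $ k))"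
      by (simp add: matrix_matrix_mult_def B_def sum_distrib_left mult_ac)
    also have "(\<Sum>i\<in>UNIV. A $ l $ i * det (\<chi> k. if k = j then axis i 1 else A $ k))
        = (\<Sum>i\<in>UNIV. det (\<chi> k. if k = j then A $ l $ i *s axis i 1 else A $ k))"
      by (simp add: det_row_mul)
    also have "\<dots> = det (\<chi> k. if k = j then (\<Sum>i\<in>UNIV. A $ l $ i *s axis i 1) else A $ k)"
      by (rule det_linear_row_sum[symmetric]) simp
    also have "(\<Sum>i\<in>UNIV. A $ l $ i *s axis i 1) = A $ l"
      by (rule basis_expansion)
    also have "det (\<chi> k. if k = j then A $ l else A $ k) = (if l = j then det A else 0)"
    proof (cases "l = j")
      case True
      then have "(\<chi> k. if k = j then A $ l else A $ k) = A" by (simp add: vec_eq_iff)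
      then show ?thesis using True by simp
    next
      case False
      then have "det (\<chi> k. if k = j then A $ l else A $ k) = 0"
        by (intro det_identical_rows[of l j]) (auto simp: row_def vec_eq_iff)
      then show ?thesis using False by simp
    qed
    finally show ?thesis using d by (auto simp: mat_def mult.commute)
  qed
  then have "A ** B = mat 1" by (simp add: vec_eq_iff)
  then show ?thesis by (rule that)
qed

lemma inverse_of_det_unit:
  fixes A :: "'r::comm_ring_1 ^ 'n ^ 'n"
  assumes d: "det A * d = 1"
  obtains B where "A ** B = mat 1" "B ** A = mat 1"
proof -
  obtain B where B: "A ** B = mat 1" using right_inverse_of_det_unit[OF d] .
  then have "det B * det A = 1" by (metis det_I det_mul mult.commute)
  then obtain C where C: "B ** C = mat 1" using right_inverse_of_det_unit by blast
  have "C = A" using B C by (metis matrix_mul_assoc matrix_mul_lid matrix_mul_rid)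
  then show ?thesis using that B C by blast
qed

lemma matrix_inv_eqI:
  fixes A B :: "'r::comm_ring_1 ^ 'n ^ 'n"
  assumes "A ** B = mat 1" "B ** A = mat 1"
  shows "matrix_inv A = B"
proof -
  have "A ** matrix_inv A = mat 1 \<and> matrix_inv A ** A = mat 1"
    unfolding matrix_inv_def by (rule someI[of _ B]) (use assms in blast)
  then show ?thesis using assms by (metis matrix_mul_assoc matrix_mul_lid matrix_mul_rid)
qed

text \<open>Substitution, extension of scalars and the constant term are all ring maps. The locale
  gives at once that they commute with determinants and with inverses of matrices.\<close>

locale ring_map =
  fixes h :: "'r::comm_ring_1 \<Rightarrow> 's::comm_ring_1"
  assumes h_add: "h (a + b) = h a + h b" and h_mult: "h (a * b) = h a * h b" and h_1: "h 1 = 1"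
begin

lemma h_0: "h 0 = 0"
  using h_add[of 0 0] by simp

lemma h_uminus: "h (- a) = - h a"
  using h_add[of a "- a"] h_0 by (simp add: eq_neg_iff_add_eq_0 add.commute)

lemma h_sum: "h (\<Sum>x\<in>A. f x) = (\<Sum>x\<in>A. h (f x))"
  by (induction A rule: infinite_finite_induct) (auto simp: h_add h_0)

lemma h_prod: "h (\<Prod>x\<in>A. f x) = (\<Prod>x\<in>A. h (f x))"
  by (induction A rule: infinite_finite_induct) (auto simp: h_mult h_1)

lemma det_map: "det (\<chi> i j. h (A $ i $ j)) = h (det A)" for A :: "'r ^ 'n ^ 'n"
proof -
  have "h (of_int (sign p)) = of_int (sign p)" for p :: "'n \<Rightarrow> 'n"
    by (simp add: sign_def h_1 h_uminus)
  then show ?thesis by (simp add: det_def h_sum h_mult h_prod)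
qed

lemma matrix_inv_map:
  fixes A :: "'r ^ 'n ^ 'n"
  assumes "det A * d = 1"
  shows "matrix_inv (\<chi> i j. h (A $ i $ j)) = (\<chi> i j. h (matrix_inv A $ i $ j))"
proof -
  obtain B where B: "A ** B = mat 1" "B ** A = mat 1" using inverse_of_det_unit[OF assms] .
  have mult: "(\<chi> i j. h (A $ i $ j)) ** (\<chi> i j. h (B $ i $ j)) = (\<chi> i j. h ((A ** B) $ i $ j))"
    for A B :: "'r ^ 'n ^ 'n"
    by (simp add: matrix_matrix_mult_def vec_eq_iff h_sum h_mult)
  have one: "(\<chi> i j. h ((mat 1 :: 'r ^ 'n ^ 'n) $ i $ j)) = mat 1"
    by (simp add: mat_def vec_eq_iff h_0 h_1)
  show ?thesis unfolding matrix_inv_eqI[OF B]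
    by (rule matrix_inv_eqI) (simp_all add: mult B one)
qed

end

lemma matrix_inv_scale:
  fixes A :: "'r::comm_ring_1 ^ 'n ^ 'n"
  assumes d: "det A * d = 1" and c: "c * c' = 1"
  shows "matrix_inv (\<chi> i j. c * A $ i $ j) = (\<chi> i j. c' * matrix_inv A $ i $ j)"
proof -
  obtain B where B: "A ** B = mat 1" "B ** A = mat 1" using inverse_of_det_unit[OF d] .
  have mult: "(\<chi> i j. a * A $ i $ j) ** (\<chi> i j. b * B $ i $ j) = (\<chi> i j. (a * b) * (A ** B) $ i $ j)"
    for A B :: "'r ^ 'n ^ 'n" and a b
    by (simp add: matrix_matrix_mult_def vec_eq_iff sum_distrib_left mult_ac)
  show ?thesis unfolding matrix_inv_eqI[OF B]
  proof (rule matrix_inv_eqI)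
    show "(\<chi> i j. c * A $ i $ j) ** (\<chi> i j. c' * B $ i $ j) = mat 1"
      unfolding mult B c by (simp add: vec_eq_iff)
    show "(\<chi> i j. c' * B $ i $ j) ** (\<chi> i j. c * A $ i $ j) = mat 1"
      unfolding mult B mult.commute[of c' c] c by (simp add: vec_eq_iff)
  qed
qed

lemma det_scale: "det (\<chi> i j. c * A $ i $ j) = c ^ CARD('n) * det A" for A :: "'r::comm_ring_1 ^ 'n ^ 'n"
proof -
  have "(\<chi> i j. c * A $ i $ j) = (\<chi> i. c *s A $ i)" by (simp add: vec_eq_iff)
  then show ?thesis using det_rows_mul[of "\<lambda>_. c" "\<lambda>i. A $ i"] by simp
qed

lemma ring_map_msubst: "(\<And>i. cterm (b i) = 0) \<Longrightarrow> ring_map (\<lambda>a. msubst a b)"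
  by unfold_locales auto

lemma ring_map_mmap_to_ac: "ring_map (mmap to_ac)"
  by unfold_locales auto

lemma ring_map_cterm: "ring_map cterm"
  by unfold_locales auto

lemma cterm_det: "cterm (det A) = det (\<chi> i j. cterm (A $ i $ j))"
  by (rule ring_map.det_map[OF ring_map_cterm, symmetric])

lemma unit_inverseE:
  fixes a :: "('v::finite, 'a::field_char_0) mps"
  assumes "cterm a \<noteq> 0"
  obtains b where "a * b = 1"
  using mult_minv[OF assms] by blast

section \<open>Stationary phase\<close>

lemma shift_mult [simp]: "shift e (a * b) = shift e a * shift e b"
  and shift_diff [simp]: "shift e (a - b) = shift e a - shift e b"
  and shift_mconst [simp]: "shift e (mconst c) = mconst c"
  by (simp_all add: shift_def)

lemma shift_indep:
  fixes a :: "('v::finite, 'a::field_char_0) mps"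
  assumes "\<And>i. mderiv (e i) a = 0"
  shows "shift e a = mrename Inl a"
  unfolding shift_def mrename_def
proof (rule msubst_cong)
  fix m i assume "mcoeff a m \<noteq> 0" "m i \<noteq> 0"
  then have "i \<noteq> e k" for k using assms[of k] by (auto simp flip: indep_of_iff simp: indep_of_def)
  then have "{k. e k = i} = {}" by auto
  then show "mvar (Inl i) + (\<Sum>k | e k = i. mvar (Inr k)) = mvar (Inl i)" by simp
qed


lemma mmap_to_ac_shift [simp]: "mmap to_ac (shift e a) = shift e (mmap to_ac a)"
  by (simp add: shift_def)

lemma mmap_to_ac_at_u0 [simp]:
  fixes a :: "('v::finite + 'n::finite, 'k::field) mps"
  shows "mmap to_ac (at_u0 a) = at_u0 (mmap to_ac a)"
proof -
  have "mmap to_ac (case_sum mvar (\<lambda>_. 0) x :: ('v, 'k) mps) = case_sum mvar (\<lambda>_. 0) x" for x :: "'v + 'n"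
    by (cases x) auto
  then show ?thesis by (simp add: at_u0_def)
qed

lemma mderiv_Inr_mrename_Inl [simp]: "mderiv (Inr i) (mrename Inl a) = 0"
  by (rule mderiv_mrename_notin) auto

lemma mderiv_power_eq_0: "mderiv i a = 0 \<Longrightarrow> mderiv i (a ^ n) = 0"
  for a :: "('v::finite, 'a::comm_ring_1) mps"
  by (induction n) auto

lemma hess_mmap_to_ac: "hess e (mmap to_ac f) = (\<chi> i j. mmap to_ac (hess e f $ i $ j))"
  by (simp add: hess_def vec_eq_iff)

lemma det_hess_mmap_to_ac: "det (hess e (mmap to_ac f)) = mmap to_ac (det (hess e f))"
  unfolding hess_mmap_to_ac by (rule ring_map.det_map[OF ring_map_mmap_to_ac])

lemma matrix_inv_hess_mmap_to_ac:
  fixes f :: "('v::finite, 'k::field_char_0) mps"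
  assumes "cterm (det (hess e f)) \<noteq> 0"
  shows "matrix_inv (hess e (mmap to_ac f)) = (\<chi> i j. mmap to_ac (matrix_inv (hess e f) $ i $ j))"
proof -
  obtain d where "det (hess e f) * d = 1" using unit_inverseE[OF assms] .
  then show ?thesis unfolding hess_mmap_to_ac by (rule ring_map.matrix_inv_map[OF ring_map_mmap_to_ac])
qed

lemma mmap_to_ac_stat_rem: "mmap to_ac (stat_rem e f) = stat_rem e (mmap to_ac f)"
  by (simp add: stat_rem_def hess_mmap_to_ac)

lemma mmap_to_ac_stat_delta:
  assumes "cterm (det (hess e f)) \<noteq> 0"
  shows "mmap to_ac (stat_delta e f a) = stat_delta e (mmap to_ac f) (mmap to_ac a)"
  by (simp add: stat_delta_def matrix_inv_hess_mmap_to_ac[OF assms])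

lemma mmap_to_ac_stat_coeff:
  assumes "cterm (det (hess e f)) \<noteq> 0"
  shows "mmap to_ac (stat_coeff e f g k) = stat_coeff e (mmap to_ac f) (mmap to_ac g) k"
proof -
  have iter: "mmap to_ac ((stat_delta e f ^^ n) a) = (stat_delta e (mmap to_ac f) ^^ n) (mmap to_ac a)" for n a
    by (induction n) (auto simp: mmap_to_ac_stat_delta[OF assms])
  have fact: "to_ac (fact n :: 'a) = fact n" for n by (metis of_nat_fact to_ac_of_nat)
  show ?thesis by (simp add: stat_coeff_def iter mmap_to_ac_stat_rem fact)
qed

text \<open>The range \<open>v \<le> 2 * k\<close> shrinks to v = 0, and shifting by
  \<open>u\<close> followed by u = 0 returns \<open>g\<close>.\<close>

lemma stat_coeff_0:
  fixes e :: "'n::finite \<Rightarrow> 'v::finite"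
  assumes "inj e"
  shows "stat_coeff e f g 0 = g"
proof -
  have "cterm (case_sum mvar (\<lambda>_. 0) j :: ('v, 'a::field_char_0) mps) = 0" for j :: "'v + 'n" by (cases j) auto
  then have "at_u0 (shift e g) = msubst g (\<lambda>j. mvar j)"
    by (simp add: at_u0_def shift_def msubst_msubst)
  then show ?thesis by (simp add: stat_coeff_def)
qed

text \<open>
  The substitution of \<open>s\<close> for \<open>t\<close> and of \<open>x\<^sup>-\<^sup>1 u\<close> for \<open>u\<close> multiplies \<open>R\<close> by \<open>x y\<close> and \<open>\<Delta>\<close> by \<open>(x y)\<^sup>-\<^sup>1\<close>;
  here \<open>x'\<close>, \<open>y'\<close> are the inverses of \<open>x\<close>, \<open>y\<close>.
\<close>
locale phase_pullback =
  fixes e :: "'n::finite \<Rightarrow> 'v::finite"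
    and x x' y y' w :: "('v, 'a::field_char_0) mps" and s :: "'n \<Rightarrow> ('v, 'a) mps"
  assumes inj_e: "inj e"
    and x: "x * x' = 1" and y: "y * y' = 1"
    and indep: "\<And>i. mderiv (e i) x = 0" "\<And>i. mderiv (e i) y = 0" "\<And>i. mderiv (e i) w = 0"
    and cs: "\<And>i. cterm (s i) = 0"
    and shift_s: "\<And>i. shift e (s i) = mrename Inl (s i) + mrename Inl x' * mvar (Inr i)"
    and ds: "\<And>i j. mderiv (e j) (s i) = (if i = j then x' else 0)"
begin

lemma indep': "mderiv (e i) x' = 0" "mderiv (e i) y' = 0"
  using mderiv_inverse[OF x] mderiv_inverse[OF y] by (simp_all add: indep)

lemma mderiv_pullback: "mderiv (e i) (msubst f s) = msubst (mderiv i f) s * x'"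
proof -
  have "mderiv (e i) (msubst f s) = (\<Sum>k\<in>UNIV. if k = i then msubst (mderiv k f) s * x' else 0)"
    unfolding mderiv_msubst[OF cs] by (rule sum.cong) (auto simp: ds)
  then show ?thesis by simp
qed

lemma mderiv_phase: "mderiv (e i) (x * y * msubst f s) = y * msubst (mderiv i f) s"
proof -
  have "mderiv (e i) (x * y * msubst f s) = (x * x') * (y * msubst (mderiv i f) s)"
    by (simp add: indep mderiv_pullback mult_ac)
  then show ?thesis using x by simp
qed

lemma hess_phase: "hess e (x * y * msubst f s) = (\<chi> i j. (y * x') * (\<chi> i j. msubst (hess (\<lambda>i. i) f $ i $ j) s) $ i $ j)"
  unfolding hess_def mderiv_phase by (simp add: indep mderiv_pullback mult_ac vec_eq_iff)

lemma det_hess_phase: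
  "det (- hess e (x * y * msubst f s)) = (y * x') ^ CARD('n) * msubst (det (- hess (\<lambda>i. i) f)) s"
proof -
  have "- hess e (x * y * msubst f s) = (\<chi> i j. (y * x') * (\<chi> i j. msubst ((- hess (\<lambda>i. i) f) $ i $ j) s) $ i $ j)"
    unfolding hess_phase by (simp add: vec_eq_iff)
  then show ?thesis by (simp only: det_scale ring_map.det_map[OF ring_map_msubst, OF cs])
qed

definition \<theta> :: "'n + 'n \<Rightarrow> ('v + 'n, 'a) mps" where
  "\<theta> = case_sum (\<lambda>i. mrename Inl (s i)) (\<lambda>i. mrename Inl x' * mvar (Inr i))"

lemma c\<theta> [simp]: "cterm (\<theta> j) = 0"
  by (cases j) (auto simp: \<theta>_def cs)

lemma pullback_mrename: "msubst (mrename Inl a) \<theta> = mrename Inl (msubst a s)"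
  by (simp add: msubst_mrename mrename_msubst cs) (simp add: \<theta>_def)

lemma pullback_shift: "msubst (shift (\<lambda>i. i) f) \<theta> = shift e (msubst f s)"
proof -
  have "shift e (msubst f s) = msubst f (\<lambda>i. shift e (s i))"
    unfolding shift_def by (rule msubst_msubst) (auto simp: cs)
  then show ?thesis by (simp add: shift_def msubst_msubst shift_s[unfolded shift_def]) (simp add: \<theta>_def)
qed

lemma mderiv_pullback_Inr: "mderiv (Inr i) (msubst a \<theta>) = mrename Inl x' * msubst (mderiv (Inr i) a) \<theta>"
proof -
  have "mderiv (Inr i) (\<theta> j) = (if j = Inr i then mrename Inl x' else 0)" for j
    by (cases j) (auto simp: \<theta>_def mderiv_mrename_notin mderiv_mvar)
  then have "mderiv (Inr i) (msubst a \<theta>) = (\<Sum>j\<in>UNIV. if j = Inr i then msubst (mderiv j a) \<theta> * mrename Inl x' else 0)"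
    unfolding mderiv_msubst[OF c\<theta>] by (intro sum.cong) auto
  then show ?thesis by (simp add: mult.commute)
qed

text \<open>Each derivative of \<open>s\<close> in an integration variable brings a factor
  \<open>x'\<close>, which is exactly the factor of the substituted \<open>u\<close>. So every
  Taylor term, and with it the remainder, pulls back with the common prefactor
  \<open>x * y\<close>.\<close>

lemma pullback_stat_rem: "stat_rem e (x * y * msubst f s) = mrename Inl (x * y) * msubst (stat_rem (\<lambda>i. i) f) \<theta>"
proof -
  let ?F = "x * y * msubst f s"
  have \<theta>r: "\<theta> (Inr i) = mrename Inl x' * mvar (Inr i)" for i by (simp add: \<theta>_def)
  have 1: "shift e ?F = mrename Inl (x * y) * msubst (shift (\<lambda>i. i) f) \<theta>"
    unfolding pullback_shift by (simp add: shift_indep indep)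
  have 2: "mrename Inl ?F = mrename Inl (x * y) * msubst (mrename Inl f) \<theta>"
    unfolding pullback_mrename by simp
  have r: "mrename Inl x * mrename Inl x' = (1 :: ('v + 'n, 'a) mps)" using x by (simp flip: mrename_mult)
  have 3: "mrename Inl (mderiv (e i) ?F) * mvar (Inr i)
      = mrename Inl (x * y) * msubst (mrename Inl (mderiv i f) * mvar (Inr i)) \<theta>" for i
  proof -
    have "mrename Inl (x * y) * msubst (mrename Inl (mderiv i f) * mvar (Inr i)) \<theta>
        = (mrename Inl x * mrename Inl x') * (mrename Inl y * mrename Inl (msubst (mderiv i f) s) * mvar (Inr i))"
      by (simp add: pullback_mrename \<theta>r mult_ac)
    then show ?thesis unfolding r mderiv_phase by simp
  qed
  have 4: "mrename Inl (hess e ?F $ i $ j) * mvar (Inr i) * mvar (Inr j)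
      = mrename Inl (x * y) * msubst (mrename Inl (hess (\<lambda>i. i) f $ i $ j) * mvar (Inr i) * mvar (Inr j)) \<theta>" for i j
  proof -
    have "mrename Inl (x * y) * msubst (mrename Inl (hess (\<lambda>i. i) f $ i $ j) * mvar (Inr i) * mvar (Inr j)) \<theta>
        = (mrename Inl x * mrename Inl x') * (mrename Inl (y * x') * mrename Inl (msubst (hess (\<lambda>i. i) f $ i $ j) s) * mvar (Inr i) * mvar (Inr j))"
      by (simp add: pullback_mrename \<theta>r mult_ac)
    then show ?thesis unfolding r hess_phase by simp
  qed
  show ?thesis unfolding stat_rem_def 1 2 3 4
    by (simp only: right_diff_distrib msubst_diff msubst_mult[OF c\<theta>] msubst_sum msubst_mconst sum_distrib_left)
       (simp add: mult_ac sum_distrib_left)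
qed

text \<open>The inverse Hessian of the phase carries the factor \<open>x * y'\<close>, and the two
  derivatives in \<open>u\<close> carry \<open>x'\<close> each; together they give
  \<open>x' * y'\<close>.\<close>

lemma pullback_stat_delta:
  assumes f: "cterm (det (hess (\<lambda>i. i) f)) \<noteq> 0" and c: "\<And>i. mderiv (e i) c = 0"
  shows "stat_delta e (x * y * msubst f s) (mrename Inl c * msubst a \<theta>)
    = mrename Inl (c * (x' * y')) * msubst (stat_delta (\<lambda>i. i) f a) \<theta>"
proof -
  obtain d where d: "det (hess (\<lambda>i. i) f) * d = 1" using unit_inverseE[OF f] .
  have d': "det (\<chi> i j. msubst (hess (\<lambda>i. i) f $ i $ j) s) * msubst d s = 1"
    unfolding ring_map.det_map[OF ring_map_msubst, OF cs] using d by (simp add: cs flip: msubst_mult)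
  have u: "(y * x') * (x * y') = 1"
  proof -
    have "(y * x') * (x * y') = (x * x') * (y * y')" by (simp add: mult_ac)
    then show ?thesis using x y by simp
  qed
  have inv: "matrix_inv (hess e (x * y * msubst f s)) $ i $ j = x * y' * msubst (matrix_inv (hess (\<lambda>i. i) f) $ i $ j) s" for i j
    unfolding hess_phase matrix_inv_scale[OF d' u]
      ring_map.matrix_inv_map[OF ring_map_msubst[OF cs] d] by simp
  have r: "mrename Inl x * mrename Inl x' = (1 :: ('v + 'n, 'a) mps)" using x by (simp flip: mrename_mult)
  have dd: "mderiv (Inr i) (mderiv (Inr j) (mrename Inl c * msubst a \<theta>))
      = mrename Inl c * mrename Inl x' * mrename Inl x' * msubst (mderiv (Inr i) (mderiv (Inr j) a)) \<theta>" for i j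
    by (simp add: mderiv_pullback_Inr mderiv_mrename_notin mult_ac)
  have "mrename Inl (matrix_inv (hess e (x * y * msubst f s)) $ i $ j) * mderiv (Inr i) (mderiv (Inr j) (mrename Inl c * msubst a \<theta>))
      = mrename Inl (c * (x' * y')) * msubst (mrename Inl (matrix_inv (hess (\<lambda>i. i) f) $ i $ j) * mderiv (Inr i) (mderiv (Inr j) a)) \<theta>" for i j
  proof -
    have "mrename Inl (matrix_inv (hess e (x * y * msubst f s)) $ i $ j) * mderiv (Inr i) (mderiv (Inr j) (mrename Inl c * msubst a \<theta>))
      = (mrename Inl x * mrename Inl x') * (mrename Inl (c * (x' * y')) * (mrename Inl (msubst (matrix_inv (hess (\<lambda>i. i) f) $ i $ j) s) * msubst (mderiv (Inr i) (mderiv (Inr j) a)) \<theta>))"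
      unfolding dd inv by (simp add: mult_ac)
    then show ?thesis unfolding r by (simp add: pullback_mrename)
  qed
  then show ?thesis unfolding stat_delta_def
    by (simp only: msubst_uminus msubst_mult[OF c\<theta>] msubst_sum msubst_mconst sum_distrib_left mult_minus_left mult_minus_right)
       (simp add: mult_ac sum_distrib_left)
qed

lemma at_u0_pullback: "at_u0 (mrename Inl c * msubst a \<theta>) = c * msubst (at_u0 a) s"
proof -
  define \<kappa>1 :: "'v + 'n \<Rightarrow> ('v, 'a) mps" where "\<kappa>1 = case_sum mvar (\<lambda>_. 0)"
  define \<kappa>2 :: "'n + 'n \<Rightarrow> ('n, 'a) mps" where "\<kappa>2 = case_sum mvar (\<lambda>_. 0)"
  have c1: "cterm (\<kappa>1 j) = 0" for j by (cases j) (auto simp: \<kappa>1_def)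
  have c2: "cterm (\<kappa>2 j) = 0" for j by (cases j) (auto simp: \<kappa>2_def)
  have "msubst (\<theta> j) \<kappa>1 = msubst (\<kappa>2 j) s" for j
  proof (cases j)
    case (Inl i)
    have "msubst (mrename Inl (s i)) \<kappa>1 = msubst (s i) mvar" by (simp add: msubst_mrename c1) (simp add: \<kappa>1_def)
    then show ?thesis using Inl by (simp add: \<theta>_def \<kappa>2_def cs)
  next
    case (Inr i)
    then show ?thesis by (simp add: \<theta>_def c1 cs) (simp add: \<kappa>1_def \<kappa>2_def)
  qed
  then have "msubst (msubst a \<theta>) \<kappa>1 = msubst (msubst a \<kappa>2) s" by (simp add: msubst_msubst c1 c2 cs)
  moreover have "msubst (mrename Inl c) \<kappa>1 = c" by (simp add: msubst_mrename c1) (simp add: \<kappa>1_def)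
  ultimately show ?thesis unfolding at_u0_def \<kappa>1_def[symmetric] \<kappa>2_def[symmetric] by (simp add: c1)
qed

text \<open>In the term with index \<open>v\<close>, the remainder contributes
  \<open>(x * y) ^ v\<close> and the \<open>k + v\<close> applications of the operator contribute
  \<open>(x' * y') ^ (k + v)\<close>. What remains is \<open>(x' * y') ^ k\<close>, the same for all
  \<open>v\<close>, so it can be taken out of the sum.\<close>

theorem stat_coeff_pullback:
  assumes f: "cterm (det (hess (\<lambda>i. i) f)) \<noteq> 0"
  shows "stat_coeff e (x * y * msubst f s) (w * msubst g s) k = w * (x' * y') ^ k * msubst (stat_coeff (\<lambda>i. i) f g k) s"
proof -
  let ?F = "x * y * msubst f s"
  have iter: "(stat_delta e ?F ^^ n) (mrename Inl c * msubst a \<theta>)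
      = mrename Inl (c * (x' * y') ^ n) * msubst ((stat_delta (\<lambda>i. i) f ^^ n) a) \<theta>"
    if "\<And>i. mderiv (e i) c = 0" for n c a
  proof (induction n)
    case (Suc n)
    have "mderiv (e i) (c * (x' * y') ^ n) = 0" for i
      using that by (simp add: indep' mderiv_power_eq_0)
    note step = pullback_stat_delta[OF f this]
    have "(stat_delta e ?F ^^ Suc n) (mrename Inl c * msubst a \<theta>)
        = stat_delta e ?F (mrename Inl (c * (x' * y') ^ n) * msubst ((stat_delta (\<lambda>i. i) f ^^ n) a) \<theta>)"
      by (simp only: funpow.simps o_apply Suc)
    then show ?case unfolding step by (simp only: funpow.simps o_apply power_Suc2 mult.assoc)
  qed simp
  have "at_u0 ((stat_delta e ?F ^^ (k + v)) (shift e (w * msubst g s) * stat_rem e ?F ^ v))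
      = w * (x' * y') ^ k * msubst (at_u0 ((stat_delta (\<lambda>i. i) f ^^ (k + v)) (shift (\<lambda>i. i) g * stat_rem (\<lambda>i. i) f ^ v))) s" for v
  proof -
    have w': "mderiv (e i) (w * (x * y) ^ v) = 0" for i
      by (simp add: indep mderiv_power_eq_0)
    have "shift e (w * msubst g s) * stat_rem e ?F ^ v
        = mrename Inl (w * (x * y) ^ v) * msubst (shift (\<lambda>i. i) g * stat_rem (\<lambda>i. i) f ^ v) \<theta>"
      unfolding pullback_stat_rem
      by (simp add: pullback_shift shift_indep indep power_mult_distrib mult_ac)
    then have "at_u0 ((stat_delta e ?F ^^ (k + v)) (shift e (w * msubst g s) * stat_rem e ?F ^ v))
      = w * (x * y) ^ v * (x' * y') ^ (k + v) * msubst (at_u0 ((stat_delta (\<lambda>i. i) f ^^ (k + v)) (shift (\<lambda>i. i) g * stat_rem (\<lambda>i. i) f ^ v))) s"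
      by (simp only: iter[OF w'] at_u0_pullback)
    moreover have "w * (x * y) ^ v * (x' * y') ^ (k + v) = w * (x' * y') ^ k * ((x * x') * (y * y')) ^ v"
      by (simp add: power_add power_mult_distrib mult_ac)
    ultimately show ?thesis using x y by simp
  qed
  then show ?thesis by (simp add: stat_coeff_def cs sum_distrib_left mult_ac)
qed

end

section \<open>Densities on hypersurfaces\<close>

lemma delta_eq_refl: "delta_eq G G"
  unfolding delta_eq_def by (rule exI[of _ 1], rule exI[of _ 0]) simp

lemma delta_eq_sym:
  fixes G G' :: "('v::finite, 'a::field_char_0) mps \<times> ('v, 'a) mps"
  assumes "delta_eq G G'"
  shows "delta_eq G' G"
proof -
  obtain u w where u: "cterm u \<noteq> 0" and G: "fst G = u * fst G'" "snd G = u * snd G' + w * fst G'"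
    using assms unfolding delta_eq_def by blast
  obtain v where v: "u * v = 1" using unit_inverseE[OF u] .
  have "fst G' = v * fst G" "snd G' = v * snd G + (- (v * w * v)) * fst G"
  proof -
    have "v * fst G = (u * v) * fst G'" by (simp add: G mult_ac)
    then show 1: "fst G' = v * fst G" using v by simp
    have "v * snd G = (u * v) * snd G' + v * w * fst G'" by (simp add: G algebra_simps)
    then show "snd G' = v * snd G + (- (v * w * v)) * fst G" using v 1 by (simp add: mult_ac)
  qed
  moreover have "cterm v \<noteq> 0" using unit_of_mult[of v u] v by (simp add: mult.commute)
  ultimately show ?thesis unfolding delta_eq_def by blast
qed

lemma delta_eq_trans:
  fixes G :: "('v::finite, 'a::field_char_0) mps \<times> ('v, 'a) mps"
  assumes "delta_eq G G'" "delta_eq G' G''"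
  shows "delta_eq G G''"
proof -
  obtain u w u' w' where u: "cterm u \<noteq> 0" "cterm u' \<noteq> 0" and G: "fst G = u * fst G'" "snd G = u * snd G' + w * fst G'"
    "fst G' = u' * fst G''" "snd G' = u' * snd G'' + w' * fst G''"
    using assms unfolding delta_eq_def by blast
  have "cterm (u * u') \<noteq> 0 \<and> fst G = (u * u') * fst G'' \<and> snd G = (u * u') * snd G'' + (u * w' + w * u') * fst G''"
    using u by (simp add: G algebra_simps)
  then show ?thesis unfolding delta_eq_def by blast
qed

lemma delta_eq_msubst:
  assumes "delta_eq (\<phi>, h) (\<phi>', h')" "\<And>i. cterm (b i) = 0"
  shows "delta_eq (msubst \<phi> b, msubst h b) (msubst \<phi>' b, msubst h' b)"
proof -
  obtain u w where u: "cterm u \<noteq> 0" "\<phi> = u * \<phi>'" "h = u * h' + w * \<phi>'"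
    using assms(1) unfolding delta_eq_def by auto
  have "cterm (msubst u b) \<noteq> 0 \<and> msubst \<phi> b = msubst u b * msubst \<phi>' b
      \<and> msubst h b = msubst u b * msubst h' b + msubst w b * msubst \<phi>' b"
    using u assms(2) by simp
  then show ?thesis unfolding delta_eq_def fst_conv snd_conv by blast
qed

lemma delta_eq_mult:
  assumes "delta_eq (\<phi>, h) (\<phi>', h')"
  shows "delta_eq (\<phi>, c * h) (\<phi>', c * h')"
proof -
  obtain u w where u: "cterm u \<noteq> 0" "\<phi> = u * \<phi>'" "h = u * h' + w * \<phi>'"
    using assms(1) unfolding delta_eq_def by auto
  have "c * h = u * (c * h') + (c * w) * \<phi>'" unfolding u by (simp add: algebra_simps)
  then show ?thesis unfolding delta_eq_def fst_conv snd_conv using u by blast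
qed

lemma delta_eq_unit:
  assumes "cterm u \<noteq> 0"
  shows "delta_eq (u * \<phi>, u * h) (\<phi>, h)"
  unfolding delta_eq_def using assms by (intro exI[of _ u] exI[of _ 0]) simp

lemma coord_eq_graph_subst:
  assumes "cterm \<psi> = p j"
  shows "msubst (coord p j) (mvar(j := \<psi> - mconst (p j))) = \<psi>"
  using assms by (simp add: coord_def)

text \<open>Restrict to the graph by substituting \<open>\<psi>'\<close> for the coordinate
  \<open>j\<close>. The equation for the hypersurfaces gives \<open>\<psi> = \<psi>'\<close>, its
  derivative in that coordinate shows that the unit \<open>u\<close> is 1 on the graph, and the
  equation for the densities then gives \<open>\<eta> = \<eta>'\<close>.\<close>

lemma delta_eq_graph:
  fixes \<psi> \<psi>' :: "('v::finite, 'a::field_char_0) mps"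
  assumes "delta_eq (coord p j - \<psi>, \<eta>) (coord p j - \<psi>', \<eta>')"
    and indep: "indep_of j \<psi>" "indep_of j \<psi>'" "indep_of j \<eta>" "indep_of j \<eta>'" and c: "cterm \<psi>' = p j"
  shows "\<psi> = \<psi>' \<and> \<eta> = \<eta>'"
proof -
  obtain u w where u: "coord p j - \<psi> = u * (coord p j - \<psi>')" "\<eta> = u * \<eta>' + w * (coord p j - \<psi>')"
    using assms(1) unfolding delta_eq_def by auto
  define b where "b = mvar(j := \<psi>' - mconst (p j))"
  have b0: "cterm (b i) = 0" for i using c by (auto simp: b_def)
  have id: "msubst a b = a" if "indep_of j a" for a
    using msubst_indep_cong[OF that, of b mvar] by (simp add: b_def)
  have x: "msubst (coord p j) b = \<psi>'" using coord_eq_graph_subst[of \<psi>' p j] c by (simp add: b_def)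
  have 1: "\<psi>' - \<psi> = 0"
    using arg_cong[OF u(1), of "\<lambda>a. msubst a b"] by (simp add: b0 x id indep)
  have "mderiv j u * (coord p j - \<psi>') + u = 1"
    using arg_cong[OF u(1), of "mderiv j"] indep by (simp add: coord_def mderiv_mvar indep_of_iff)
  then have "msubst (mderiv j u * (coord p j - \<psi>') + u) b = 1" by (simp only: msubst_1)
  then have 2: "msubst u b = 1" by (simp add: b0 x id indep)
  have "\<eta> = \<eta>'" using arg_cong[OF u(2), of "\<lambda>a. msubst a b"] by (simp add: b0 x id indep 2)
  then show ?thesis using 1 by simp
qed

section \<open>Powers of a coordinate and rescaling\<close>

lemma cterm_mpowr [simp]: "cterm (mpowr i c d) = 1"
  by (simp add: cterm_def mpowr_def)

lemma mderiv_mpowr_neq: "j \<noteq> i \<Longrightarrow> mderiv j (mpowr i c d) = 0" for c :: "'a::field_char_0"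
  unfolding indep_of_iff[symmetric] by (auto simp: indep_of_def mpowr_def)

lemma coord_mult_mpowr:
  fixes p :: "'v::finite \<Rightarrow> 'a::field_char_0"
  assumes "c \<noteq> 0" "p i = c"
  shows "coord p i * (mconst (1 / c) * mpowr i c (- 1)) = 1"
proof -
  have "mconst c * mconst (1 / c) = (1 :: ('v, 'a) mps)" using assms(1) by (simp flip: mconst_mult)
  then have *: "mconst (1 / c) * coord p i = 1 + mconst (1 / c) * mvar i"
    using assms(2) by (simp add: coord_def ring_distribs mult.commute)
  have "coord p i * (mconst (1 / c) * mpowr i c (- 1)) = mpowr i c (- 1) * (mconst (1 / c) * coord p i)"
    by (simp only: mult_ac)
  also have "\<dots> = 1" unfolding * mpowr_eq_binom using binom_minus_of_nat[of "mconst (1 / c) * mvar i" 1] by simp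
  finally show ?thesis .
qed

lemma msubst_zero: "msubst a (\<lambda>_. 0) = mconst (cterm a)"
  by (rule map_eq_on_series[where G = "\<lambda>a. mconst (cterm a)"])
    (auto intro!: mord_msubst elim: mord_mono simp: mconst_add mconst_mult, simp add: mord_def cterm_def)

lemma binom_at_0 [simp]: "binom d 0 = 1"
  by (simp add: binom_def msubst_zero)

lemma rescale_mult [simp]: "rescale p (a * b) = rescale p a * rescale p b"
  and rescale_add [simp]: "rescale p (a + b) = rescale p a + rescale p b"
  and rescale_diff [simp]: "rescale p (a - b) = rescale p a - rescale p b"
  and rescale_mconst [simp]: "rescale p (mconst c) = mconst c"
  and rescale_1 [simp]: "rescale p 1 = 1"
  by (simp_all add: rescale_def)

lemma rescale_coord: "rescale p (coord p i) = (1 + mvar None) * mrename Some (coord p i)"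
  by (simp add: rescale_def coord_def algebra_simps)

lemma rescale_msubst: "(\<And>i. cterm (b i) = 0) \<Longrightarrow> rescale p (msubst a b) = msubst a (\<lambda>i. rescale p (b i))"
  unfolding rescale_def by (rule msubst_msubst) auto

lemma mmap_to_ac_rescale [simp]: "mmap to_ac (rescale p a) = rescale (to_ac \<circ> p) (mmap to_ac a)"
  by (simp add: rescale_def)

text \<open>The affine chart of projective space where the coordinate \<open>i\<^sub>0\<close> is
  nonzero. It is used with \<open>(First, Last)\<close> for a density and with
  \<open>(Last, First)\<close> for its transform. The value of \<open>p\<close> at
  \<open>i\<^sub>1\<close> is left open, because it depends on the function whose graph is
  considered.\<close>

locale cone_chart =
  fixes i\<^sub>0 i\<^sub>1 :: "'n::finite amb" and p :: "'n amb \<Rightarrow> 'a::field_char_0" and c :: 'a and t :: "'n \<Rightarrow> 'a"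
  assumes i: "i\<^sub>0 \<noteq> i\<^sub>1" "\<And>i. i\<^sub>0 \<noteq> Mid i" "\<And>i. i\<^sub>1 \<noteq> Mid i"
    and c: "c \<noteq> 0" and p0: "p i\<^sub>0 = c" and pMid: "\<And>i. p (Mid i) = c * t i"
begin

lemma i': "i\<^sub>1 \<noteq> i\<^sub>0" "Mid i \<noteq> i\<^sub>0" "Mid i \<noteq> i\<^sub>1"
  using i by metis+

lemma UNIV_chart: "UNIV = insert i\<^sub>0 (insert i\<^sub>1 (range Mid))"
  using i by (cases i\<^sub>0; cases i\<^sub>1) (auto simp: UNIV_amb)

lemma sum_chart: "(\<Sum>j\<in>UNIV. F j) = F i\<^sub>0 + F i\<^sub>1 + (\<Sum>i\<in>UNIV. F (Mid i))" for F :: "'n amb \<Rightarrow> 'b::comm_monoid_add"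
proof -
  have "inj (Mid :: 'n \<Rightarrow> 'n amb)" by (auto simp: inj_def)
  then have "(\<Sum>j\<in>range Mid. F j) = (\<Sum>i\<in>UNIV. F (Mid i))" by (simp add: sum.reindex)
  moreover have "i\<^sub>0 \<notin> insert i\<^sub>1 (range Mid)" "i\<^sub>1 \<notin> range Mid" using i by auto
  ultimately show ?thesis unfolding UNIV_chart by (simp add: add.assoc)
qed

lemma chart_cases: obtains "j = i\<^sub>0" | "j = i\<^sub>1" | i where "j = Mid i"
  using UNIV_chart by (metis UNIV_I imageE insertE)

definition x :: "('n amb, 'a) mps" where "x = coord p i\<^sub>0"
definition x' :: "('n amb, 'a) mps" where "x' = mconst (1 / c) * mpowr i\<^sub>0 c (- 1)"
definition s :: "'n \<Rightarrow> ('n amb, 'a) mps" where "s i = coord p (Mid i) * x' - mconst (t i)"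

lemma xx': "x * x' = 1"
  unfolding x_def x'_def by (rule coord_mult_mpowr[of c p i\<^sub>0, OF c p0])

lemma cterm_x [simp]: "cterm x = c" and cterm_x' [simp]: "cterm x' = 1 / c" and cterm_s [simp]: "cterm (s i) = 0"
  using c by (simp_all add: x_def x'_def s_def p0 pMid)

lemma mderiv_x: "mderiv j x = (if j = i\<^sub>0 then 1 else 0)"
  by (simp add: x_def coord_def mderiv_mvar)

lemma mderiv_x': "mderiv j x' = (if j = i\<^sub>0 then - (x' ^ 2) else 0)"
  using mderiv_inverse[OF xx', of j] by (simp add: mderiv_x)

lemma mderiv_coord: "mderiv j (coord p k) = (if j = k then 1 else 0)"
  by (simp add: coord_def mderiv_mvar)

lemma mderiv_s: "mderiv j (s i) = (if j = Mid i then x' else if j = i\<^sub>0 then - (coord p (Mid i) * x' ^ 2) else 0)"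
  using i' by (auto simp: s_def mderiv_x' mderiv_coord)

lemma mderiv_pullback_Mid: "mderiv (Mid i) (msubst f s) = msubst (mderiv i f) s * x'"
proof -
  have "mderiv (Mid i) (msubst f s) = (\<Sum>k\<in>UNIV. if k = i then msubst (mderiv k f) s * x' else 0)"
    unfolding mderiv_msubst[of s, OF cterm_s] using i' by (intro sum.cong) (auto simp: mderiv_s)
  then show ?thesis by simp
qed

lemma mderiv_pullback_i1: "mderiv i\<^sub>1 (msubst f s) = 0"
  using i i' by (simp add: mderiv_msubst mderiv_s)

lemma mderiv_pullback_i0: "mderiv i\<^sub>0 (msubst f s) = - (\<Sum>i\<in>UNIV. msubst (mderiv i f) s * coord p (Mid i)) * x' ^ 2"
  using i i' by (simp add: mderiv_msubst mderiv_s sum_negf sum_distrib_left sum_distrib_right mult_ac)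

text \<open>Makes \<open>stat_coeff_pullback\<close> available on the cone: shifting a middle
  coordinate by \<open>u\<close> shifts its ratio to \<open>x\<close> by \<open>x' u\<close>.
  Neither \<open>x\<close> nor \<open>s\<close> involves the coordinate \<open>i\<^sub>1\<close>, so
  in the mixed wave function that slot can hold the dual variable \<open>y\<close>.\<close>

lemma phase_pullback_Mid:
  assumes "y * y' = 1" "\<And>i. mderiv (Mid i) y = 0" "\<And>i. mderiv (Mid i) w = 0"
  shows "phase_pullback Mid x x' y y' w s"
proof
  have injM: "inj (Mid :: 'n \<Rightarrow> 'n amb)" by (auto simp: inj_def)
  then show "inj (Mid :: 'n \<Rightarrow> 'n amb)" .
  show "mderiv (Mid i) x = 0" for i using i' by (simp add: mderiv_x)
  show "shift Mid (s i) = mrename Inl (s i) + mrename Inl x' * mvar (Inr i)" for i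
  proof -
    have "shift Mid x' = mrename Inl x'" using i' by (intro shift_indep) (simp add: mderiv_x')
    moreover have "{k. Mid k = Mid i} = {i}" by auto
    then have "shift Mid (coord p (Mid i)) = mrename Inl (coord p (Mid i)) + mvar (Inr i)"
      by (simp add: shift_def coord_def)
    ultimately show ?thesis by (simp add: s_def ring_distribs mult.commute)
  qed
  show "mderiv (Mid j) (s i) = (if i = j then x' else 0)" for i j using i' by (simp add: mderiv_s)
qed (use xx' assms in auto)

lemma x'_unit: "x' * x = 1"
  using xx' by (simp add: mult.commute)

lemma rescale_x': "rescale p x' * (1 + mvar None) = mrename Some x'"
proof -
  let ?X = "mrename Some x :: ('n amb option, 'a) mps"
  have u: "cterm ?X \<noteq> 0" using c by simp
  have "?X * (rescale p x' * (1 + mvar None)) = rescale p (x * x')"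
    by (simp add: x_def rescale_coord mult_ac)
  also have "\<dots> = ?X * mrename Some x'" using xx' by (simp flip: mrename_mult)
  finally show ?thesis by (rule unit_cancel[OF u])
qed

lemma rescale_ratio: "rescale p (coord p j * x') = mrename Some (coord p j * x')"
proof -
  have "rescale p (coord p j * x') = mrename Some (coord p j) * (rescale p x' * (1 + mvar None))"
    by (simp add: rescale_coord mult_ac)
  then show ?thesis by (simp add: rescale_x')
qed

lemma rescale_s: "rescale p (s i) = mrename Some (s i)"
  unfolding s_def rescale_diff mrename_diff rescale_ratio by simp

lemma rescale_pullback: "rescale p (msubst f s) = mrename Some (msubst f s)"
  by (simp add: rescale_msubst rescale_s mrename_msubst)

text \<open>Rescaling turns 1 + y into (1 + \<epsilon>) (1 + y), and \<open>binom_half_mult\<close>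
  splits the power of this product.\<close>

lemma rescale_mpowr:
  "rescale p (mpowr i\<^sub>0 c (- of_nat n / 2)) = mpowr None 1 (- of_nat n / 2) * mrename Some (mpowr i\<^sub>0 c (- of_nat n / 2))"
proof -
  let ?y = "mconst (1 / c) * mvar i\<^sub>0 :: ('n amb, 'a) mps"
  have "mconst (1 / c) * mconst c = (1 :: ('n amb option, 'a) mps)" using c by (simp flip: mconst_mult)
  then have "rescale p ?y = mvar None + mrename Some ?y + mvar None * mrename Some ?y"
    by (simp add: rescale_def p0 ring_distribs mult.left_commute[of "mconst (1 / c)"] add_ac)
  moreover have "rescale p (binom d ?y) = binom d (rescale p ?y)" for d
    unfolding rescale_def by (rule msubst_binom) auto
  moreover have "mrename Some (binom d ?y) = binom d (mrename Some ?y)" for d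
    unfolding mrename_def by (rule msubst_binom) auto
  moreover have "binom (- of_nat n / 2) (mvar None + mrename Some ?y + mvar None * mrename Some ?y)
      = binom (- of_nat n / 2) (mvar None) * binom (- of_nat n / 2) (mrename Some ?y)"
    by (rule binom_half_mult) auto
  ultimately show ?thesis unfolding mpowr_eq_binom by (simp only: div_by_1 mconst_1 mult_1_left)
qed

text \<open>A section of the chart map \<open>s\<close> (see \<open>slice_s\<close>): the point of
  the hyperplane \<open>x = c\<close> with prescribed affine coordinates, in local coordinates at
  \<open>p\<close>.\<close>

definition slice :: "'n amb \<Rightarrow> ('n, 'a) mps" where
  "slice j = (case j of Mid i \<Rightarrow> mconst c * mvar i | _ \<Rightarrow> 0)"

lemma cterm_slice [simp]: "cterm (slice j) = 0"
  by (auto simp: slice_def split: amb.split)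

lemma slice_i0 [simp]: "slice i\<^sub>0 = 0" and slice_i1 [simp]: "slice i\<^sub>1 = 0" and slice_Mid [simp]: "slice (Mid i) = mconst c * mvar i"
  using i by (auto simp: slice_def split: amb.split)

text \<open>
  Every ray meets the hyperplane \<open>x\<^sub>0 = c\<close>; \<open>\<kappa>\<close> moves the base point there and takes \<open>1 + \<epsilon> = x\<^sub>0 / c\<close>.
\<close>
lemma homogeneous_expansion:
  assumes a: "indep_of i\<^sub>1 a" and h: "rescale p a = mpowr None 1 d * mrename Some a"
  shows "a = mpowr i\<^sub>0 c d * msubst (msubst a slice) s"
proof -
  define \<kappa> :: "'n amb option \<Rightarrow> ('n amb, 'a) mps" where
    "\<kappa> = case_option (mconst (1 / c) * mvar i\<^sub>0) (\<lambda>j. msubst (slice j) s)"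
  have \<kappa>0: "cterm (\<kappa> j) = 0" for j by (cases j) (auto simp: \<kappa>_def)
  have cc: "mconst c * mconst (1 / c) = (1 :: ('n amb, 'a) mps)" "mconst (1 / c) * mconst c = (1 :: ('n amb, 'a) mps)"
    using c by (simp_all flip: mconst_mult)
  have "msubst (rescale p a) \<kappa> = msubst a (\<lambda>j. msubst (mvar (Some j) + mvar None * (mconst (p j) + mvar (Some j))) \<kappa>)"
    unfolding rescale_def by (rule msubst_msubst) (auto simp: \<kappa>0)
  also have "\<dots> = msubst a mvar"
  proof (rule msubst_indep_cong[OF a])
    fix j assume j: "j \<noteq> i\<^sub>1"
    have "\<kappa> (Some j) + \<kappa> None * (mconst (p j) + \<kappa> (Some j)) = mvar j"
    proof (cases j rule: chart_cases)
      case 1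
      have "\<kappa> (Some i\<^sub>0) = 0" by (simp add: \<kappa>_def)
      moreover have "mconst (1 / c) * mvar i\<^sub>0 * mconst c = (mconst (1 / c) * mconst c) * (mvar i\<^sub>0 :: ('n amb, 'a) mps)"
        by (simp only: mult_ac)
      ultimately show ?thesis using cc by (simp add: 1 p0) (simp add: \<kappa>_def)
    next
      case (3 i)
      have xc: "x = mconst c + mvar i\<^sub>0" by (simp add: x_def coord_def p0)
      have "mconst c * s i + mconst (1 / c) * mvar i\<^sub>0 * (mconst c * mconst (t i) + mconst c * s i)
        = mconst c * s i + (mconst (1 / c) * mconst c) * (mvar i\<^sub>0 * (mconst (t i) + s i))"
        by (simp add: algebra_simps)
      also have "\<dots> = (mconst c + mvar i\<^sub>0) * (mconst (t i) + s i) - mconst c * mconst (t i)"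
        unfolding cc by (simp add: algebra_simps)
      also have "\<dots> = (x * x') * coord p (Mid i) - mconst (p (Mid i))"
        unfolding xc[symmetric] by (simp add: s_def pMid mconst_mult mult_ac)
      also have "\<dots> = mvar (Mid i)" unfolding xx' by (simp add: coord_def)
      finally show ?thesis by (simp add: 3 \<kappa>_def pMid mconst_mult)
    qed (use j in simp)
    then show "msubst (mvar (Some j) + mvar None * (mconst (p j) + mvar (Some j))) \<kappa> = mvar j"
      by (simp add: \<kappa>0)
  qed
  finally have 1: "msubst (rescale p a) \<kappa> = a" by simp
  have 2: "msubst (mpowr None 1 d) \<kappa> = mpowr i\<^sub>0 c d"
    unfolding mpowr_eq_binom by (subst msubst_binom) (auto simp: \<kappa>0, simp add: \<kappa>_def)
  have 3: "msubst (mrename Some a) \<kappa> = msubst (msubst a slice) s"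
    by (simp add: msubst_mrename msubst_msubst \<kappa>0) (simp add: \<kappa>_def)
  have "a = msubst (mpowr None 1 d * mrename Some a) \<kappa>" using 1 h by simp
  then show ?thesis by (simp add: \<kappa>0 2 3)
qed

lemma slice_x': "msubst x' slice = mconst (1 / c)"
  unfolding x'_def mpowr_eq_binom by (simp add: msubst_binom)

lemma slice_s: "msubst (s i) slice = mvar i"
proof -
  have "mconst c * mconst (1 / c) = (1 :: ('n, 'a) mps)" using c by (simp flip: mconst_mult)
  moreover have "(mconst (c * t i) + mconst c * mvar i) * mconst (1 / c)
      = (mconst c * mconst (1 / c)) * (mconst (t i) + mvar i :: ('n, 'a) mps)"
    by (simp only: mconst_mult ring_distribs mult_ac)
  ultimately show ?thesis by (simp add: s_def slice_x' coord_def pMid)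
qed

lemma slice_pullback: "msubst (msubst a s) slice = a"
  by (simp add: msubst_msubst slice_s)

definition eqn :: "('n, 'a) mps \<Rightarrow> ('n amb, 'a) mps" where
  "eqn f = coord p i\<^sub>1 * x' - msubst f s"

definition graph :: "('n, 'a) mps \<Rightarrow> ('n amb, 'a) mps" where
  "graph f = x * msubst f s"

lemma eqn_graph: "eqn f = x' * (coord p i\<^sub>1 - graph f)"
proof -
  have "x' * (coord p i\<^sub>1 - graph f) = coord p i\<^sub>1 * x' - (x * x') * msubst f s"
    unfolding graph_def by (simp only: right_diff_distrib mult_ac)
  then show ?thesis by (simp add: eqn_def xx')
qed

text \<open>The equation is \<open>x'\<close> times the graph equation, so by \<delta>(u \<phi>) =
  u^(-1) \<delta>(\<phi>) the density acquires the factor \<open>x\<close>.\<close>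

lemma delta_eq_eqn: "delta_eq (eqn f, h) (coord p i\<^sub>1 - graph f, x * h)"
proof -
  have "h = x' * (x * h)" using x'_unit by (simp flip: mult.assoc)
  then show ?thesis unfolding eqn_graph using delta_eq_unit[of x' "coord p i\<^sub>1 - graph f" "x * h"] c by simp
qed

lemma indep_graph: "indep_of i\<^sub>1 (graph f)"
  using i i' by (simp add: indep_of_iff graph_def mderiv_pullback_i1 mderiv_x)

lemma conical_eqn: "conical p (eqn f)"
  unfolding conical_def
proof (rule exI[of _ 1])
  show "rescale p (eqn f) = 1 * mrename Some (eqn f)"
    unfolding eqn_def rescale_diff mrename_diff rescale_ratio rescale_pullback by simp
qed

lemma mderiv_eqn:
  "mderiv i\<^sub>1 (eqn f) = x'"
  "mderiv (Mid i) (eqn f) = - (msubst (mderiv i f) s * x')"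
  "mderiv i\<^sub>0 (eqn f) = - (coord p i\<^sub>1 * x' ^ 2) + (\<Sum>i\<in>UNIV. msubst (mderiv i f) s * coord p (Mid i)) * x' ^ 2"
  using i i' by (auto simp: eqn_def mderiv_coord mderiv_x' mderiv_pullback_i1 mderiv_pullback_Mid mderiv_pullback_i0)

lemma tangent_eqn:
  assumes p1: "p i\<^sub>1 = c * cterm f" and v: "v \<in> tangent_space (eqn f)"
  shows "v i\<^sub>1 = cterm f * v i\<^sub>0 + (\<Sum>i\<in>UNIV. cterm (mderiv i f) * (v (Mid i) - t i * v i\<^sub>0))"
proof -
  have "(- (c * cterm f * (1 / c) ^ 2) + (\<Sum>i\<in>UNIV. cterm (mderiv i f) * (c * t i)) * (1 / c) ^ 2) * v i\<^sub>0 + 1 / c * v i\<^sub>1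
      + (\<Sum>i\<in>UNIV. - (cterm (mderiv i f) * (1 / c)) * v (Mid i)) = 0"
    using v by (simp add: tangent_space_def sum_chart mderiv_eqn p1 pMid)
  then have "c * ((- (c * cterm f * (1 / c) ^ 2) + (\<Sum>i\<in>UNIV. cterm (mderiv i f) * (c * t i)) * (1 / c) ^ 2) * v i\<^sub>0 + 1 / c * v i\<^sub>1
      + (\<Sum>i\<in>UNIV. - (cterm (mderiv i f) * (1 / c)) * v (Mid i))) = 0" by simp
  then have "- (cterm f * v i\<^sub>0) + (\<Sum>i\<in>UNIV. cterm (mderiv i f) * t i * v i\<^sub>0) + v i\<^sub>1 - (\<Sum>i\<in>UNIV. cterm (mderiv i f) * v (Mid i)) = 0"
    using c by (simp add: ring_distribs sum_distrib_left sum_distrib_right sum_negf power2_eq_square mult_ac)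
  then show ?thesis by (simp add: algebra_simps sum_subtractf)
qed

text \<open>In affine coordinates the Gauss map of a graph is essentially the gradient map of
  \<open>f\<close>, whose differential is the Hessian.\<close>

lemma gauss_immersion_eqn:
  assumes p1: "p i\<^sub>1 = c * cterm f" and f: "cterm (det (hess (\<lambda>i. i) f)) \<noteq> 0"
  shows "gauss_immersion p (eqn f)"
  unfolding gauss_immersion_def
proof (intro ballI impI)
  fix v assume v: "v \<in> tangent_space (eqn f)"
    and "\<exists>l. \<forall>i. (\<Sum>j\<in>UNIV. cterm (mderiv j (mderiv i (eqn f))) * v j) = l * cterm (mderiv i (eqn f))"
  then obtain l where l: "\<And>i. (\<Sum>j\<in>UNIV. cterm (mderiv j (mderiv i (eqn f))) * v j) = l * cterm (mderiv i (eqn f))"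
    by blast
  \<comment> \<open>The row \<open>i\<^sub>1\<close> determines \<open>l\<close>; then the rows \<open>Mid i\<close> give the Hessian of \<open>f\<close> applied to the
    component of \<open>v\<close> transversal to the ray.\<close>
  have "- (1 / c)\<^sup>2 * v i\<^sub>0 = l * (1 / c)"
    using l[of i\<^sub>1] i i' by (simp add: sum_chart mderiv_eqn mderiv_x')
  then have l0: "l = - v i\<^sub>0 / c" using c by (simp add: power2_eq_square field_simps)
  define d where "d i = v (Mid i) - t i * v i\<^sub>0" for i
  have row: "(\<Sum>j\<in>UNIV. cterm (mderiv j (mderiv i f)) * d j) = 0" for i
  proof -
    let ?f = "cterm (mderiv i f)" and ?F = "\<lambda>j. cterm (mderiv j (mderiv i f))"
    have "((\<Sum>j\<in>UNIV. ?F j * (c * t j)) * (1 / c) ^ 2 * (1 / c) + ?f * (1 / c)\<^sup>2) * v i\<^sub>0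
        + (\<Sum>j\<in>UNIV. - (?F j * (1 / c) * (1 / c)) * v (Mid j)) = - v i\<^sub>0 / c * - (?f * (1 / c))"
      using l[of "Mid i"] i i' unfolding l0
      by (simp add: sum_chart mderiv_eqn mderiv_x' mderiv_pullback_i0 mderiv_pullback_i1 mderiv_pullback_Mid pMid)
    then have "c ^ 2 * (((\<Sum>j\<in>UNIV. ?F j * (c * t j)) * (1 / c) ^ 2 * (1 / c) + ?f * (1 / c)\<^sup>2) * v i\<^sub>0
        + (\<Sum>j\<in>UNIV. - (?F j * (1 / c) * (1 / c)) * v (Mid j))) = c ^ 2 * (- v i\<^sub>0 / c * - (?f * (1 / c)))"
      by (rule arg_cong)
    then have "(\<Sum>j\<in>UNIV. ?F j * t j * v i\<^sub>0) + ?f * v i\<^sub>0 - (\<Sum>j\<in>UNIV. ?F j * v (Mid j)) = ?f * v i\<^sub>0"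
      using c by (simp add: ring_distribs sum_distrib_left sum_distrib_right sum_negf power2_eq_square mult_ac)
    then show ?thesis by (simp add: d_def algebra_simps sum_subtractf)
  qed
  have "d i = 0" for i
  proof -
    let ?H = "\<chi> i j. cterm (hess (\<lambda>i. i) f $ i $ j)"
    have "invertible ?H" using f by (simp add: invertible_det_nz cterm_det)
    then obtain B where B: "B ** ?H = mat 1" unfolding invertible_def by blast
    have "?H *v (\<chi> i. d i) = 0"
      using row by (simp add: matrix_vector_mult_def vec_eq_iff hess_def mderiv_commute)
    then have "(\<chi> i. d i) = 0"
      using B by (metis matrix_vector_mul_assoc matrix_vector_mul_lid matrix_vector_mult_0_right)
    then show ?thesis by (simp add: vec_eq_iff)
  qed
  then have M: "v (Mid i) = t i * v i\<^sub>0" for i by (simp add: d_def)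
  have "v j = v i\<^sub>0 / c * p j" for j
  proof (cases j rule: chart_cases)
    case 2
    then show ?thesis using tangent_eqn[OF p1 v] c by (simp add: M p1)
  qed (use c in \<open>simp_all add: p0 pMid M\<close>)
  then show "\<exists>l. \<forall>j. v j = l * p j" by blast
qed

text \<open>On the hypersurface the right-hand side vanishes, whereas the left-hand side does not
  involve the coordinate \<open>i\<^sub>1\<close> and is unchanged by the restriction. This yields
  the condition that the density is nonzero.\<close>

lemma pullback_not_multiple:
  assumes p1: "p i\<^sub>1 = c * cterm f" and w: "msubst g s * (mconst K * mpowr i\<^sub>0 c d) = w * eqn f" and K: "K \<noteq> 0"
  shows "g = 0"
proof -
  define b where "b = mvar(i\<^sub>1 := graph f - mconst (p i\<^sub>1))"
  have b0: "cterm (b j) = 0" for j using p1 by (simp add: b_def graph_def)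
  have g1: "msubst (coord p i\<^sub>1) b = graph f"
    unfolding b_def by (rule coord_eq_graph_subst) (simp add: graph_def p1)
  have id: "msubst a b = a" if "mderiv i\<^sub>1 a = 0" for a
    using msubst_indep_cong[of i\<^sub>1 a b mvar] that by (simp add: b_def indep_of_iff)
  have z: "msubst (eqn f) b = 0"
    unfolding eqn_graph using indep_graph[of f] by (simp add: b0 g1 id indep_of_iff)
  have "mderiv i\<^sub>1 (msubst g s * (mconst K * mpowr i\<^sub>0 c d)) = 0"
    using i by (simp add: mderiv_pullback_i1 mderiv_mpowr_neq)
  then have "msubst g s * (mconst K * mpowr i\<^sub>0 c d) = msubst (w * eqn f) b" using id w by metis
  then have "(mconst K * mpowr i\<^sub>0 c d) * msubst g s = (mconst K * mpowr i\<^sub>0 c d) * 0"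
    by (simp add: b0 z mult_ac)
  then have "msubst g s = 0" by (rule unit_cancel[rotated]) (use K in simp)
  then show ?thesis using slice_pullback[of g] by simp
qed

end

section \<open>Conical densities and their Fourier transforms\<close>

lemma hdeg_eq: "hdeg TYPE('n::finite) = - of_nat (CARD('n) + 2) / 2"
  unfolding hdeg_def by (rule minus_divide_left)

lemma to_ac_hdeg [simp]: "to_ac (hdeg TYPE('n::finite)) = hdeg TYPE('n)"
  by (simp add: hdeg_def del: of_nat_add)

section \<open>The chart over the algebraic closure, and its densities\<close>

context cone_chart
begin

lemma chart_to_ac: "cone_chart i\<^sub>0 i\<^sub>1 (to_ac \<circ> p) (to_ac c) (to_ac \<circ> t)"
  using i c p0 pMid by unfold_locales auto

lemma x_to_ac [simp]: "mmap to_ac x = cone_chart.x i\<^sub>0 (to_ac \<circ> p)"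
  and x'_to_ac [simp]: "mmap to_ac x' = cone_chart.x' i\<^sub>0 (to_ac c)"
  and s_to_ac [simp]: "mmap to_ac (s j) = cone_chart.s i\<^sub>0 (to_ac \<circ> p) (to_ac c) (to_ac \<circ> t) j"
  and slice_to_ac [simp]: "mmap to_ac (slice k) = cone_chart.slice (to_ac c) k"
proof -
  interpret A: cone_chart i\<^sub>0 i\<^sub>1 "to_ac \<circ> p" "to_ac c" "to_ac \<circ> t" by (rule chart_to_ac)
  show "mmap to_ac x = A.x" "mmap to_ac x' = A.x'" "mmap to_ac (s j) = A.s j"
    by (simp_all add: x_def A.x_def x'_def A.x'_def s_def A.s_def)
  show "mmap to_ac (slice k) = A.slice k" by (cases k rule: chart_cases) auto
qed

lemma eqn_to_ac [simp]: "mmap to_ac (eqn f) = cone_chart.eqn i\<^sub>0 i\<^sub>1 (to_ac \<circ> p) (to_ac c) (to_ac \<circ> t) (mmap to_ac f)"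
  and graph_to_ac [simp]: "mmap to_ac (graph f) = cone_chart.graph i\<^sub>0 (to_ac \<circ> p) (to_ac c) (to_ac \<circ> t) (mmap to_ac f)"
proof -
  interpret A: cone_chart i\<^sub>0 i\<^sub>1 "to_ac \<circ> p" "to_ac c" "to_ac \<circ> t" by (rule chart_to_ac)
  show "mmap to_ac (eqn f) = A.eqn (mmap to_ac f)" "mmap to_ac (graph f) = A.graph (mmap to_ac f)"
    by (simp_all add: eqn_def A.eqn_def graph_def A.graph_def)
qed

lemma cone_distr_eq:
  assumes "p i\<^sub>1 = c * cterm f"
  shows "cone_distr i\<^sub>0 i\<^sub>1 r c t f g = (p, eqn f, msubst g (\<lambda>i. mmap to_ac (s i)) *
    (mconst (inverse (r c ^ (CARD('n) + 2))) * mpowr i\<^sub>0 (to_ac c) (hdeg TYPE('n))))"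
proof -
  have p: "(\<lambda>j. case j of Mid i \<Rightarrow> c * t i | _ \<Rightarrow> if j = i\<^sub>0 then c else c * cterm f) = p"
  proof
    fix j
    show "(case j of Mid i \<Rightarrow> c * t i | _ \<Rightarrow> if j = i\<^sub>0 then c else c * cterm f) = p j"
      using i' i p0 pMid assms by (cases j rule: chart_cases) (auto split: amb.split)
  qed
  show ?thesis unfolding cone_distr_def Let_def p x'_def[symmetric] s_def[symmetric] eqn_def
    by (simp add: s_def[abs_def] cong: if_cong)
qed

text \<open>Solving the equation for the coordinate \<open>i\<^sub>1\<close> costs one factor
  \<open>x\<close>, and 1 - (n + 2)/2 = -n/2. The constant \<open>c\<close> is the value of
  \<open>x\<close> at the base point.\<close>

lemma x_mult_mpowr: "x * mpowr i\<^sub>0 c (hdeg TYPE('n)) = mconst c * mpowr i\<^sub>0 c (- of_nat CARD('n) / 2)"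
proof -
  let ?y = "mconst (1 / c) * mvar i\<^sub>0 :: ('n amb, 'a) mps"
  have "mconst c * mconst (1 / c) = (1 :: ('n amb, 'a) mps)" using c by (simp flip: mconst_mult)
  then have x: "x = mconst c * binom 1 ?y"
    by (simp add: x_def coord_def p0 ring_distribs flip: mult.assoc)
  have "1 + hdeg TYPE('n) = (- of_nat CARD('n) / 2 :: 'a)" by (simp add: hdeg_def add_divide_distrib)
  then show ?thesis unfolding x mpowr_eq_binom mult.assoc
    by (simp flip: binom_add del: binom_1)
qed

lemma pullback_inject: "msubst a s = msubst b s \<Longrightarrow> a = b"
  by (metis slice_pullback)

text \<open>The constant \<open>b\<close> is 1 for the densities themselves and a square root of a
  constant for their transforms. It is moved into the constant prefactor, so that what remains of
  the density is a germ over the ground field.\<close>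

lemma cone_density_cone_distr:
  fixes S :: "'a setting"
  assumes S: "valid_setting S" and p1: "p i\<^sub>1 = c * cterm f" and r: "r c \<noteq> 0" and b: "b \<noteq> 0"
    and f: "germ S f" "cterm (det (hess (\<lambda>i. i) f)) \<noteq> 0" and g: "germ S g" "g \<noteq> 0"
  shows "cone_density S i\<^sub>0 i\<^sub>1 (b * inverse (r c ^ (CARD('n) + 2))) (cone_distr i\<^sub>0 i\<^sub>1 r c t f (mconst b * mmap to_ac g))"
proof -
  interpret A: cone_chart i\<^sub>0 i\<^sub>1 "to_ac \<circ> p" "to_ac c" "to_ac \<circ> t" by (rule chart_to_ac)
  let ?K = "b * inverse (r c ^ (CARD('n) + 2))"
  define h where "h = msubst (mconst b * mmap to_ac g) A.s * (mconst (inverse (r c ^ (CARD('n) + 2))) * mpowr i\<^sub>0 (to_ac c) (hdeg TYPE('n)))"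
  have h: "h = msubst (mmap to_ac g) A.s * (mconst ?K * mpowr i\<^sub>0 (to_ac c) (hdeg TYPE('n)))"
    by (simp add: h_def mconst_mult mult_ac)
  have G: "cone_distr i\<^sub>0 i\<^sub>1 r c t f (mconst b * mmap to_ac g) = (p, eqn f, h)"
    unfolding cone_distr_eq[OF p1] h_def by simp
  have K: "?K \<noteq> 0" using b r by simp
  have gx': "germ S x'" unfolding x'_def by (intro germ_mult germ_mpowr) (auto simp: S)
  have gs: "germ S (s j)" for j unfolding s_def by (intro germ_diff germ_mult gx') (auto simp: S)
  have 1: "p \<noteq> (\<lambda>_. 0)" using c p0 by auto
  have 2: "germ S (eqn f)" unfolding eqn_def by (intro germ_diff germ_mult germ_msubst gx' gs f) (auto simp: S)
  have 3: "smooth_hypersurface (eqn f)"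
  proof -
    have "cterm (eqn f) = 0" using c p1 by (simp add: eqn_def)
    moreover have "cterm (mderiv i\<^sub>1 (eqn f)) \<noteq> 0" using c by (simp add: mderiv_eqn)
    ultimately show ?thesis unfolding smooth_hypersurface_def by blast
  qed
  have 4: "(\<lambda>_. 0)(i\<^sub>1 := 1) \<notin> tangent_space (eqn f)"
    using tangent_eqn[OF p1, of "(\<lambda>_. 0)(i\<^sub>1 := 1)"] i i' by auto
  have 5: "\<exists>h\<^sub>0. germ S h\<^sub>0 \<and> h = mconst ?K * mmap to_ac h\<^sub>0"
  proof (intro exI conjI)
    show "germ S (msubst g s * mpowr i\<^sub>0 c (hdeg TYPE('n)))"
      by (intro germ_mult germ_msubst germ_mpowr gs g) (auto simp: S)
    show "h = mconst ?K * mmap to_ac (msubst g s * mpowr i\<^sub>0 c (hdeg TYPE('n)))"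
      unfolding h by (simp add: mult_ac)
  qed
  have 6: "\<not> (\<exists>w. h = w * mmap to_ac (eqn f))"
  proof
    assume "\<exists>w. h = w * mmap to_ac (eqn f)"
    then obtain w where "h = w * A.eqn (mmap to_ac f)" by auto
    then have "mmap to_ac g = 0"
      unfolding h by (rule A.pullback_not_multiple[rotated]) (use K p1 in auto)
    then have "mmap to_ac g = mmap to_ac 0" by simp
    then show False using g(2) by (simp only: mmap_to_ac_eq_iff)
  qed
  have "rescale (to_ac \<circ> p) h = mpowr None 1 (hdeg TYPE('n)) * mrename Some h"
    unfolding h hdeg_eq rescale_mult mrename_mult A.rescale_pullback A.rescale_mpowr by (simp add: mult_ac)
  moreover have "rescale (to_ac \<circ> p) (A.eqn F) = mrename Some (A.eqn F)" for F
    unfolding A.eqn_def rescale_diff mrename_diff A.rescale_ratio A.rescale_pullback by simp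
  ultimately have 7: "homogeneous (hdeg TYPE('n)) (to_ac \<circ> p) (mmap to_ac (eqn f)) h"
    by (simp add: homogeneous_def delta_eq_refl)
  show ?thesis unfolding G cone_density_def prod.case
    using 1 2 3 4 5 6 7 conical_eqn[of f] gauss_immersion_eqn[OF p1 f(2)] c p0 by blast
qed

end

section \<open>The Fourier transform of a graph density\<close>

lemma cone_chart_point:
  fixes c :: "'a::field_char_0" and t :: "'n::finite \<Rightarrow> 'a"
  assumes "i\<^sub>0 \<noteq> i\<^sub>1" "\<And>i. i\<^sub>0 \<noteq> Mid i" "\<And>i. i\<^sub>1 \<noteq> Mid i" "c \<noteq> 0"
  obtains p where "cone_chart i\<^sub>0 i\<^sub>1 p c t" "p i\<^sub>1 = c * a"
proof -
  let ?p = "\<lambda>j. case j of Mid i \<Rightarrow> c * t i | _ \<Rightarrow> if j = i\<^sub>0 then c else c * a"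
  have "cone_chart i\<^sub>0 i\<^sub>1 ?p c t"
    using assms by unfold_locales (auto split: amb.split)
  moreover have "?p i\<^sub>1 = c * a" using assms by (auto split: amb.split)
  ultimately show ?thesis by (rule that)
qed

text \<open>By \<open>phase_pullback\<close> everything reduces to the integral of the pair at the
  affine point. The square roots \<open>\<rho>\<close> and \<open>\<kappa>\<close> enter only
  through the equations for their squares, so they can later be chosen to match the fixed
  branches.\<close>

lemma formal_integral_graph:
  fixes p q :: "'n::finite amb \<Rightarrow> 'a::field_char_0"
  assumes P: "cone_chart First Last p c t" and Q: "cone_chart Last First q d t'"
    and f: "cterm (det (hess (\<lambda>i. i) f)) \<noteq> 0"
    and A: "\<And>k. k \<ge> 1 \<Longrightarrow> stat_coeff (\<lambda>i. i) f g k = 0"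
    and t': "\<And>i. t' i = - cterm (mderiv i f)"
    and \<tau>: "\<And>i. cterm (\<tau> i) = 0" "\<And>i. msubst (mderiv i f) \<tau> = - (mconst (t' i) + mvar i)"
    and f': "f' = msubst f \<tau> + (\<Sum>i\<in>UNIV. (mconst (t i) + \<tau> i) * (mconst (t' i) + mvar i))"
    and \<rho>: "\<rho>\<^sup>2 * det (- hess (\<lambda>i. i) f) = 1"
    and \<kappa>: "\<kappa>\<^sup>2 * (d / c) ^ CARD('n) = 1"
    and z: "z = p(Last := q Last)" and z': "z' = q(First := p First)"
  shows "is_formal_integral Mid z (cone_chart.graph First p c t f * coord z Last)
      (mconst K * mpowr First c (- of_nat CARD('n) / 2) * msubst g (cone_chart.s First p c t))
      (Wave z' (int CARD('n)) (- (coord z' First * cone_chart.graph Last q d t' (- f')))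
        (fps_const (mconst (\<kappa> * K) * mpowr Last d (- of_nat CARD('n) / 2) * msubst (msubst (\<rho> * g) \<tau>) (cone_chart.s Last q d t'))))"
proof -
  interpret P: cone_chart First Last p c t by fact
  interpret Q: cone_chart Last First q d t' by fact
  let ?n = "CARD('n)"
  define Y where "Y = coord z Last"
  have Y: "Y = Q.x" by (simp add: Y_def Q.x_def coord_def z)
  have zx: "coord z' First = P.x" by (simp add: P.x_def coord_def z')
  have zM: "coord z' (Mid i) = Q.x * (mconst (t' i) + Q.s i)" for i
  proof -
    have "Q.x * (mconst (t' i) + Q.s i) = (Q.x * Q.x') * coord q (Mid i)" by (simp add: Q.s_def mult_ac)
    then show ?thesis using Q.xx' by (simp add: coord_def z')
  qed
  define w :: "('n amb, 'a) mps" where "w = mconst K * mpowr First c (- of_nat ?n / 2)"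
  interpret pp: phase_pullback Mid P.x P.x' Y Q.x' w P.s
    by (rule P.phase_pullback_Mid) (auto simp: Y Q.xx' Q.mderiv_x w_def mderiv_mpowr_neq)
  \<comment> \<open>the critical point \<open>x\<^sub>i = x\<^sub>0 (t\<^sub>i + \<tau>\<^sub>i(y / y\<^bsub>n+1\<^esub>))\<close>\<close>
  define T where "T j = (case j of Mid i \<Rightarrow> P.x * (mconst (t i) + msubst (\<tau> i) Q.s) - mconst (p (Mid i)) | _ \<Rightarrow> mvar j)" for j
  have T0: "cterm (T j) = 0" for j
    using P.pMid by (cases j) (auto simp: T_def \<tau>)
  have T_simps: "T First = mvar First" "T Last = mvar Last"
    "T (Mid i) = P.x * (mconst (t i) + msubst (\<tau> i) Q.s) - mconst (p (Mid i))" for i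
    by (simp_all add: T_def)
  have Tx: "msubst P.x T = P.x" "msubst Y T = Y"
    by (simp_all add: P.x_def Y_def coord_def T0 T_simps)
  have Tm: "msubst (mpowr First e a) T = mpowr First e a" "msubst (mpowr Last e a) T = mpowr Last e a" for a e
    unfolding mpowr_eq_binom by (simp_all add: msubst_binom T0 T_simps)
  have Ts: "msubst (P.s i) T = msubst (\<tau> i) Q.s" for i
  proof -
    have "msubst P.x' T = P.x'" by (simp add: P.x'_def T0 Tm)
    then have "msubst (P.s i) T = (P.x * P.x') * (mconst (t i) + msubst (\<tau> i) Q.s) - mconst (t i)"
      by (simp add: P.s_def coord_def T0 T_simps mult_ac)
    then show ?thesis using P.xx' by simp
  qed
  have TS: "msubst (msubst a P.s) T = msubst (msubst a \<tau>) Q.s" for a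
    by (simp add: msubst_msubst T0 Ts \<tau>)
  let ?F = "P.graph f * Y"
  have F: "?F = P.x * Y * msubst f P.s" by (simp add: P.graph_def mult_ac)
  have dF: "mderiv (Mid i) ?F = Y * msubst (mderiv i f) P.s" for i unfolding F by (rule pp.mderiv_phase)
  have det: "det (- hess Mid ?F) = (Y * P.x') ^ ?n * msubst (det (- hess (\<lambda>i. i) f)) P.s"
    unfolding F by (rule pp.det_hess_phase)
  \<comment> \<open>The determinant of the phase has the additional factor
    \<open>(Y * P.x') ^ n\<close>. The two \<open>mpowr\<close> factors are the inverse square root
    of its series part, and \<open>\<kappa>\<close> is that of its constant part
    \<open>(d / c) ^ n\<close>.\<close>
  define \<rho>' where "\<rho>' = mconst \<kappa> * (mpowr Last d (- of_nat ?n / 2) * mpowr First c (of_nat ?n / 2)) * msubst \<rho> P.s"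
  have \<rho>': "\<rho>'\<^sup>2 * det (- hess Mid ?F) = 1"
  proof -
    let ?u = "mconst (1 / d) * mvar Last :: ('n amb, 'a) mps" and ?v = "mconst (1 / c) * mvar First :: ('n amb, 'a) mps"
    have "mconst d * mconst (1 / d) = (1 :: ('n amb, 'a) mps)" using Q.c by (simp flip: mconst_mult)
    then have "Q.x = mconst d * (1 + ?u)" by (simp add: Q.x_def coord_def Q.p0 ring_distribs flip: mult.assoc)
    moreover have "P.x' = mconst (1 / c) * binom (- 1) ?v" by (simp add: P.x'_def mpowr_eq_binom)
    ultimately have yx: "(Y * P.x') ^ ?n = mconst ((d / c) ^ ?n) * (binom (of_nat ?n) ?u * binom (- 1) ?v ^ ?n)"
      by (simp add: Y power_mult_distrib binom_of_nat divide_inverse mconst_power mconst_mult mult_ac)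
    have b: "binom (- of_nat ?n / 2) ?u ^ 2 * binom (of_nat ?n) ?u = 1"
      using binom_minus[of ?u "of_nat ?n"] by (simp add: binom_double)
    have "(binom (- 1) ?v * binom 1 ?v) ^ ?n = 1" using binom_minus[of ?v 1] by simp
    then have b': "binom (of_nat ?n / 2) ?v ^ 2 * binom (- 1) ?v ^ ?n = 1"
      by (simp add: binom_double binom_of_nat power_mult_distrib mult.commute)
    have r: "msubst \<rho> P.s ^ 2 * msubst (det (- hess (\<lambda>i. i) f)) P.s = 1"
      using arg_cong[OF \<rho>, of "\<lambda>a. msubst a P.s"] by simp
    have k: "mconst \<kappa> ^ 2 * mconst ((d / c) ^ ?n) = (1 :: ('n amb, 'a) mps)"
      using \<kappa> by (simp flip: mconst_power mconst_mult)
    have "\<rho>'\<^sup>2 * det (- hess Mid ?F) = (mconst \<kappa> ^ 2 * mconst ((d / c) ^ ?n))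
        * (binom (- of_nat ?n / 2) ?u ^ 2 * binom (of_nat ?n) ?u)
        * (binom (of_nat ?n / 2) ?v ^ 2 * binom (- 1) ?v ^ ?n)
        * (msubst \<rho> P.s ^ 2 * msubst (det (- hess (\<lambda>i. i) f)) P.s)"
      unfolding det yx unfolding \<rho>'_def mpowr_eq_binom power_mult_distrib by (simp only: mult_ac)
    then show ?thesis unfolding k b b' r by simp
  qed
  have cdet: "cterm (det (hess Mid ?F)) \<noteq> 0"
  proof -
    have "(1 :: 'a) = cterm (\<rho>'\<^sup>2) * cterm (det (- hess Mid ?F))" using \<rho>' by (metis cterm_1 cterm_mult)
    then have "cterm (det (- hess Mid ?F)) \<noteq> 0" by auto
    moreover have "- hess Mid ?F = (\<chi> i j. (- 1) * hess Mid ?F $ i $ j)" by (simp add: vec_eq_iff)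
    then have "det (- hess Mid ?F) = (- 1) ^ ?n * det (hess Mid ?F)" by (simp only: det_scale)
    ultimately show ?thesis by auto
  qed
  have Acoeff: "stat_coeff Mid ?F (w * msubst g P.s) k = w * (P.x' * Q.x') ^ k * msubst (stat_coeff (\<lambda>i. i) f g k) P.s" for k
    unfolding F by (rule pp.stat_coeff_pullback[OF f])
  \<comment> \<open>The dual cone is the graph belonging to \<open>- f'\<close>, so the left-hand
    side is x_0 y_{n+1} f', the critical value of the phase.\<close>
  have phase: "- (P.x * Q.graph (- f')) = msubst ?F T + (\<Sum>i\<in>UNIV. (mconst (z (Mid i)) + T (Mid i)) * coord z' (Mid i))"
  proof -
    have "(mconst (z (Mid i)) + T (Mid i)) * coord z' (Mid i)
        = P.x * Q.x * msubst ((mconst (t i) + \<tau> i) * (mconst (t' i) + mvar i)) Q.s" for i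
      by (simp add: zM T_simps z mult_ac)
    moreover have "msubst ?F T = P.x * Q.x * msubst (msubst f \<tau>) Q.s"
      unfolding F by (simp add: T0 Tx TS) (simp add: Y)
    ultimately have "msubst ?F T + (\<Sum>i\<in>UNIV. (mconst (z (Mid i)) + T (Mid i)) * coord z' (Mid i)) = P.x * Q.x * msubst f' Q.s"
      unfolding f' msubst_add msubst_sum by (simp only: distrib_left sum_distrib_left)
    then show ?thesis by (simp add: Q.graph_def mult_ac)
  qed
  have amp: "fps_const (mconst (\<kappa> * K) * mpowr Last d (- of_nat ?n / 2) * msubst (msubst (\<rho> * g) \<tau>) Q.s)
      = Abs_fps (\<lambda>k. msubst (\<rho>' * stat_coeff Mid ?F (w * msubst g P.s) k) T)"
  proof (rule fps_ext)
    fix k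
    show "fps_nth (fps_const (mconst (\<kappa> * K) * mpowr Last d (- of_nat ?n / 2) * msubst (msubst (\<rho> * g) \<tau>) Q.s)) k
      = fps_nth (Abs_fps (\<lambda>k. msubst (\<rho>' * stat_coeff Mid ?F (w * msubst g P.s) k) T)) k"
    proof (cases "k = 0")
      case True
      have v: "mpowr First c (of_nat ?n / 2) * mpowr First c (- of_nat ?n / 2) = (1 :: ('n amb, 'a) mps)"
        unfolding mpowr_eq_binom by (simp flip: binom_add)
      have "stat_coeff Mid ?F (w * msubst g P.s) 0 = w * msubst g P.s"
        by (rule stat_coeff_0) (auto simp: inj_def)
      then have "\<rho>' * stat_coeff Mid ?F (w * msubst g P.s) 0
        = (mpowr First c (of_nat ?n / 2) * mpowr First c (- of_nat ?n / 2)) * (mconst (\<kappa> * K) * mpowr Last d (- of_nat ?n / 2) * msubst (\<rho> * g) P.s)"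
        by (simp add: \<rho>'_def w_def mconst_mult mult_ac)
      also have "\<dots> = mconst (\<kappa> * K) * mpowr Last d (- of_nat ?n / 2) * msubst (\<rho> * g) P.s" unfolding v by simp
      finally have "msubst (\<rho>' * stat_coeff Mid ?F (w * msubst g P.s) 0) T
        = mconst (\<kappa> * K) * mpowr Last d (- of_nat ?n / 2) * msubst (msubst (\<rho> * g) \<tau>) Q.s"
        by (simp only: msubst_mult[OF T0] msubst_mconst Tm TS)
      then show ?thesis using True by simp
    next
      case False
      then show ?thesis by (simp add: Acoeff A)
    qed
  qed
  have "is_formal_integral Mid z ?F (w * msubst g P.s)
      (Wave z' (int ?n) (- (P.x * Q.graph (- f'))) (fps_const (mconst (\<kappa> * K) * mpowr Last d (- of_nat ?n / 2) * msubst (msubst (\<rho> * g) \<tau>) Q.s)))"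
    unfolding is_formal_integral_def wave.sel
  proof (intro conjI exI[of _ T] exI[of _ \<rho>'] allI impI)
    show "z' (Mid i) = - cterm (mderiv (Mid i) ?F)" for i
      unfolding dF using Q.pMid Q.p0 by (simp add: z' z Y t')
    show "z' j = z j" if "j \<notin> range Mid" for j using that by (cases j) (auto simp: z z')
    show "T j = mvar j" if "j \<notin> range Mid" for j using that by (cases j) (auto simp: T_def)
    show "coord z' (Mid i) = - msubst (mderiv (Mid i) ?F) T" for i
      unfolding dF zM by (simp add: T0 Tx TS \<tau>) (simp add: Y algebra_simps)
  qed (use cdet \<rho>' phase amp T0 in simp_all)
  then show ?thesis by (simp only: zx w_def Y_def)
qed

section \<open>The gradient map and the Legendre transform\<close>

lemma uminus_matrix: "- A = (\<chi> i j. - 1 * A $ i $ j)" for A :: "'r::comm_ring_1 ^ 'n ^ 'm"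
  by (simp add: vec_eq_iff)

lemma cterm_det_uminus: "cterm (det (- A)) = (- 1) ^ CARD('n) * cterm (det A)"
  for A :: "('v::finite, 'a::field_char_0) mps ^ 'n ^ 'n"
  unfolding uminus_matrix[of A] det_scale by simp

lemma det_jacobian_gradient:
  fixes f :: "('n::finite, 'a::field_char_0) mps"
  shows "det (jacobian_at_0 (\<lambda>i. - mderiv i f - mconst (t' i))) = cterm (det (- hess (\<lambda>i. i) f))"
  unfolding cterm_det jacobian_at_0_def hess_def
  by (rule arg_cong[of _ _ det]) (simp add: vec_eq_iff mderiv_commute)

text \<open>\<open>F\<close> is the map y = -df in local coordinates, and the Hessian is its
  Jacobian up to sign. Since the inverse is two-sided, any solution \<open>\<sigma>\<close> of the
  critical point equation equals it. The last clause therefore applies to the solution supplied by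
  an arbitrary formal integral.\<close>

lemma gradient_inverse:
  fixes f :: "('n::finite, 'a::field_char_0) mps"
  assumes f: "cterm (det (hess (\<lambda>i. i) f)) \<noteq> 0" and t': "\<And>i. t' i = - cterm (mderiv i f)"
  obtains \<tau> where "\<And>i. cterm (\<tau> i) = 0" "\<And>i. msubst (mderiv i f) \<tau> = - (mconst (t' i) + mvar i)"
    "\<And>S i. valid_setting S \<Longrightarrow> germ S f \<Longrightarrow> germ S (\<tau> i)" "det (jacobian_at_0 \<tau>) \<noteq> 0"
    "\<And>\<sigma> a. (\<And>i. cterm (\<sigma> i) = 0) \<Longrightarrow> (\<And>i. msubst (mderiv i f) \<sigma> = - (mconst (t' i) + mvar i)) \<Longrightarrow>
       msubst a \<sigma> = 0 \<Longrightarrow> a = 0"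
proof -
  define F where "F i = - mderiv i f - mconst (t' i)" for i
  have F0: "cterm (F i) = 0" for i by (simp add: F_def t')
  have "det (jacobian_at_0 F) \<noteq> 0"
    using f det_jacobian_gradient[of f t'] cterm_det_uminus[of "hess (\<lambda>i. i) f"] by (simp add: F_def[abs_def])
  then obtain T where T: "\<And>i. cterm (T i) = 0" "\<And>i. msubst (F i) T = mvar i" "\<And>i. msubst (T i) F = mvar i"
    "\<And>S i. valid_setting S \<Longrightarrow> (\<And>i. germ S (F i)) \<Longrightarrow> germ S (T i)"
    "jacobian_at_0 F ** jacobian_at_0 T = mat 1"
    using inverse_function[of F, OF F0] by metis
  have F_iff: "msubst (mderiv i f) \<sigma> = - (mconst (t' i) + mvar i) \<longleftrightarrow> msubst (F i) \<sigma> = mvar i" for \<sigma> :: "'n \<Rightarrow> ('n, 'a) mps" and i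
  proof
    assume "msubst (F i) \<sigma> = mvar i"
    then have "mvar i = - msubst (mderiv i f) \<sigma> - mconst (t' i)" by (simp add: F_def)
    then show "msubst (mderiv i f) \<sigma> = - (mconst (t' i) + mvar i)" by simp
  qed (simp add: F_def)
  show ?thesis
  proof (rule that[of T, OF T(1)])
    show "msubst (mderiv i f) T = - (mconst (t' i) + mvar i)" for i
      unfolding F_iff by (rule T)
    show "germ S (T i)" if "valid_setting S" "germ S f" for S i
      using that T(4)[of S] by (simp add: F_def germ_diff germ_uminus germ_mderiv)
    have "det (jacobian_at_0 F) * det (jacobian_at_0 T) = 1" using T(5) by (metis det_I det_mul)
    then show "det (jacobian_at_0 T) \<noteq> 0" by auto
  next
    fix \<sigma> a assume \<sigma>: "\<And>i. cterm (\<sigma> i) = 0" "\<And>i. msubst (mderiv i f) \<sigma> = - (mconst (t' i) + mvar i)" and a: "msubst a \<sigma> = 0"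
    have "T i = \<sigma> i" for i
    proof -
      have "\<sigma> i = msubst (msubst (T i) F) \<sigma>" by (simp add: T(3) \<sigma>(1))
      also have "\<dots> = msubst (T i) (\<lambda>k. msubst (F k) \<sigma>)" by (rule msubst_msubst) (auto simp: F0 \<sigma>(1))
      also have "\<dots> = T i" using \<sigma>(2) unfolding F_iff by simp
      finally show ?thesis ..
    qed
    then have "T = \<sigma>" by blast
    have "a = msubst a (\<lambda>i. msubst (T i) F)" by (simp add: T(3))
    also have "\<dots> = msubst (msubst a T) F" by (rule msubst_msubst[symmetric]) (auto simp: F0 T(1))
    finally show "a = 0" using a \<open>T = \<sigma>\<close> by simp
  qed
qed

text \<open>The envelope theorem: the terms with derivatives of \<open>\<tau>\<close> cancel because \<open>\<tau>\<close> is critical.\<close>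
lemma mderiv_legendre:
  fixes f :: "('n::finite, 'a::field_char_0) mps"
  assumes \<tau>: "\<And>i. cterm (\<tau> i) = 0" "\<And>i. msubst (mderiv i f) \<tau> = - (mconst (t' i) + mvar i)"
  shows "mderiv j (msubst f \<tau> + (\<Sum>i\<in>UNIV. (mconst (t i) + \<tau> i) * (mconst (t' i) + mvar i))) = mconst (t j) + \<tau> j"
proof -
  have "mderiv j (msubst f \<tau>) = - (\<Sum>i\<in>UNIV. (mconst (t' i) + mvar i) * mderiv j (\<tau> i))"
    unfolding mderiv_msubst[of \<tau>, OF \<tau>(1)] \<tau>(2) mult_minus_left sum_negf ..
  moreover have "mderiv j (\<Sum>i\<in>UNIV. (mconst (t i) + \<tau> i) * (mconst (t' i) + mvar i))
      = (\<Sum>i\<in>UNIV. (mconst (t' i) + mvar i) * mderiv j (\<tau> i)) + (\<Sum>i\<in>UNIV. if i = j then mconst (t i) + \<tau> i else 0)"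
    unfolding mderiv_sum sum.distrib[symmetric] by (rule sum.cong) (auto simp: mderiv_mvar mult.commute)
  ultimately show ?thesis by simp
qed

lemma det_neg_hess_mmap_to_ac: "det (- hess e (mmap to_ac f)) = mmap to_ac (det (- hess e f))"
proof -
  have "- hess e (mmap to_ac f) = (\<chi> i j. mmap to_ac ((- hess e f) $ i $ j))"
    by (simp add: hess_mmap_to_ac vec_eq_iff)
  then show ?thesis by (simp only: ring_map.det_map[OF ring_map_mmap_to_ac])
qed

lemma sqrt_branch_nonzero: "sqrt_branch r \<Longrightarrow> c \<noteq> 0 \<Longrightarrow> r c \<noteq> 0"
  by (metis sqrt_branch_def to_ac_eq_0_iff zero_power2)

lemma sqrt_branch_power:
  assumes "sqrt_branch r" "c \<noteq> 0"
  shows "to_ac c * inverse (r c ^ (n + 2)) = inverse (r c ^ n)"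
proof -
  have "to_ac c = r c ^ 2" using assms by (simp add: sqrt_branch_def)
  then show ?thesis using sqrt_branch_nonzero[OF assms] by (simp add: power_add power2_eq_square field_simps)
qed

text \<open>The data \<open>t'\<close>, \<open>f'\<close>, \<open>g'\<close>, \<open>b\<close> are
  chosen before \<open>d\<close>, so they describe the transform along the whole dual ray. The last
  clause allows any representative \<open>(\<phi>, h)\<close> of the distribution, so that it covers
  all members of the set and not only those given by \<open>cone_distr\<close>.\<close>

lemma fourier_transform_exists:
  fixes S :: "'k::field_char_0 setting" and p :: "'n::finite amb \<Rightarrow> 'k"
  assumes S: "valid_setting S" and rx: "sqrt_branch rx" and ry: "sqrt_branch ry"
    and P: "cone_chart First Last p c t" "p Last = c * cterm f"
    and f: "germ S f" "cterm (det (hess (\<lambda>i. i) f)) \<noteq> 0" and g: "germ S g" "g \<noteq> 0"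
    and A: "\<And>k. k \<ge> 1 \<Longrightarrow> stat_coeff (\<lambda>i. i) f g k = 0"
  obtains t' f' g' b where "germ S f'" "germ S g'" "b ^ 2 \<in> range to_ac"
    "\<And>d. d \<noteq> 0 \<Longrightarrow> cone_density S Last First (b * inverse (ry d ^ (CARD('n) + 2)))
       (cone_distr Last First ry d t' (- f') (mconst b * mmap to_ac g') :: ('n, 'k) distr)"
    "\<And>d \<phi> h \<phi>' h'. d \<noteq> 0 \<Longrightarrow> cone_distr First Last rx c t f (mmap to_ac g) = (p, \<phi>', h') \<Longrightarrow>
       delta_eq (mmap to_ac \<phi>, h) (mmap to_ac \<phi>', h') \<Longrightarrow>
       fourier_related (p, \<phi>, h) (cone_distr Last First ry d t' (- f') (mconst b * mmap to_ac g'))"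
proof -
  interpret P: cone_chart First Last p c t by fact
  interpret A: cone_chart First Last "to_ac \<circ> p" "to_ac c" "to_ac \<circ> t" by (rule P.chart_to_ac)
  let ?n = "CARD('n)"
  define t' where "t' i = - cterm (mderiv i f)" for i
  obtain \<tau> where \<tau>: "\<And>i. cterm (\<tau> i) = 0" "\<And>i. msubst (mderiv i f) \<tau> = - (mconst (t' i) + mvar i)"
    "\<And>i. germ S (\<tau> i)" "det (jacobian_at_0 \<tau>) \<noteq> 0"
    and inj: "\<And>a. msubst a \<tau> = 0 \<Longrightarrow> a = 0"
    using gradient_inverse[OF f(2), of t'] S f(1) unfolding t'_def by metis
  define f' where "f' = msubst f \<tau> + (\<Sum>i\<in>UNIV. (mconst (t i) + \<tau> i) * (mconst (t' i) + mvar i))"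
  have df': "mderiv j f' = mconst (t j) + \<tau> j" for j
    unfolding f'_def by (rule mderiv_legendre) (rule \<tau>)+
  define D where "D = det (- hess (\<lambda>i. i) f)"
  \<comment> \<open>Since \<open>D\<close> is its constant term times 1 + v, the factor
    \<open>q\<close> of det(-H)^(-1/2) is defined over the ground field. Only the constant
    \<open>b\<close> below requires the closure.\<close>
  define v where "v = mconst (1 / cterm D) * D - 1"
  define q where "q = binom (- 1 / 2) v"
  have D0: "cterm D \<noteq> 0" using f(2) by (simp add: D_def cterm_det_uminus)
  then have v0: "cterm v = 0" by (simp add: v_def)
  have qD: "q\<^sup>2 * (mconst (1 / cterm D) * D) = 1"
    using binom_minus_of_nat[OF v0, of 1] v0 by (simp add: q_def binom_double) (simp add: v_def)
  have gD: "germ S D"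
    unfolding D_def det_def hess_def using S f(1)
    by (intro germ_sum germ_mult germ_prod) (auto simp: sign_def germ_uminus germ_mderiv)
  have gq: "germ S q" unfolding q_def v_def
    using v0 by (intro germ_binom germ_diff germ_mult gD) (auto simp: S v_def)
  obtain b :: "'k alg_closure" where b: "b ^ 2 = to_ac (1 / cterm D)"
    using nth_root_exists[of 2 "to_ac (1 / cterm D)"] by auto
  have b0: "b \<noteq> 0" using b D0 by auto
  define g' where "g' = msubst (q * g) \<tau>"
  define \<rho> where "\<rho> = mconst b * mmap to_ac q"
  have \<rho>: "\<rho>\<^sup>2 * det (- hess (\<lambda>i. i) (mmap to_ac f)) = 1"
  proof -
    have "\<rho>\<^sup>2 * det (- hess (\<lambda>i. i) (mmap to_ac f)) = mconst (b ^ 2) * (mmap to_ac (q\<^sup>2) * mmap to_ac D)"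
      by (simp add: \<rho>_def D_def det_neg_hess_mmap_to_ac power_mult_distrib mconst_power mult_ac)
    also have "\<dots> = mmap to_ac (q\<^sup>2 * (mconst (1 / cterm D) * D))" unfolding b by (simp add: mult_ac)
    finally show ?thesis unfolding qD by simp
  qed
  have gf': "germ S f'" unfolding f'_def
    by (intro germ_add germ_sum germ_mult germ_msubst f(1) \<tau>) (auto simp: S)
  have gg': "germ S g'" unfolding g'_def by (intro germ_msubst germ_mult gq g \<tau> S)
  have g'0: "g' \<noteq> 0"
  proof
    assume "g' = 0"
    then have "q * g = 0" unfolding g'_def by (rule inj)
    then have "q * g = q * 0" by simp
    then have "g = 0" by (rule unit_cancel[rotated]) (simp add: q_def)
    then show False using g(2) by simp
  qed
  have hf': "cterm (det (hess (\<lambda>i. i) (- f'))) \<noteq> 0"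
  proof -
    have "hess (\<lambda>i. i) (- f') = - hess (\<lambda>i. i) f'" by (simp add: hess_def vec_eq_iff)
    \<comment> \<open>By \<open>df'\<close> the gradient of the Legendre transform is
      \<open>\<tau>\<close> up to constants, so its Hessian is the transposed Jacobian of an
      invertible map.\<close>
    moreover have "cterm (det (hess (\<lambda>i. i) f')) = det (transpose (jacobian_at_0 \<tau>))"
      unfolding cterm_det hess_def by (simp add: df' jacobian_at_0_def transpose_def)
    ultimately show ?thesis using \<tau>(4) by (simp add: cterm_det_uminus)
  qed
  show ?thesis
  proof (rule that[OF gf' gg'])
    show "b ^ 2 \<in> range to_ac" unfolding b by (rule rangeI)
  next
    fix d :: 'k assume d: "d \<noteq> 0"
    obtain pt where Q: "cone_chart Last First pt d t'" "pt First = d * cterm (- f')"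
      using cone_chart_point[of Last First d t' "cterm (- f')"] d by auto
    interpret Q: cone_chart Last First pt d t' by fact
    show "cone_density S Last First (b * inverse (ry d ^ (?n + 2)))
       (cone_distr Last First ry d t' (- f') (mconst b * mmap to_ac g') :: ('n, 'k) distr)"
      by (rule Q.cone_density_cone_distr)
        (simp_all only: S Q(2) sqrt_branch_nonzero[OF ry d] b0 hf' gg' g'0 germ_uminus[OF S gf'] not_False_eq_True)
  next
    fix d :: 'k and \<phi> h \<phi>' h'
    assume d: "d \<noteq> 0" and G: "cone_distr First Last rx c t f (mmap to_ac g) = (p, \<phi>', h')"
      and del: "delta_eq (mmap to_ac \<phi>, h) (mmap to_ac \<phi>', h')"
    obtain pt where Q: "cone_chart Last First pt d t'" "pt First = d * cterm (- f')"
      using cone_chart_point[of Last First d t' "cterm (- f')"] d by auto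
    interpret Q: cone_chart Last First pt d t' by fact
    interpret B: cone_chart Last First "to_ac \<circ> pt" "to_ac d" "to_ac \<circ> t'" by (rule Q.chart_to_ac)
    define K where "K = to_ac c * inverse (rx c ^ (?n + 2))"
    \<comment> \<open>A square root of \<open>(c / d) ^ n\<close>, because \<open>rx c\<close> and
      \<open>ry d\<close> are square roots of \<open>c\<close> and \<open>d\<close>. The sign is
      chosen so that \<open>\<kappa> * K\<close> becomes the constant of the dual density at
      \<open>d\<close>, see \<open>\<kappa>K\<close>.\<close>
    define \<kappa> where "\<kappa> = rx c ^ ?n / ry d ^ ?n"
    have r0: "rx c \<noteq> 0" "ry d \<noteq> 0" using rx ry d P.c by (auto simp: sqrt_branch_nonzero)
    have \<kappa>: "\<kappa>\<^sup>2 * (to_ac d / to_ac c) ^ ?n = 1"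
    proof -
      have "\<kappa>\<^sup>2 * (to_ac d / to_ac c) ^ ?n = (rx c ^ 2 / ry d ^ 2 * (to_ac d / to_ac c)) ^ ?n"
        by (simp add: \<kappa>_def power_divide power_mult_distrib power_commutes flip: power_mult) (simp add: mult.commute)
      also have "rx c ^ 2 / ry d ^ 2 * (to_ac d / to_ac c) = 1"
        using rx ry d P.c by (simp add: sqrt_branch_def)
      finally show ?thesis by simp
    qed
    have \<kappa>K: "\<kappa> * K = to_ac d * inverse (ry d ^ (?n + 2))"
      unfolding K_def \<kappa>_def sqrt_branch_power[OF rx P.c] sqrt_branch_power[OF ry d]
      using r0 by (simp add: field_simps)
    define \<eta> where "\<eta> = mconst K * mpowr First (to_ac c) (- of_nat ?n / 2) * msubst (mmap to_ac g) A.s"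
    define \<eta>' where "\<eta>' = mconst (\<kappa> * K) * mpowr Last (to_ac d) (- of_nat ?n / 2)
      * msubst (msubst (\<rho> * mmap to_ac g) (\<lambda>i. mmap to_ac (\<tau> i))) B.s"
    let ?z = "(to_ac \<circ> p)(Last := (to_ac \<circ> pt) Last)" and ?z' = "(to_ac \<circ> pt)(First := (to_ac \<circ> p) First)"
    let ?w = "Wave ?z' (int ?n) (- (coord ?z' First * B.graph (- mmap to_ac f'))) (fps_const \<eta>')"
    have int: "is_formal_integral Mid ?z (A.graph (mmap to_ac f) * coord ?z Last) \<eta> ?w"
      unfolding \<eta>_def \<eta>'_def
    proof (rule formal_integral_graph[OF A.cone_chart_axioms B.cone_chart_axioms _ _ _ _ _ _ \<rho> \<kappa> refl refl])
      show "cterm (det (hess (\<lambda>i. i) (mmap to_ac f))) \<noteq> 0" using f(2) by (simp add: det_hess_mmap_to_ac)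
      show "stat_coeff (\<lambda>i. i) (mmap to_ac f) (mmap to_ac g) k = 0" if "k \<ge> 1" for k
        using A[OF that] mmap_to_ac_stat_coeff[OF f(2), of g k] by simp
      show "(to_ac \<circ> t') i = - cterm (mderiv i (mmap to_ac f))" for i
        by (simp add: t'_def flip: mmap_to_ac_mderiv)
      show "msubst (mderiv i (mmap to_ac f)) (\<lambda>i. mmap to_ac (\<tau> i)) = - (mconst ((to_ac \<circ> t') i) + mvar i)" for i
        using arg_cong[OF \<tau>(2)[of i], of "mmap to_ac"] by simp
      show "mmap to_ac f' = msubst (mmap to_ac f) (\<lambda>i. mmap to_ac (\<tau> i))
          + (\<Sum>i\<in>UNIV. (mconst ((to_ac \<circ> t) i) + mmap to_ac (\<tau> i)) * (mconst ((to_ac \<circ> t') i) + mvar i))"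
        by (simp add: f'_def)
    qed (simp add: \<tau>(1))
    have 1: "delta_eq (mmap to_ac \<phi>, h) (coord (to_ac \<circ> p) Last - A.graph (mmap to_ac f), \<eta>)"
    proof -
      have \<phi>': "mmap to_ac \<phi>' = A.eqn (mmap to_ac f)"
        and h': "h' = msubst (mmap to_ac g) A.s * (mconst (inverse (rx c ^ (?n + 2))) * mpowr First (to_ac c) (hdeg TYPE('n)))"
        using G unfolding P.cone_distr_eq[OF P(2)] by auto
      have "A.x * h' = (A.x * mpowr First (to_ac c) (hdeg TYPE('n))) * (mconst (inverse (rx c ^ (?n + 2))) * msubst (mmap to_ac g) A.s)"
        unfolding h' by (simp only: mult_ac)
      also have "\<dots> = \<eta>" unfolding A.x_mult_mpowr \<eta>_def K_def mconst_mult by (simp only: mult_ac)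
      finally show ?thesis using delta_eq_trans[OF del[unfolded \<phi>'] A.delta_eq_eqn] by simp
    qed
    have 2: "cone_distr Last First ry d t' (- f') (mconst b * mmap to_ac g') = (pt, Q.eqn (- f'),
       msubst (mconst b * mmap to_ac g') B.s * (mconst (inverse (ry d ^ (?n + 2))) * mpowr Last (to_ac d) (hdeg TYPE('n))))"
      (is "_ = (_, _, ?h')") using Q.cone_distr_eq[OF Q(2)] by simp
    have 3: "delta_eq (mmap to_ac (Q.eqn (- f')), ?h') (coord (to_ac \<circ> pt) First - B.graph (- mmap to_ac f'), \<eta>')"
    proof -
      have e: "msubst (mconst b * mmap to_ac g') B.s = msubst (msubst (\<rho> * mmap to_ac g) (\<lambda>i. mmap to_ac (\<tau> i))) B.s"
        by (simp add: \<rho>_def g'_def \<tau>(1) mult_ac)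
      have "B.x * ?h' = (B.x * mpowr Last (to_ac d) (hdeg TYPE('n))) * (mconst (inverse (ry d ^ (?n + 2))) * msubst (mconst b * mmap to_ac g') B.s)"
        by (simp only: mult_ac)
      also have "\<dots> = \<eta>'" unfolding B.x_mult_mpowr \<eta>'_def \<kappa>K e mconst_mult by (simp only: mult_ac)
      finally show ?thesis using B.delta_eq_eqn[of "- mmap to_ac f'" ?h'] by simp
    qed
    have "indep_of Last \<eta>" unfolding indep_of_iff \<eta>_def by (simp add: A.mderiv_pullback_i1 mderiv_mpowr_neq)
    moreover have "indep_of First \<eta>'" unfolding indep_of_iff \<eta>'_def by (simp add: B.mderiv_pullback_i1 mderiv_mpowr_neq)
    \<comment> \<open>With these branches the fourth root of unity is 1. The 2 subtracted from n + 2
      is the factor (2 pi hbar)^(-1) of the delta function on the dual side.\<close>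
    moreover have "wave_eq ?w (Wave ?z' (int (?n + 2) - 2) (- (coord ?z' First * B.graph (- mmap to_ac f'))) (fps_const \<eta>'))"
      unfolding wave_eq_def by (auto intro!: exI[of _ 1])
    ultimately show "fourier_related (p, \<phi>, h) (cone_distr Last First ry d t' (- f') (mconst b * mmap to_ac g'))"
      unfolding 2 fourier_related_def prod.case Let_def
      using 1 3 int A.indep_graph B.indep_graph by blast
  qed
qed

section \<open>From a homogeneous density back to a pair of functions\<close>

lemma mderiv_rescale_Some:
  fixes a :: "('v::finite, 'a::field_char_0) mps"
  assumes "indep_of j a"
  shows "mderiv (Some j) (rescale p a) = 0"
proof -
  have "msubst (mderiv i a) b * mderiv (Some j) (mvar (Some i) + mvar None * (mconst (p i) + mvar (Some i))) = 0" for i and b :: "'v \<Rightarrow> ('v option, 'a) mps"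
    using assms by (cases "i = j") (auto simp: indep_of_iff mderiv_mvar)
  then show ?thesis unfolding rescale_def by (subst mderiv_msubst) (auto intro!: sum.neutral)
qed

lemma mderiv_mrename_Some:
  fixes a :: "('v::finite, 'a::field_char_0) mps"
  shows "mderiv (Some j) (mrename Some a) = mrename Some (mderiv j a)"
proof -
  have "(\<Sum>i\<in>UNIV. msubst (mderiv i a) (\<lambda>i. mvar (Some i)) * mderiv (Some j) (mvar (Some i)))
      = (\<Sum>i\<in>UNIV. if i = j then mrename Some (mderiv i a) else 0)"
    by (rule sum.cong) (auto simp: mderiv_mvar mrename_def)
  then show ?thesis unfolding mrename_def by (subst mderiv_msubst) (auto simp: mrename_def)
qed

lemma tangent_single: "(\<lambda>_. 0)(j := 1) \<in> tangent_space \<phi> \<longleftrightarrow> cterm (mderiv j \<phi>) = 0"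
proof -
  have "(\<Sum>i\<in>UNIV. cterm (mderiv i \<phi>) * ((\<lambda>_. 0)(j := 1)) i) = (\<Sum>i\<in>UNIV. if i = j then cterm (mderiv i \<phi>) else 0)"
    by (rule sum.cong) auto
  then show ?thesis by (simp add: tangent_space_def)
qed

text \<open>Restrict \<open>\<phi>((1 + \<epsilon>) x) = u \<phi>(x)\<close> to the hypersurface \<open>\<phi> = 0\<close>.\<close>
lemma conical_graph:
  fixes \<phi> \<xi> :: "('v::finite, 'a::field_char_0) mps"
  assumes con: "conical p \<phi>" and \<xi>: "cterm \<xi> = 0" "indep_of j \<xi>"
    and \<phi>: "\<phi> = (mvar j - \<xi>) * q" and q: "cterm q \<noteq> 0"
  shows "rescale p (mconst (p j) + \<xi>) = (1 + mvar None) * mrename Some (mconst (p j) + \<xi>)"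
proof -
  define \<sigma> where "\<sigma> = mvar(Some j := mrename Some \<xi>)"
  have \<sigma>0: "cterm (\<sigma> i) = 0" for i by (simp add: \<sigma>_def \<xi>)
  have id: "msubst a \<sigma> = a" if "indep_of (Some j) a" for a
    using msubst_indep_cong[OF that, of \<sigma> mvar] by (simp add: \<sigma>_def)
  have ren: "msubst (mrename Some \<xi>) \<sigma> = mrename Some \<xi>"
    using \<xi>(2) by (intro id) (simp add: indep_of_iff mderiv_mrename_Some)
  have s: "\<sigma> (Some j) = mrename Some \<xi>" "\<sigma> None = mvar None" by (simp_all add: \<sigma>_def)
  obtain u where u: "rescale p \<phi> = u * mrename Some \<phi>" using con unfolding conical_def by blast
  have "msubst (mrename Some \<phi>) \<sigma> = 0" by (simp add: \<phi> \<sigma>0 ren s)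
  then have "msubst (rescale p \<phi>) \<sigma> = 0" by (simp add: u \<sigma>0)
  then have "msubst (rescale p q) \<sigma> * msubst (rescale p (mvar j - \<xi>)) \<sigma> = msubst (rescale p q) \<sigma> * 0"
    by (simp add: \<phi> \<sigma>0 mult.commute)
  then have z: "msubst (rescale p (mvar j - \<xi>)) \<sigma> = 0"
    by (rule unit_cancel[rotated]) (simp add: rescale_def q)
  have "mvar j - \<xi> = coord p j - (mconst (p j) + \<xi>)" by (simp add: coord_def)
  then have "rescale p (mvar j - \<xi>) = (1 + mvar None) * mrename Some (coord p j) - rescale p (mconst (p j) + \<xi>)"
    by (simp only: rescale_diff rescale_coord)
  moreover have "msubst (rescale p (mconst (p j) + \<xi>)) \<sigma> = rescale p (mconst (p j) + \<xi>)"
    using \<xi>(2) by (intro id) (simp only: indep_of_iff mderiv_rescale_Some mderiv_add mderiv_mconst add_0_left)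
  ultimately show ?thesis using z by (simp add: \<sigma>0 s coord_def del: rescale_add rescale_diff)
qed

lemma mpowr_None_1: "mpowr None 1 1 = 1 + mvar None"
  by (simp add: mpowr_eq_binom)

text \<open>The graph equation is homogeneous of degree 1, so its delta function has degree -1 and
  the density \<open>\<eta>\<close> has degree d + 1. Uniqueness of the graph form, applied with
  \<epsilon> as a further variable, turns equality of distributions into equality of series.\<close>

lemma homogeneous_graph:
  fixes \<phi> h \<psi> \<eta> :: "('v::finite, 'a::field_char_0) mps"
  assumes hom: "homogeneous d p \<phi> h" and del: "delta_eq (\<phi>, h) (coord p j - \<psi>, \<eta>)"
    and indep: "indep_of j \<psi>" "indep_of j \<eta>" and c: "cterm \<psi> = p j"
    and \<psi>: "rescale p \<psi> = (1 + mvar None) * mrename Some \<psi>"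
  shows "rescale p \<eta> = mpowr None 1 (1 + d) * mrename Some \<eta>"
proof -
  let ?C = "coord p j - \<psi>" and ?m = "mpowr None 1 d :: ('v option, 'a) mps"
  have r: "delta_eq (rescale p \<phi>, rescale p h) (rescale p ?C, rescale p \<eta>)"
    unfolding rescale_def by (rule delta_eq_msubst[OF del]) simp
  have m: "delta_eq (mrename Some \<phi>, ?m * mrename Some h) (mrename Some ?C, ?m * mrename Some \<eta>)"
    unfolding mrename_def by (rule delta_eq_mult[OF delta_eq_msubst[OF del]]) simp
  have rC: "rescale p ?C = (1 + mvar None) * mrename Some ?C"
    unfolding rescale_diff rescale_coord \<psi> mrename_diff by (simp only: right_diff_distrib)
  obtain v :: "('v option, 'a) mps" where v: "(1 + mvar None) * v = 1"
    using unit_inverseE[of "1 + mvar None"] by auto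
  have "delta_eq (v * rescale p ?C, v * rescale p \<eta>) (mrename Some ?C, ?m * mrename Some \<eta>)"
  proof (rule delta_eq_trans)
    show "delta_eq (v * rescale p ?C, v * rescale p \<eta>) (rescale p ?C, rescale p \<eta>)"
      by (rule delta_eq_unit) (use unit_of_mult[of v "1 + mvar None"] v in \<open>simp add: mult.commute\<close>)
    show "delta_eq (rescale p ?C, rescale p \<eta>) (mrename Some ?C, ?m * mrename Some \<eta>)"
      using hom[unfolded homogeneous_def] delta_eq_sym[OF r] m by (blast intro: delta_eq_trans)
  qed
  moreover have "v * rescale p ?C = mrename Some ?C"
  proof -
    have "v * rescale p ?C = ((1 + mvar None) * v) * mrename Some ?C" unfolding rC by (simp only: mult_ac)
    then show ?thesis by (simp only: v mult_1_left)
  qed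
  \<comment> \<open>The base point is extended by the value 0 for \<epsilon>, so that
    \<open>delta_eq_graph\<close> applies in the enlarged set of variables.\<close>
  moreover have "mrename Some ?C = coord (case_option 0 p) (Some j) - mrename Some \<psi>"
    by (simp add: coord_def)
  ultimately have "delta_eq (coord (case_option 0 p) (Some j) - mrename Some \<psi>, v * rescale p \<eta>)
      (coord (case_option 0 p) (Some j) - mrename Some \<psi>, ?m * mrename Some \<eta>)" by simp
  then have "v * rescale p \<eta> = ?m * mrename Some \<eta>"
  proof (rule delta_eq_graph[THEN conjunct2])
    have "mderiv (Some j) v = 0" using mderiv_inverse[OF v, of "Some j"] by (simp add: mderiv_mvar)
    then show "indep_of (Some j) (v * rescale p \<eta>)"
      using indep(2) by (simp add: indep_of_iff mderiv_rescale_Some)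
    show "indep_of (Some j) (?m * mrename Some \<eta>)"
      using indep(2) by (simp add: indep_of_iff mderiv_mrename_Some mderiv_mpowr_neq)
  qed (use indep(1) c in \<open>simp_all add: indep_of_iff mderiv_mrename_Some\<close>)
  then have "(1 + mvar None) * (v * rescale p \<eta>) = (1 + mvar None) * ?m * mrename Some \<eta>" by (simp only: mult.assoc)
  moreover have "(1 + mvar None) * (v * rescale p \<eta>) = rescale p \<eta>" using v by (simp flip: mult.assoc)
  moreover have "(1 + mvar None) * ?m = mpowr None 1 (1 + d)"
    by (simp add: mpowr_eq_binom binom_add)
  ultimately show ?thesis by (simp only:)
qed

text \<open>The third constraint allows solving for the last coordinate, so \<open>\<phi>\<close> is
  a unit \<open>q\<close> times a graph equation and the density is divided by \<open>q\<close>.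
  Homogeneity then determines the graph function and the density from their restrictions to a slice,
  which are \<open>f\<close> and \<open>g\<close> up to constants.\<close>

lemma density_representation:
  fixes S :: "'k::field_char_0 setting" and p :: "'n::finite amb \<Rightarrow> 'k"
  assumes S: "valid_setting S" and rx: "sqrt_branch rx"
    and dens: "cone_density S First Last (inverse (rx (p First) ^ (CARD('n) + 2))) (p, \<phi>, h)"
  obtains t f g \<phi>' h' where "cone_chart First Last p (p First) t" "p Last = p First * cterm f"
    "germ S f" "germ S g" "g \<noteq> 0" "cone_distr First Last rx (p First) t f (mmap to_ac g) = (p, \<phi>', h')"
    "delta_eq (mmap to_ac \<phi>, h) (mmap to_ac \<phi>', h')"
proof -
  let ?n = "CARD('n)"
  define c where "c = p First"
  define c0 where "c0 = inverse (rx c ^ (?n + 2))"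
  define t where "t i = p (Mid i) / c" for i
  from dens obtain h0 where \<phi>: "germ S \<phi>" "cterm \<phi> = 0" "cterm (mderiv Last \<phi>) \<noteq> 0" "conical p \<phi>" and c: "c \<noteq> 0"
    and h0: "germ S h0" "h = mconst c0 * mmap to_ac h0" and nz: "\<And>w. h \<noteq> w * mmap to_ac \<phi>"
    and hom: "homogeneous (hdeg TYPE('n)) (to_ac \<circ> p) (mmap to_ac \<phi>) h"
    unfolding cone_density_def prod.case smooth_hypersurface_def tangent_single c0_def c_def by blast
  interpret P: cone_chart First Last p c t
    by unfold_locales (use c in \<open>auto simp: t_def c_def\<close>)
  interpret A: cone_chart First Last "to_ac \<circ> p" "to_ac c" "to_ac \<circ> t" by (rule P.chart_to_ac)
  obtain \<xi> where \<xi>: "cterm \<xi> = 0" "indep_of Last \<xi>" "msubst \<phi> (mvar(Last := \<xi>)) = 0" "germ S \<xi>"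
    using implicit_function[OF \<phi>(2,3)] S \<phi>(1) by metis
  define \<sigma> where "\<sigma> = mvar(Last := \<xi>)"
  have \<sigma>0: "cterm (\<sigma> i) = 0" for i by (simp add: \<sigma>_def \<xi>)
  have id: "msubst a \<sigma> = a" if "indep_of Last a" for a
    using msubst_indep_cong[OF that, of \<sigma> mvar] by (simp add: \<sigma>_def)
  have \<sigma>L: "\<sigma> Last = \<xi>" by (simp add: \<sigma>_def)
  obtain q where q: "\<phi> = (mvar Last - \<xi>) * q"
    using division_by_graph[OF \<xi>(1,2), of \<phi>] \<xi>(3) by auto
  have dq: "mderiv Last \<phi> = q + (mvar Last - \<xi>) * mderiv Last q"
    unfolding q using \<xi>(2) by (simp add: indep_of_iff mderiv_mvar)
  then have q0: "cterm q \<noteq> 0" using \<phi>(3) \<xi>(1) by simp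
  have q\<sigma>: "msubst q \<sigma> = msubst (mderiv Last \<phi>) \<sigma>"
    unfolding dq by (simp add: \<sigma>0 \<sigma>L id[OF \<xi>(2)])
  define \<psi> where "\<psi> = mconst (p Last) + \<xi>"
  have \<psi>i: "indep_of Last \<psi>" using \<xi>(2) by (simp add: \<psi>_def indep_of_iff)
  have \<psi>h: "rescale p \<psi> = (1 + mvar None) * mrename Some \<psi>"
    unfolding \<psi>_def by (rule conical_graph[OF \<phi>(4) \<xi>(1,2) q q0])
  \<comment> \<open>The graph function has degree 1 and equals \<open>c * f\<close> on the slice,
    hence the division by \<open>c\<close>.\<close>
  define f where "f = mconst (1 / c) * msubst \<psi> P.slice"
  have \<psi>g: "\<psi> = P.graph f"
  proof -
    have cc: "mconst c * mconst (1 / c) = (1 :: ('n amb, 'k) mps)" using c by (simp flip: mconst_mult)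
    have x: "mpowr First c 1 = mconst (1 / c) * P.x"
      using cc by (simp add: mpowr_eq_binom P.x_def coord_def P.p0 ring_distribs mult.commute)
    have "\<psi> = mpowr First c 1 * msubst (msubst \<psi> P.slice) P.s"
      by (rule P.homogeneous_expansion[OF \<psi>i]) (simp only: \<psi>h mpowr_None_1)
    then show ?thesis by (simp add: x P.graph_def f_def mult_ac)
  qed
  have pL: "p Last = c * cterm f"
    using arg_cong[OF \<psi>g, of cterm] \<xi>(1) by (simp add: \<psi>_def P.graph_def)
  have gsl: "germ S (P.slice j)" for j
    by (cases j) (auto simp: P.slice_def S intro!: germ_mult)
  have gf: "germ S f" unfolding f_def \<psi>_def
    by (intro germ_mult germ_msubst germ_add gsl \<xi>(4)) (auto simp: S)
  \<comment> \<open>On the hypersurface \<open>q\<close> equals \<open>\<partial>\<phi> / \<partial>x\<^bsub>n+1\<^esub>\<close>, which, unlike \<open>q\<close>, is known to be a germ.\<close>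
  define \<eta>0 where "\<eta>0 = msubst h0 \<sigma> * minv (msubst (mderiv Last \<phi>) \<sigma>)"
  have g\<sigma>: "germ S (\<sigma> j)" for j by (auto simp: \<sigma>_def S \<xi>(4))
  have g\<eta>: "germ S \<eta>0" unfolding \<eta>0_def
    using \<phi>(3) by (intro germ_mult germ_minv germ_msubst germ_mderiv S g\<sigma> \<sigma>0 h0 \<phi>(1)) simp
  have \<sigma>i: "indep_of Last (msubst a \<sigma>)" for a
    unfolding indep_of_iff \<sigma>_def using \<xi>(1,2)
    by (subst mderiv_msubst) (auto simp: mderiv_mvar indep_of_iff intro!: sum.neutral)
  have q\<eta>: "msubst q \<sigma> * \<eta>0 = msubst h0 \<sigma>"
    using mult_minv[of "msubst (mderiv Last \<phi>) \<sigma>"] \<phi>(3) by (simp add: \<eta>0_def q\<sigma> mult.left_commute)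
  have \<eta>i: "indep_of Last \<eta>0"
  proof -
    have "mderiv Last (minv (msubst (mderiv Last \<phi>) \<sigma>)) = 0"
      using mderiv_inverse[OF mult_minv, of "msubst (mderiv Last \<phi>) \<sigma>" Last] \<phi>(3) \<sigma>i[of "mderiv Last \<phi>"]
      by (simp add: indep_of_iff)
    then show ?thesis using \<sigma>i[of h0] by (simp add: indep_of_iff \<eta>0_def)
  qed
  obtain w where w: "h0 - q * \<eta>0 = (mvar Last - \<xi>) * w"
  proof -
    have "msubst (h0 - q * \<eta>0) \<sigma> = 0" by (simp add: \<sigma>0 id[OF \<eta>i] q\<eta>)
    then show ?thesis using that division_by_graph[OF \<xi>(1,2), of "h0 - q * \<eta>0"] unfolding \<sigma>_def by auto
  qed
  define \<eta> where "\<eta> = mconst c0 * mmap to_ac \<eta>0"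
  have coord: "coord (to_ac \<circ> p) Last - mmap to_ac \<psi> = mmap to_ac (mvar Last - \<xi>)"
    by (simp add: \<psi>_def coord_def)
  have del: "delta_eq (mmap to_ac \<phi>, h) (coord (to_ac \<circ> p) Last - mmap to_ac \<psi>, \<eta>)"
    unfolding delta_eq_def fst_conv snd_conv coord
  proof (intro exI conjI)
    show "cterm (mmap to_ac q) \<noteq> 0" using q0 by simp
    show "mmap to_ac \<phi> = mmap to_ac q * mmap to_ac (mvar Last - \<xi>)" by (subst q) (simp add: mult.commute)
    have "h0 = q * \<eta>0 + (mvar Last - \<xi>) * w" using w by (simp add: algebra_simps)
    then have e: "mmap to_ac h0 = mmap to_ac q * mmap to_ac \<eta>0 + mmap to_ac (mvar Last - \<xi>) * mmap to_ac w"
      by (simp only: mmap_to_ac_add mmap_to_ac_mult)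
    show "h = mmap to_ac q * \<eta> + (mconst c0 * mmap to_ac w) * mmap to_ac (mvar Last - \<xi>)"
      unfolding h0(2) \<eta>_def e by (simp only: distrib_left mult_ac)
  qed
  \<comment> \<open>The graph density is \<open>A.x\<close> times the density of
    \<open>cone_distr\<close>; on the slice this factor is \<open>c\<close>.\<close>
  define g where "g = mconst (1 / c) * msubst \<eta>0 P.slice"
  have gg: "germ S g" unfolding g_def by (intro germ_mult germ_msubst gsl g\<eta>) (auto simp: S)
  have "rescale (to_ac \<circ> p) \<eta> = mpowr None 1 (1 + hdeg TYPE('n)) * mrename Some \<eta>"
  proof (rule homogeneous_graph[OF hom del])
    show "indep_of Last (mmap to_ac \<psi>)" "indep_of Last \<eta>"
      using \<psi>i \<eta>i by (simp_all add: indep_of_iff \<eta>_def flip: mmap_to_ac_mderiv)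
    show "cterm (mmap to_ac \<psi>) = (to_ac \<circ> p) Last" by (simp add: \<psi>_def \<xi>(1))
    show "rescale (to_ac \<circ> p) (mmap to_ac \<psi>) = (1 + mvar None) * mrename Some (mmap to_ac \<psi>)"
      using arg_cong[OF \<psi>h, of "mmap to_ac"] by simp
  qed
  then have \<eta>exp: "\<eta> = mpowr First (to_ac c) (1 + hdeg TYPE('n)) * msubst (msubst \<eta> A.slice) A.s"
    using \<eta>i by (intro A.homogeneous_expansion) (simp_all add: indep_of_iff \<eta>_def flip: mmap_to_ac_mderiv)
  have "msubst \<eta> A.slice = mconst c0 * (mconst (to_ac c) * mmap to_ac g)"
  proof -
    have "msubst \<eta> A.slice = mconst c0 * mmap to_ac (msubst \<eta>0 P.slice)" by (simp add: \<eta>_def)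
    also have "msubst \<eta>0 P.slice = mconst c * g" using c by (simp add: g_def flip: mult.assoc mconst_mult)
    finally show ?thesis by simp
  qed
  moreover have "1 + hdeg TYPE('n) = (- of_nat ?n / 2 :: 'k alg_closure)" by (simp add: hdeg_def add_divide_distrib)
  ultimately have \<eta>eq: "\<eta> = mpowr First (to_ac c) (- of_nat ?n / 2) * msubst (mconst c0 * (mconst (to_ac c) * mmap to_ac g)) A.s"
    using \<eta>exp by simp
  define h' where "h' = msubst (mmap to_ac g) A.s * (mconst c0 * mpowr First (to_ac c) (hdeg TYPE('n)))"
  have xh: "A.x * h' = \<eta>"
  proof -
    have "A.x * h' = (A.x * mpowr First (to_ac c) (hdeg TYPE('n))) * (mconst c0 * msubst (mmap to_ac g) A.s)"
      unfolding h'_def by (simp only: mult_ac)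
    also have "\<dots> = \<eta>" unfolding A.x_mult_mpowr \<eta>eq by (simp add: mult_ac)
    finally show ?thesis .
  qed
  have D: "cone_distr First Last rx c t f (mmap to_ac g) = (p, P.eqn f, h')"
    unfolding P.cone_distr_eq[OF pL] h'_def c0_def by simp
  have del': "delta_eq (mmap to_ac \<phi>, h) (mmap to_ac (P.eqn f), h')"
  proof -
    have "mmap to_ac \<psi> = A.graph (mmap to_ac f)" by (simp add: \<psi>g)
    then show ?thesis
      using delta_eq_trans[OF del[unfolded \<open>mmap to_ac \<psi> = _\<close>] delta_eq_sym[OF A.delta_eq_eqn[of "mmap to_ac f" h', unfolded xh]]]
      by simp
  qed
  have "g \<noteq> 0"
  proof
    assume "g = 0"
    then have "h' = 0" by (simp add: h'_def)
    then obtain u w where u: "cterm u \<noteq> 0" "mmap to_ac \<phi> = u * mmap to_ac (P.eqn f)" "h = w * mmap to_ac (P.eqn f)"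
      using del' unfolding delta_eq_def by auto
    obtain v where "u * v = 1" using unit_inverseE[OF u(1)] .
    moreover have "(w * v) * mmap to_ac \<phi> = w * mmap to_ac (P.eqn f) * (u * v)" unfolding u(2) by (simp only: mult_ac)
    ultimately show False using nz u(3) by (metis mult.right_neutral)
  qed
  then show ?thesis using that[of t f g] P.cone_chart_axioms pL gf gg D del' unfolding c_def by blast
qed

text \<open>By \<open>delta_eq_graph\<close> the witnesses hidden in \<open>fourier_related\<close>
  are the graph function and density computed from the pair. By \<open>stat_coeff_pullback\<close>
  an amplitude constant in hbar then makes the coefficients of the pair vanish at the critical
  point, up to unit factors.\<close>

lemma fourier_related_admissible:
  fixes p :: "'n::finite amb \<Rightarrow> 'k::field_char_0"
  assumes P: "cone_chart First Last p c t" "p Last = c * cterm f" and r: "rx c \<noteq> 0"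
    and G: "cone_distr First Last rx c t f (mmap to_ac g) = (p, \<phi>', h')"
    and del: "delta_eq (mmap to_ac \<phi>, h) (mmap to_ac \<phi>', h')"
    and F: "fourier_related (p, \<phi>, h) (q, \<phi>'', h'')" and q: "q Last \<noteq> 0"
  shows "cterm (det (hess (\<lambda>i. i) f)) \<noteq> 0" "k \<ge> 1 \<Longrightarrow> stat_coeff (\<lambda>i. i) f g k = 0"
proof -
  interpret P: cone_chart First Last p c t by fact
  interpret A: cone_chart First Last "to_ac \<circ> p" "to_ac c" "to_ac \<circ> t" by (rule P.chart_to_ac)
  let ?n = "CARD('n)"
  let ?f = "mmap to_ac f" and ?g = "mmap to_ac g"
  define d where "d = to_ac (q Last)"
  have d: "d \<noteq> 0" using q by (simp add: d_def)
  define K where "K = to_ac c * inverse (rx c ^ (?n + 2))"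
  define W :: "('n amb, 'k alg_closure) mps" where "W = mconst K * mpowr First (to_ac c) (- of_nat ?n / 2)"
  have K: "K \<noteq> 0" using r P.c by (simp add: K_def)
  define z where "z = (to_ac \<circ> p)(Last := (to_ac \<circ> q) Last)"
  define Y where "Y = coord z Last"
  obtain \<psi> \<eta> \<eta>' w where \<psi>: "indep_of Last \<psi>" "indep_of Last \<eta>"
    and del2: "delta_eq (mmap to_ac \<phi>, h) (coord (to_ac \<circ> p) Last - \<psi>, \<eta>)"
    and int: "is_formal_integral Mid z (\<psi> * Y) \<eta> w"
    and amp: "\<exists>\<zeta>. ampl w = fps_const (mconst \<zeta>) * fps_const \<eta>'"
    using F unfolding fourier_related_def prod.case Let_def wave_eq_def wave.sel z_def Y_def by blast
  have \<phi>': "mmap to_ac \<phi>' = A.eqn ?f"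
    and h': "h' = msubst ?g A.s * (mconst (inverse (rx c ^ (?n + 2))) * mpowr First (to_ac c) (hdeg TYPE('n)))"
    using G unfolding P.cone_distr_eq[OF P(2)] by auto
  have "A.x * h' = (A.x * mpowr First (to_ac c) (hdeg TYPE('n))) * (mconst (inverse (rx c ^ (?n + 2))) * msubst ?g A.s)"
    unfolding h' by (simp only: mult_ac)
  also have "\<dots> = W * msubst ?g A.s" unfolding A.x_mult_mpowr W_def K_def mconst_mult by (simp only: mult_ac)
  finally have xh: "A.x * h' = W * msubst ?g A.s" .
  have "\<psi> = A.graph ?f \<and> \<eta> = W * msubst ?g A.s"
  proof (rule delta_eq_graph)
    show "delta_eq (coord (to_ac \<circ> p) Last - \<psi>, \<eta>) (coord (to_ac \<circ> p) Last - A.graph ?f, W * msubst ?g A.s)"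
      using delta_eq_trans[OF delta_eq_sym[OF del2] delta_eq_trans[OF del[unfolded \<phi>'] A.delta_eq_eqn]] by (simp only: xh)
    show "indep_of Last (W * msubst ?g A.s)"
      unfolding indep_of_iff W_def by (simp add: A.mderiv_pullback_i1 mderiv_mpowr_neq)
    show "cterm (A.graph ?f) = (to_ac \<circ> p) Last" using P(2) by (simp add: A.graph_def)
  qed (use \<psi> A.indep_graph in auto)
  then have \<psi>\<eta>: "\<psi> = A.graph ?f" "\<eta> = W * msubst ?g A.s" by auto
  have "cterm Y \<noteq> 0" using d by (simp add: Y_def z_def d_def)
  then obtain Y' where Y': "Y * Y' = 1" using unit_inverseE by blast
  interpret pp: phase_pullback Mid A.x A.x' Y Y' W A.s
    by (rule A.phase_pullback_Mid, rule Y')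
      (simp_all add: Y_def coord_def mderiv_mvar W_def mderiv_mpowr_neq)
  have ph: "\<psi> * Y = A.x * Y * msubst ?f A.s" unfolding \<psi>\<eta> A.graph_def by (simp only: mult_ac)
  obtain \<tau> \<rho> where det0: "cterm (det (hess Mid (\<psi> * Y))) \<noteq> 0"
    and wb: "\<And>i. wbase w (Mid i) = - cterm (mderiv (Mid i) (\<psi> * Y))"
    and \<tau>: "\<And>j. cterm (\<tau> j) = 0" "\<And>j. j \<notin> range Mid \<Longrightarrow> \<tau> j = mvar j"
    and crit: "\<And>i. coord (wbase w) (Mid i) = - msubst (mderiv (Mid i) (\<psi> * Y)) \<tau>"
    and \<rho>: "\<rho>\<^sup>2 * det (- hess Mid (\<psi> * Y)) = 1"
    and ampw: "ampl w = Abs_fps (\<lambda>k. msubst (\<rho> * stat_coeff Mid (\<psi> * Y) \<eta> k) \<tau>)"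
    using int unfolding is_formal_integral_def by blast
  have "cterm (det (- hess Mid (\<psi> * Y))) \<noteq> 0" using det0 by (simp add: cterm_det_uminus)
  then have f_ac: "cterm (det (hess (\<lambda>i. i) ?f)) \<noteq> 0"
    unfolding ph pp.det_hess_phase by (auto simp: cterm_det_uminus)
  then show fdet: "cterm (det (hess (\<lambda>i. i) f)) \<noteq> 0" by (simp add: det_hess_mmap_to_ac)
  \<comment> \<open>On \<open>x\<^sub>0 = c\<close>, \<open>y\<^bsub>n+1\<^esub> = d\<close> the critical point inverts the gradient map of \<open>f\<close>, so pulling back
    along it is injective.\<close>
  define sl :: "'n amb \<Rightarrow> ('n, 'k alg_closure) mps" where "sl j = (case j of Mid i \<Rightarrow> mconst d * mvar i | _ \<Rightarrow> 0)" for j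
  have sl: "cterm (sl j) = 0" for j by (cases j) (auto simp: sl_def)
  have sl_simps: "sl (Mid i) = mconst d * mvar i" "sl Last = 0" for i by (simp_all add: sl_def)
  define \<sigma> where "\<sigma> i = msubst (msubst (A.s i) \<tau>) sl" for i
  have \<sigma>0: "cterm (\<sigma> i) = 0" for i by (simp add: \<sigma>_def)
  have pull: "msubst (msubst (msubst a A.s) \<tau>) sl = msubst a \<sigma>" for a
    by (simp add: msubst_msubst \<tau>(1) sl \<sigma>_def[abs_def])
  have grad: "msubst (mderiv i ?f) \<sigma> = - (mconst (- cterm (mderiv i ?f)) + mvar i)" for i
  proof -
    have dF: "mderiv (Mid i) (\<psi> * Y) = Y * msubst (mderiv i ?f) A.s" unfolding ph by (rule pp.mderiv_phase)
    have cY: "cterm Y = d" by (simp add: Y_def z_def d_def)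
    have "\<tau> Last = mvar Last" by (rule \<tau>(2)) auto
    then have Ysl: "msubst (msubst Y \<tau>) sl = mconst d"
      by (simp add: Y_def coord_def z_def d_def \<tau>(1) sl sl_simps)
    have "msubst (coord (wbase w) (Mid i)) sl = - msubst (msubst (Y * msubst (mderiv i ?f) A.s) \<tau>) sl"
      unfolding crit dF by simp
    moreover have "wbase w (Mid i) = - (d * cterm (mderiv i ?f))" unfolding wb dF by (simp add: cY)
    then have "msubst (coord (wbase w) (Mid i)) sl = mconst d * (mvar i - mconst (cterm (mderiv i ?f)))"
      by (simp add: coord_def sl sl_simps mconst_mult mconst_uminus algebra_simps)
    moreover have "msubst (msubst (Y * msubst (mderiv i ?f) A.s) \<tau>) sl = mconst d * msubst (mderiv i ?f) \<sigma>"
      by (simp add: \<tau>(1) sl Ysl pull)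
    ultimately have "mconst d * (mvar i - mconst (cterm (mderiv i ?f))) = mconst d * (- msubst (mderiv i ?f) \<sigma>)"
      by simp
    then have "mvar i - mconst (cterm (mderiv i ?f)) = - msubst (mderiv i ?f) \<sigma>"
      by (rule unit_cancel[rotated]) (simp add: d)
    then have "msubst (mderiv i ?f) \<sigma> = - (mvar i - mconst (cterm (mderiv i ?f)))" by simp
    then show ?thesis by (simp add: mconst_uminus)
  qed
  show "stat_coeff (\<lambda>i. i) f g k = 0" if k: "k \<ge> 1"
  proof -
    have "fps_nth (ampl w) k = 0" using amp k by auto
    then have "msubst (\<rho> * stat_coeff Mid (\<psi> * Y) \<eta> k) \<tau> = 0" by (simp add: ampw)
    then have 0: "msubst (\<rho> * (W * (A.x' * Y') ^ k) * msubst (stat_coeff (\<lambda>i. i) ?f ?g k) A.s) \<tau> = 0"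
      unfolding ph \<psi>\<eta>(2) pp.stat_coeff_pullback[OF f_ac] by (simp only: mult.assoc)
    have "cterm (\<rho>\<^sup>2) \<noteq> 0" using unit_of_mult[OF \<rho>] .
    moreover have "cterm Y' \<noteq> 0" using unit_of_mult[of Y' Y] Y' by (simp add: mult.commute)
    ultimately have "cterm (\<rho> * (W * (A.x' * Y') ^ k)) \<noteq> 0" using K P.c by (simp add: W_def)
    then have "msubst (msubst (stat_coeff (\<lambda>i. i) ?f ?g k) A.s) \<tau> = 0"
      using 0 unit_cancel[of "msubst (\<rho> * (W * (A.x' * Y') ^ k)) \<tau>" _ 0] by (simp add: \<tau>(1))
    then have "msubst (stat_coeff (\<lambda>i. i) ?f ?g k) \<sigma> = 0" using pull by (metis msubst_0)
    then have "stat_coeff (\<lambda>i. i) ?f ?g k = 0"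
      using gradient_inverse[OF f_ac, of "\<lambda>i. - cterm (mderiv i ?f)"] \<sigma>0 grad by metis
    then have "mmap to_ac (stat_coeff (\<lambda>i. i) f g k) = mmap to_ac 0" using mmap_to_ac_stat_coeff[OF fdet] by simp
    then show ?thesis by (simp only: mmap_to_ac_eq_iff)
  qed
qed

section \<open>Identification along rays\<close>

text \<open>The ratios to the coordinate \<open>i\<^sub>0\<close> are invariant under dilation, and
  everything in the chart is built from them and from powers of that coordinate divided by its
  value.\<close>

lemma dilate_chart:
  fixes p :: "'n::finite amb \<Rightarrow> 'a::field_char_0"
  assumes P: "cone_chart i\<^sub>0 i\<^sub>1 p c t" and l: "l \<noteq> 0"
  shows "cone_chart i\<^sub>0 i\<^sub>1 (\<lambda>i. l * p i) (l * c) t"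
    and "msubst (mpowr i\<^sub>0 (l * c) d) (\<lambda>i. mconst l * mvar i) = mpowr i\<^sub>0 c d"
    and "msubst (cone_chart.s i\<^sub>0 (\<lambda>i. l * p i) (l * c) t i) (\<lambda>i. mconst l * mvar i) = cone_chart.s i\<^sub>0 p c t i"
    and "msubst (cone_chart.eqn i\<^sub>0 i\<^sub>1 (\<lambda>i. l * p i) (l * c) t f) (\<lambda>i. mconst l * mvar i) = cone_chart.eqn i\<^sub>0 i\<^sub>1 p c t f"
proof -
  interpret P: cone_chart i\<^sub>0 i\<^sub>1 p c t by fact
  show P': "cone_chart i\<^sub>0 i\<^sub>1 (\<lambda>i. l * p i) (l * c) t"
    using P.i P.c l by unfold_locales (auto simp: P.p0 P.pMid)
  interpret P': cone_chart i\<^sub>0 i\<^sub>1 "\<lambda>i. l * p i" "l * c" t by fact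
  let ?D = "\<lambda>i. mconst l * mvar i :: ('n amb, 'a) mps"
  have ll: "mconst (1 / l) * mconst l = (1 :: ('n amb, 'a) mps)" using l by (simp flip: mconst_mult)
  show m: "msubst (mpowr i\<^sub>0 (l * c) d) ?D = mpowr i\<^sub>0 c d" for d
  proof -
    have "mconst (1 / (l * c)) * (mconst l * mvar i\<^sub>0) = mconst (1 / c) * (mvar i\<^sub>0 :: ('n amb, 'a) mps)"
      using l by (simp flip: mult.assoc mconst_mult)
    then show ?thesis unfolding mpowr_eq_binom by (simp add: msubst_binom)
  qed
  have x': "msubst P'.x' ?D = mconst (1 / l) * P.x'"
  proof -
    have "mconst (1 / (l * c)) = mconst (1 / l) * (mconst (1 / c) :: ('n amb, 'a) mps)"
      by (simp flip: mconst_mult)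
    then show ?thesis by (simp add: P'.x'_def P.x'_def m mult.assoc)
  qed
  have r: "msubst (coord (\<lambda>i. l * p i) j * P'.x') ?D = coord p j * P.x'" for j
  proof -
    have "msubst (coord (\<lambda>i. l * p i) j) ?D = mconst l * coord p j"
      by (simp add: coord_def mconst_mult distrib_left)
    then have "msubst (coord (\<lambda>i. l * p i) j * P'.x') ?D = (mconst l * coord p j) * (mconst (1 / l) * P.x')"
      using msubst_mult[of ?D "coord (\<lambda>i. l * p i) j" P'.x'] by (simp only: x') simp
    also have "\<dots> = (mconst (1 / l) * mconst l) * (coord p j * P.x')" by (simp only: mult_ac)
    finally show ?thesis unfolding ll by simp
  qed
  show s: "msubst (P'.s i) ?D = P.s i" for i
    unfolding P'.s_def P.s_def msubst_diff r by simp
  show "msubst (P'.eqn f) ?D = P.eqn f"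
    unfolding P'.eqn_def P.eqn_def msubst_diff r by (simp add: msubst_msubst s)
qed

lemma ray_eq_refl: "r (p First) \<noteq> 0 \<Longrightarrow> ray_eq r (p, \<phi>, h) (p, \<phi>, h)"
  unfolding ray_eq_def prod.case Let_def
  by (rule exI[of _ 1]) (simp add: delta_eq_refl)

lemma ray_eq_sym:
  fixes p :: "'n::finite amb \<Rightarrow> 'k::field_char_0"
  assumes "ray_eq r (p, \<phi>, h) (p', \<phi>', h')" and r: "r (p First) \<noteq> 0" "r (p' First) \<noteq> 0"
  shows "ray_eq r (p', \<phi>', h') (p, \<phi>, h)"
proof -
  let ?D = "\<lambda>l i. mconst (to_ac l) * mvar i" and ?N = "CARD('n) + 2"
  let ?k = "inverse ((r (p' First) / r (p First)) ^ ?N)" and ?k' = "inverse ((r (p First) / r (p' First)) ^ ?N)"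
  obtain l where l: "l \<noteq> 0" "p' = (\<lambda>i. l * p i)"
    and del: "delta_eq (msubst (mmap to_ac \<phi>') (?D l), msubst h' (?D l)) (mmap to_ac \<phi>, mconst ?k * h)"
    using assms(1) unfolding ray_eq_def prod.case Let_def by blast
  have inv: "msubst (msubst a (?D l)) (?D (1 / l)) = a" for a :: "('n amb, 'k alg_closure) mps"
    using l by (simp add: msubst_msubst flip: mult.assoc mconst_mult)
  have "delta_eq (mmap to_ac \<phi>', h') (msubst (mmap to_ac \<phi>) (?D (1 / l)), mconst ?k * msubst h (?D (1 / l)))"
    using delta_eq_msubst[OF del, of "?D (1 / l)"] unfolding inv by simp
  then have "delta_eq (msubst (mmap to_ac \<phi>) (?D (1 / l)), mconst ?k' * (mconst ?k * msubst h (?D (1 / l))))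
      (mmap to_ac \<phi>', mconst ?k' * h')"
    by (rule delta_eq_mult[OF delta_eq_sym])
  moreover have "?k' * ?k = 1" using r by (simp add: power_divide)
  then have "mconst ?k' * (mconst ?k * msubst h (?D (1 / l))) = msubst h (?D (1 / l))"
    by (simp only: mult.assoc[symmetric] mconst_mult[symmetric] mconst_1 mult_1_left)
  moreover have "1 / l \<noteq> 0" "p = (\<lambda>i. 1 / l * p' i)" using l by auto
  ultimately show ?thesis unfolding ray_eq_def prod.case Let_def by metis
qed

text \<open>The prefactor is formed from the quotient of the branch values at the two points, so the
  prefactors of consecutive dilations multiply to the prefactor of the composite.\<close>

lemma ray_eq_trans:
  fixes p :: "'n::finite amb \<Rightarrow> 'k::field_char_0"
  assumes "ray_eq r (p, \<phi>, h) (p', \<phi>', h')" "ray_eq r (p', \<phi>', h') (p'', \<phi>'', h'')" and r: "r (p' First) \<noteq> 0"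
  shows "ray_eq r (p, \<phi>, h) (p'', \<phi>'', h'')"
proof -
  let ?D = "\<lambda>l i. mconst (to_ac l) * mvar i" and ?N = "CARD('n) + 2"
  let ?k = "inverse ((r (p' First) / r (p First)) ^ ?N)" and ?k' = "inverse ((r (p'' First) / r (p' First)) ^ ?N)"
  obtain l where l: "l \<noteq> 0" "p' = (\<lambda>i. l * p i)"
    and del: "delta_eq (msubst (mmap to_ac \<phi>') (?D l), msubst h' (?D l)) (mmap to_ac \<phi>, mconst ?k * h)"
    using assms(1) unfolding ray_eq_def prod.case Let_def by blast
  obtain l' where l': "l' \<noteq> 0" "p'' = (\<lambda>i. l' * p' i)"
    and del': "delta_eq (msubst (mmap to_ac \<phi>'') (?D l'), msubst h'' (?D l')) (mmap to_ac \<phi>', mconst ?k' * h')"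
    using assms(2) unfolding ray_eq_def prod.case Let_def by blast
  have comp: "msubst (msubst a (?D l')) (?D l) = msubst a (?D (l' * l))" for a :: "('n amb, 'k alg_closure) mps"
    by (simp add: msubst_msubst mconst_mult mult.assoc)
  have "delta_eq (msubst (mmap to_ac \<phi>'') (?D (l' * l)), msubst h'' (?D (l' * l)))
      (msubst (mmap to_ac \<phi>') (?D l), mconst ?k' * msubst h' (?D l))"
    using delta_eq_msubst[OF del', of "?D l"] unfolding comp by simp
  then have "delta_eq (msubst (mmap to_ac \<phi>'') (?D (l' * l)), msubst h'' (?D (l' * l))) (mmap to_ac \<phi>, mconst ?k' * (mconst ?k * h))"
    by (rule delta_eq_trans) (rule delta_eq_mult[OF del])
  moreover have "?k' * ?k = inverse ((r (p'' First) / r (p First)) ^ ?N)" using r by (simp add: power_divide)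
  then have "mconst ?k' * (mconst ?k * h) = mconst (inverse ((r (p'' First) / r (p First)) ^ ?N)) * h"
    by (simp only: mult.assoc[symmetric] mconst_mult[symmetric])
  moreover have "l' * l \<noteq> 0" "p'' = (\<lambda>i. (l' * l) * p i)" using l l' by auto
  ultimately show ?thesis unfolding ray_eq_def prod.case Let_def by (metis to_ac_mult)
qed

text \<open>Dilation by \<open>c\<^sub>1 / c\<close> preserves all ratios, hence the equation and
  the pullback of \<open>g\<close>; the half-integral power contributes the quotient of the branch
  values. So every ray class of such a density has a representative with first coordinate
  \<open>c\<^sub>1\<close>.\<close>

lemma ray_eq_cone_distr:
  fixes p :: "'n::finite amb \<Rightarrow> 'k::field_char_0"
  assumes P: "cone_chart First Last p c t" "p Last = c * cterm f" and r: "r c \<noteq> 0" "r c\<^sub>1 \<noteq> 0" and c1: "c\<^sub>1 \<noteq> 0"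
    and G: "cone_distr First Last r c t f (mmap to_ac g) = (p, \<phi>', h')"
    and del: "delta_eq (mmap to_ac \<phi>, h) (mmap to_ac \<phi>', h')"
  shows "ray_eq r (p, \<phi>, h) (cone_distr First Last r c\<^sub>1 t f (mmap to_ac g))"
proof -
  let ?N = "CARD('n) + 2"
  interpret P: cone_chart First Last p c t by fact
  define l where "l = c\<^sub>1 / c"
  have l: "l \<noteq> 0" "l * c = c\<^sub>1" using P.c c1 by (auto simp: l_def)
  let ?p = "\<lambda>i. l * p i" and ?D = "\<lambda>i. mconst (to_ac l) * mvar i"
  interpret A: cone_chart First Last "to_ac \<circ> p" "to_ac c" "to_ac \<circ> t" by (rule P.chart_to_ac)
  interpret P1: cone_chart First Last ?p c\<^sub>1 t
    using dilate_chart(1)[OF P(1) l(1)] l(2) by simp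
  have pL: "?p Last = c\<^sub>1 * cterm f" using P(2) l(2) by (simp flip: mult.assoc)
  have l': "to_ac l \<noteq> 0" using l by simp
  have to: "to_ac \<circ> ?p = (\<lambda>i. to_ac l * (to_ac \<circ> p) i)" "to_ac c\<^sub>1 = to_ac l * to_ac c"
    by (auto simp flip: l(2))
  note dil = dilate_chart(2-4)[OF A.cone_chart_axioms l']
  have s: "msubst (mmap to_ac (P1.s i)) ?D = A.s i" for i
    unfolding P1.s_to_ac to by (rule dil(2))
  have e: "msubst (mmap to_ac (P1.eqn f)) ?D = mmap to_ac \<phi>'"
  proof -
    have "\<phi>' = P.eqn f" using G unfolding P.cone_distr_eq[OF P(2)] by auto
    then show ?thesis unfolding P1.eqn_to_ac to P.eqn_to_ac by (simp only: dil(3) P.eqn_to_ac)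
  qed
  let ?h1 = "msubst (mmap to_ac g) (\<lambda>i. mmap to_ac (P1.s i)) * (mconst (inverse (r c\<^sub>1 ^ ?N)) * mpowr First (to_ac c\<^sub>1) (hdeg TYPE('n)))"
  have m: "msubst (mpowr First (to_ac c\<^sub>1) (hdeg TYPE('n)) :: ('n amb, 'k alg_closure) mps) ?D = mpowr First (to_ac c) (hdeg TYPE('n))"
    unfolding to by (rule dil(1))
  have c0: "cterm (?D i) = 0" for i :: "'n amb" by simp
  have "msubst ?h1 ?D = msubst (mmap to_ac g) A.s * (mconst (inverse (r c\<^sub>1 ^ ?N)) * mpowr First (to_ac c) (hdeg TYPE('n)))"
  proof -
    have "msubst (msubst (mmap to_ac g) (\<lambda>i. mmap to_ac (P1.s i))) ?D = msubst (mmap to_ac g) A.s"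
      by (subst msubst_msubst) (simp_all add: s del: P1.s_to_ac)
    then show ?thesis by (simp only: msubst_mult[of ?D, OF c0] msubst_mconst m)
  qed
  also have "\<dots> = mconst (inverse ((r (?p First) / r (p First)) ^ ?N)) * h'"
  proof -
    have "h' = msubst (mmap to_ac g) A.s * (mconst (inverse (r c ^ ?N)) * mpowr First (to_ac c) (hdeg TYPE('n)))"
      using G unfolding P.cone_distr_eq[OF P(2)] by auto
    moreover have "inverse (r c\<^sub>1 ^ N) = inverse ((r (?p First) / r (p First)) ^ N) * inverse (r c ^ N)" for N
      using r unfolding P.p0 l(2) by (simp add: power_divide field_simps)
    ultimately show ?thesis by (simp only: mconst_mult mult_ac)
  qed
  finally have h1: "msubst ?h1 ?D = \<dots>" .
  have "delta_eq (msubst (mmap to_ac (P1.eqn f)) ?D, msubst ?h1 ?D)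
      (mmap to_ac \<phi>, mconst (inverse ((r (?p First) / r (p First)) ^ ?N)) * h)"
    unfolding e h1 by (rule delta_eq_mult) (rule delta_eq_sym[OF del])
  then show ?thesis unfolding P1.cone_distr_eq[OF pL] ray_eq_def prod.case Let_def using l(1) by blast
qed

text \<open>Both points have first coordinate \<open>c\<close>, so the dilation is the identity and
  the two distributions are equal. The graph form is unique, and pullback along the chart is
  injective.\<close>

lemma cone_distr_inject:
  fixes f f' g g' :: "('n::finite, 'k::field_char_0) mps"
  assumes r: "r c \<noteq> 0" and c: "c \<noteq> 0"
    and ray: "ray_eq r (cone_distr First Last r c t f (mmap to_ac g)) (cone_distr First Last r c t' f' (mmap to_ac g'))"
  shows "t' = t \<and> f' = f \<and> g' = g"
proof -
  obtain p where P: "cone_chart First Last p c t" "p Last = c * cterm f"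
    using cone_chart_point[of First Last c t "cterm f"] c by auto
  obtain p' where P': "cone_chart First Last p' c t'" "p' Last = c * cterm f'"
    using cone_chart_point[of First Last c t' "cterm f'"] c by auto
  interpret P: cone_chart First Last p c t by fact
  interpret P': cone_chart First Last p' c t' by fact
  interpret A: cone_chart First Last "to_ac \<circ> p" "to_ac c" "to_ac \<circ> t" by (rule P.chart_to_ac)
  define u :: "('n amb, 'k alg_closure) mps" where "u = mconst (inverse (r c ^ (CARD('n) + 2))) * mpowr First (to_ac c) (hdeg TYPE('n))"
  obtain l where l: "p' = (\<lambda>i. l * p i)"
    and del: "delta_eq (msubst (mmap to_ac (P'.eqn f')) (\<lambda>i. mconst (to_ac l) * mvar i),
        msubst (msubst (mmap to_ac g') (\<lambda>i. mmap to_ac (P'.s i)) * u) (\<lambda>i. mconst (to_ac l) * mvar i))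
      (mmap to_ac (P.eqn f), mconst (inverse ((r (p' First) / r (p First)) ^ (CARD('n) + 2))) * (msubst (mmap to_ac g) (\<lambda>i. mmap to_ac (P.s i)) * u))"
    using ray unfolding P.cone_distr_eq[OF P(2)] P'.cone_distr_eq[OF P'(2)] ray_eq_def prod.case Let_def u_def by blast
  have l1: "l = 1" using fun_cong[OF l, of First] P.p0 P'.p0 c by simp
  have p: "p' = p" using l l1 by simp
  have t: "t' = t" using P.pMid P'.pMid c unfolding p by (auto simp: fun_eq_iff)
  have "delta_eq (A.eqn (mmap to_ac f'), msubst (mmap to_ac g') A.s * u) (A.eqn (mmap to_ac f), msubst (mmap to_ac g) A.s * u)"
    using del r unfolding l1 p t by (simp add: P.p0)
  then have "delta_eq (coord (to_ac \<circ> p) Last - A.graph (mmap to_ac f'), A.x * (msubst (mmap to_ac g') A.s * u))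
      (coord (to_ac \<circ> p) Last - A.graph (mmap to_ac f), A.x * (msubst (mmap to_ac g) A.s * u))"
    using A.delta_eq_eqn delta_eq_sym delta_eq_trans by blast
  moreover have ind: "indep_of Last (A.x * (msubst a A.s * u))" for a
    by (simp add: indep_of_iff u_def A.mderiv_pullback_i1 mderiv_mpowr_neq A.mderiv_x)
  moreover have "cterm (A.graph (mmap to_ac f)) = (to_ac \<circ> p) Last" using P(2) by (simp add: A.graph_def)
  ultimately have eq: "A.graph (mmap to_ac f') = A.graph (mmap to_ac f) \<and> A.x * (msubst (mmap to_ac g') A.s * u) = A.x * (msubst (mmap to_ac g) A.s * u)"
    using A.indep_graph by (intro delta_eq_graph) assumption+
  have "msubst (mmap to_ac f') A.s = msubst (mmap to_ac f) A.s"
    using eq[THEN conjunct1] unfolding A.graph_def by (rule unit_cancel[rotated]) (simp add: c)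
  then have "f' = f" using A.pullback_inject by (metis mmap_to_ac_eq_iff)
  moreover have "(A.x * u) * msubst (mmap to_ac g') A.s = (A.x * u) * msubst (mmap to_ac g) A.s"
    using eq by (simp add: mult_ac)
  then have "msubst (mmap to_ac g') A.s = msubst (mmap to_ac g) A.s"
    by (rule unit_cancel[rotated]) (use c r in \<open>simp add: u_def\<close>)
  then have "g' = g" using A.pullback_inject by (metis mmap_to_ac_eq_iff)
  ultimately show ?thesis using t by simp
qed

section \<open>Ray classes and the correspondence\<close>

lemma equiv_ray_rel:
  assumes r: "sqrt_branch r"
  shows "equiv (fourier_cone_densities S r) (ray_rel S r)"
proof -
  have nz: "r (p First) \<noteq> 0" if "(p, \<phi>, h) \<in> fourier_cone_densities S r" for p \<phi> h
    using that sqrt_branch_nonzero[OF r] by (auto simp: fourier_cone_densities_def cone_density_def)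
  show ?thesis
  proof (rule equivI)
    show "refl_on (fourier_cone_densities S r) (ray_rel S r)"
      by (rule refl_onI) (auto simp: ray_rel_def intro!: ray_eq_refl nz)
    show "sym (ray_rel S r)"
    proof (rule symI)
      fix G G' assume "(G, G') \<in> ray_rel S r"
      moreover obtain p \<phi> h p' \<phi>' h' where "G = (p, \<phi>, h)" "G' = (p', \<phi>', h')" by (cases G, cases G') blast
      ultimately show "(G', G) \<in> ray_rel S r" unfolding ray_rel_def using ray_eq_sym nz by blast
    qed
    show "trans (ray_rel S r)"
    proof (rule transI)
      fix G G' G'' assume "(G, G') \<in> ray_rel S r" "(G', G'') \<in> ray_rel S r"
      moreover obtain p \<phi> h p' \<phi>' h' p'' \<phi>'' h''
        where "G = (p, \<phi>, h)" "G' = (p', \<phi>', h')" "G'' = (p'', \<phi>'', h'')"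
        by (cases G, cases G', cases G'') blast
      ultimately show "(G, G'') \<in> ray_rel S r" unfolding ray_rel_def using ray_eq_trans nz by blast
    qed
  qed (auto simp: ray_rel_def)
qed

lemma cone_distr_in_densities:
  fixes S :: "'k::field_char_0 setting" and rx ry :: "'k \<Rightarrow> 'k alg_closure"
  assumes S: "valid_setting S" and rx: "sqrt_branch rx" and ry: "sqrt_branch ry" and c: "c \<noteq> 0"
    and a: "(t, f, g) \<in> admissible_pairs S"
  shows "cone_distr First Last rx c t f (mmap to_ac g) \<in> (fourier_cone_densities S rx :: ('n::finite, 'k) distr set)"
proof -
  have f: "germ S f" "cterm (det (hess (\<lambda>i. i) f)) \<noteq> 0" and g: "germ S g" "g \<noteq> 0"
    and A: "\<And>k. k \<ge> 1 \<Longrightarrow> stat_coeff (\<lambda>i. i) f g k = 0"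
    using a unfolding admissible_pairs_def by auto
  obtain p where P: "cone_chart First Last p c t" "p Last = c * cterm f"
    using cone_chart_point[of First Last c t "cterm f"] c by auto
  interpret P: cone_chart First Last p c t by fact
  obtain \<phi> h where G: "cone_distr First Last rx c t f (mmap to_ac g) = (p, \<phi>, h)"
    using P.cone_distr_eq[OF P(2)] by blast
  have "cone_density S First Last (inverse (rx (fst (p, \<phi>, h) First) ^ (CARD('n) + 2))) (p, \<phi>, h)"
  proof -
    have "cone_density S First Last (1 * inverse (rx c ^ (CARD('n) + 2))) (cone_distr First Last rx c t f (mconst 1 * mmap to_ac g))"
      by (rule P.cone_density_cone_distr) (simp_all only: S P(2) sqrt_branch_nonzero[OF rx c] f g one_neq_zero not_False_eq_True)
    then show ?thesis by (simp add: G P.p0)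
  qed
  moreover have "\<exists>G' b. b ^ 2 \<in> range to_ac \<and> cone_density S Last First b G' \<and> fourier_related (p, \<phi>, h) G'"
  proof -
    obtain t' f' g' b where b: "b ^ 2 \<in> range to_ac"
      and dens: "cone_density S Last First (b * inverse (ry 1 ^ (CARD('n) + 2)))
        (cone_distr Last First ry 1 t' (- f') (mconst b * mmap to_ac g') :: ('n, 'k) distr)"
      and rel: "fourier_related (p, \<phi>, h) (cone_distr Last First ry 1 t' (- f') (mconst b * mmap to_ac g'))"
      using fourier_transform_exists[OF S rx ry P f g A] G delta_eq_refl one_neq_zero by metis
    \<comment> \<open>The transform is taken at d = 1, where the branch value is 1 or -1; hence the
      constant of the dual density still has its square in the ground field.\<close>
    have "ry 1 ^ 2 = 1" using ry by (simp add: sqrt_branch_def)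
    then have "(ry 1 ^ N) ^ 2 = 1" for N by (metis power_mult mult.commute power_one)
    then have "(b * inverse (ry 1 ^ (CARD('n) + 2))) ^ 2 = b ^ 2"
      by (simp only: power_mult_distrib power_inverse inverse_1 mult_1_right)
    then show ?thesis using b dens rel by metis
  qed
  ultimately show ?thesis unfolding G fourier_cone_densities_def by blast
qed

lemma densities_cone_distr:
  fixes S :: "'k::field_char_0 setting"
  assumes S: "valid_setting S" and rx: "sqrt_branch rx"
    and G: "(p, \<phi>, h) \<in> (fourier_cone_densities S rx :: ('n::finite, 'k) distr set)"
  obtains t f g \<phi>' h' where "cone_chart First Last p (p First) t" "p Last = p First * cterm f"
    "(t, f, g) \<in> admissible_pairs S" "cone_distr First Last rx (p First) t f (mmap to_ac g) = (p, \<phi>', h')"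
    "delta_eq (mmap to_ac \<phi>, h) (mmap to_ac \<phi>', h')"
proof -
  obtain q \<phi>'' h'' b where dens: "cone_density S First Last (inverse (rx (p First) ^ (CARD('n) + 2))) (p, \<phi>, h)"
    and dens': "cone_density S Last First b (q, \<phi>'', h'')" and rel: "fourier_related (p, \<phi>, h) (q, \<phi>'', h'')"
    using G unfolding fourier_cone_densities_def by (auto simp del: split_paired_All)
  obtain t f g \<phi>' h' where P: "cone_chart First Last p (p First) t" "p Last = p First * cterm f"
    and gm: "germ S f" "germ S g" "g \<noteq> 0" and D: "cone_distr First Last rx (p First) t f (mmap to_ac g) = (p, \<phi>', h')"
    and del: "delta_eq (mmap to_ac \<phi>, h) (mmap to_ac \<phi>', h')"
    using density_representation[OF S rx dens] by metis
  interpret P: cone_chart First Last p "p First" t by fact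
  have "q Last \<noteq> 0" using dens' by (simp add: cone_density_def)
  then have "(t, f, g) \<in> admissible_pairs S"
    using fourier_related_admissible[OF P sqrt_branch_nonzero[OF rx P.c] D del rel] gm
    by (simp add: admissible_pairs_def)
  then show ?thesis using that P D del by blast
qed

text \<open>The constant \<open>c\<close> picks the point with \<open>x\<^sub>0 = c\<close> on each
  ray as the place where the density of a pair is written down. The second conjunct makes the
  transform explicit along the whole dual ray: the same data serve every \<open>d\<close>.\<close>

theorem theorem3p1p1:
  fixes S :: "'k::field_char_0 setting"
    and rx ry :: "'k \<Rightarrow> 'k alg_closure"
    and c :: 'k
  assumes "valid_setting S"
    and "sqrt_branch rx" and "sqrt_branch ry"
    and "c \<noteq> 0"
  shows "bij_betw
           (\<lambda>(t, f, g). ray_rel S rx `` {cone_distr First Last rx c t f (mmap to_ac g)})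
           (admissible_pairs S :: (('n::finite \<Rightarrow> 'k) \<times> ('n, 'k) mps \<times> ('n, 'k) mps) set)
           (fourier_cone_densities S rx // ray_rel S rx)
       \<and> (\<forall>G \<in> (fourier_cone_densities S rx :: ('n, 'k) distr set).
            \<exists>t' f' g' b. germ S f' \<and> germ S g' \<and> b ^ 2 \<in> range to_ac \<and>
              (\<forall>d. d \<noteq> 0 \<longrightarrow>
                 (let G' = cone_distr Last First ry d t' (- f') (mconst b * mmap to_ac g') in
                    cone_density S Last First (b * inverse (ry d ^ (CARD('n) + 2))) G' \<and>
                    fourier_related G G')))"
proof (intro conjI ballI)
  note S = assms(1) and rx = assms(2) and ry = assms(3) and c = assms(4)
  let ?A = "admissible_pairs S :: (('n \<Rightarrow> 'k) \<times> ('n, 'k) mps \<times> ('n, 'k) mps) set"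
  let ?D = "fourier_cone_densities S rx :: ('n, 'k) distr set" and ?R = "ray_rel S rx :: ('n, 'k) distr rel"
  let ?G = "\<lambda>t f g. cone_distr First Last rx c t f (mmap to_ac g) :: ('n, 'k) distr"
  have eq: "equiv ?D ?R" by (rule equiv_ray_rel[OF rx])
  have mem: "?G t f g \<in> ?D" if "(t, f, g) \<in> ?A" for t f g
    by (rule cone_distr_in_densities[OF S rx ry c that])
  have rc: "rx c \<noteq> 0" by (rule sqrt_branch_nonzero[OF rx c])
  show "bij_betw (\<lambda>(t, f, g). ?R `` {?G t f g}) ?A (?D // ?R)"
    unfolding bij_betw_def
  proof
    show "inj_on (\<lambda>(t, f, g). ?R `` {?G t f g}) ?A"
    proof (rule inj_onI)
      fix a a' assume a: "a \<in> ?A" "a' \<in> ?A"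
        and e: "(\<lambda>(t, f, g). ?R `` {?G t f g}) a = (\<lambda>(t, f, g). ?R `` {?G t f g}) a'"
      obtain t f g t' f' g' where aa: "a = (t, f, g)" "a' = (t', f', g')" by (cases a, cases a') blast
      have "?R `` {?G t f g} = ?R `` {?G t' f' g'}" using e by (simp add: aa)
      then have "(?G t f g, ?G t' f' g') \<in> ?R" by (rule eq_equiv_class[OF _ eq mem[OF a(2)[unfolded aa]]])
      then have "ray_eq rx (?G t f g) (?G t' f' g')" by (simp add: ray_rel_def)
      from cone_distr_inject[OF rc c this] show "a = a'" by (simp add: aa)
    qed
    show "(\<lambda>(t, f, g). ?R `` {?G t f g}) ` ?A = ?D // ?R"
    proof (intro equalityI subsetI)
      fix C assume "C \<in> (\<lambda>(t, f, g). ?R `` {?G t f g}) ` ?A"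
      then show "C \<in> ?D // ?R" using mem by (auto intro: quotientI)
    next
      fix C assume "C \<in> ?D // ?R"
      then obtain p \<phi> h where G: "(p, \<phi>, h) \<in> ?D" and C: "C = ?R `` {(p, \<phi>, h)}"
        by (auto elim!: quotientE)
      obtain t f g \<phi>' h' where P: "cone_chart First Last p (p First) t" "p Last = p First * cterm f"
        and a: "(t, f, g) \<in> ?A" and D: "cone_distr First Last rx (p First) t f (mmap to_ac g) = (p, \<phi>', h')"
        "delta_eq (mmap to_ac \<phi>, h) (mmap to_ac \<phi>', h')"
        using densities_cone_distr[OF S rx G] .
      interpret P: cone_chart First Last p "p First" t by fact
      \<comment> \<open>The density has an arbitrary base point on its ray; it is moved to the point
        with first coordinate \<open>c\<close>.\<close>
      have "ray_eq rx (p, \<phi>, h) (?G t f g)"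
        by (rule ray_eq_cone_distr[OF P sqrt_branch_nonzero[OF rx P.c] rc c D])
      then have "((p, \<phi>, h), ?G t f g) \<in> ?R" using G mem[OF a] by (simp add: ray_rel_def)
      then have "C = ?R `` {?G t f g}" unfolding C by (rule equiv_class_eq[OF eq])
      then show "C \<in> (\<lambda>(t, f, g). ?R `` {?G t f g}) ` ?A" using a by force
    qed
  qed
  \<comment> \<open>Here the pair is read off at the base point of \<open>G\<close> itself, since
    the transform asserted is that of \<open>G\<close> and not of another member of its ray
    class.\<close>
  fix G assume "G \<in> ?D"
  moreover obtain p \<phi> h where pq: "G = (p, \<phi>, h)" by (cases G) auto
  ultimately have G: "(p, \<phi>, h) \<in> ?D" by simp
  obtain t f g \<phi>' h' where P: "cone_chart First Last p (p First) t" "p Last = p First * cterm f"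
    and a: "(t, f, g) \<in> ?A" and D: "cone_distr First Last rx (p First) t f (mmap to_ac g) = (p, \<phi>', h')"
    "delta_eq (mmap to_ac \<phi>, h) (mmap to_ac \<phi>', h')"
    using densities_cone_distr[OF S rx G] .
  have f: "germ S f" "cterm (det (hess (\<lambda>i. i) f)) \<noteq> 0" and g: "germ S g" "g \<noteq> 0"
    and A: "\<And>k. k \<ge> 1 \<Longrightarrow> stat_coeff (\<lambda>i. i) f g k = 0"
    using a unfolding admissible_pairs_def by auto
  show "\<exists>t' f' g' b. germ S f' \<and> germ S g' \<and> b ^ 2 \<in> range to_ac \<and>
      (\<forall>d. d \<noteq> 0 \<longrightarrow>
         (let G' = cone_distr Last First ry d t' (- f') (mconst b * mmap to_ac g') in
            cone_density S Last First (b * inverse (ry d ^ (CARD('n) + 2))) G' \<and> fourier_related G G'))"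
    unfolding pq Let_def using fourier_transform_exists[OF S rx ry P f g A] D by metis
qed

end
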